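(* Let $(E,\|\cdot\|)$ be a complete random normed module over $\mathbb{R}$ with base $(\Omega,\mathcal{F},P)$ having full support. An operator $T:\mathscr{C}(E)\to\mathscr{C}(E)$ is a stable order preserving involution if and only if there exist $c\in E$, $w\in E^*$ and a continuous module automorphism $H$ of $E$ satisfying $H^2=ID_E$, $c\in Ker(H+ID_E)$, $w\in Ker(H^*+ID_{E^*})$, such that $$T(f)(x)=f(H(x)+c)+w(x)-\tfrac12 w(c)\qquad\text{for all } x\in E \text{ and } f\in\mathscr{C}(E).$$
   Context: $(\Omega,\mathcal{F},P)$ is a probability space. $L^0(\mathcal{F})$ is the algebra of equivalence classes (under a.s. equality) of real-valued random variables, and $\bar L^0(\mathcal{F})$ is the set of equivalence classes of extended real-valued random variables, ordered by $\xi\le\eta$ iff $\xi\le\eta$ a.s.; it is a complete lattice, and $\vee H,\wedge H$ denote supremum and infimum. "$\xi>\eta$ on $A$" means $\xi(\omega)>\eta(\omega)$ for almost all $\omega\in A$. $L^0_+(\mathcal{F})=\{\xi\in L^0(\mathcal{F}):\xi\ge 0\}$. $\tilde I_A$ is the class of the characteristic function of $A\in\mathcal{F}$, $A^c=\Omega\setminus A$. Convention: $0\cdot(+\infty)=0$. A random normed (RN) module over $\mathbb{R}$ with base $(\Omega,\mathcal{F},P)$ is an $L^0(\mathcal{F})$-module $E$ with a map $\|\cdot\|:E\to L^0_+(\mathcal{F})$ such that $\|\xi x\|=|\xi|\|x\|$, $\|x+y\|\le\|x\|+\|y\|$, and $\|x\|=0$ implies $x=\theta$ (the null element), for all $\xi\in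 L^0(\mathcal{F})$, $x,y\in E$. It carries the $(\varepsilon,\lambda)$-topology, a metrizable linear topology with local base at $\theta$ the sets $\{x:P(\|x\|<\varepsilon)>1-\lambda\}$, $\varepsilon>0$, $0<\lambda<1$ (so $x_n\to x$ iff $\|x_n-x\|\to0$ in probability); completeness, closedness and continuity refer to this topology. $L^0(\mathcal{F})$ is an RN module with $|\cdot|$. $E$ has full support if $\vee\{\|x\|:x\in E\}>0$ on $\Omega$. $E^*$ is the $L^0(\mathcal{F})$-module of continuous module homomorphisms $E\to L^0(\mathcal{F})$. For a continuous module homomorphism $H:E\to E$, $H^*:E^*\to E^*$ is $H^*(u)(x)=u(H(x))$. $ID_E$, $ID_{E^*}$ are the identity operators; $Ker$ denotes kernel. $\mathscr{C}(E)$ is the set of proper lower semicontinuous $L^0$-convex functions, i.e. maps $f:E\to\bar L^0(\mathcal{F})$ such that: (1) $f(x)>-\infty$ on $\Omega$ for all $x\in E$; (2) $dom(f)=\{x\in E:f(x)<+\infty\text{ on }\Omega\}\neq\emptyset$; (3) $f(\xi x+(1-\xi)y)\le\xi f(x)+(1-\xi)f(y)$ for all $x,y\in E$ and $\xi\in L^0_+(\mathcal{F})$ with $0\le\xi\le1$; (4) $epi(f)=\{(x,r)\in E\times L^0(\mathcal{F}):f(x)\le r\}$ is closed in the RN module $E\times L^0(\mathcal{F})$ with $L^0$-norm $\|x\|+|r|$. For $f,g\in\mathscr{C}(E)$, $f\le g$ means $f(x)\le g(x)$ for all $x\in E$; $\tilde I_Af+\tilde I_{A^c}g$ is defined pointwise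 and belongs to $\mathscr{C}(E)$. An operator $T:\mathscr{C}(E)\to\mathscr{C}(E)$ is order preserving if $f\le g$ implies $T(f)\le T(g)$; stable if $T(\tilde I_Af+\tilde I_{A^c}g)=\tilde I_AT(f)+\tilde I_{A^c}T(g)$ for all $A\in\mathcal{F}$, $f,g\in\mathscr{C}(E)$; an involution if $T(T(f))=f$ for all $f\in\mathscr{C}(E)$. *)

theory Defs
  imports "HOL-Probability.Probability" "HOL-Algebra.AbelCoset" "HOL-Algebra.Module"
    "HOL-Algebra.Complete_Lattice"
begin

section \<open>Equivalence classes of random variables\<close>

definition ae_eq :: "'w measure \<Rightarrow> (('w \<Rightarrow> 'b::topological_space) \<times> ('w \<Rightarrow> 'b)) set" where
  "ae_eq M = {(f, g). f \<in> borel_measurable M \<and> g \<in> borel_measurable M \<and> (AE \<omega> in M. f \<omega> = g \<omega>)}"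

definition rv :: "'w measure \<Rightarrow> ('w \<Rightarrow> 'b::topological_space) set set" where
  "rv M = borel_measurable M // ae_eq M"

definition rv_class :: "'w measure \<Rightarrow> ('w \<Rightarrow> 'b::topological_space) \<Rightarrow> ('w \<Rightarrow> 'b) set" where
  "rv_class M f = ae_eq M `` {f}"

definition rv_const :: "'w measure \<Rightarrow> 'b::topological_space \<Rightarrow> ('w \<Rightarrow> 'b) set" where
  "rv_const M c = rv_class M (\<lambda>_. c)"

definition rv_ind :: "'w measure \<Rightarrow> 'w set \<Rightarrow> ('w \<Rightarrow> 'b::{topological_space, zero_neq_one}) set" where
  "rv_ind M A = rv_class M (indicator A)"

definition rv_map ::
  "'w measure \<Rightarrow> ('a::topological_space \<Rightarrow> 'b::topological_space) \<Rightarrow> ('w \<Rightarrow> 'a) set \<Rightarrow> ('w \<Rightarrow> 'b) set" where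
  "rv_map M h X = (\<Union>f\<in>X. rv_class M (\<lambda>\<omega>. h (f \<omega>)))"

definition rv_map2 ::
  "'w measure \<Rightarrow> ('a::topological_space \<Rightarrow> 'b::topological_space \<Rightarrow> 'c::topological_space)
    \<Rightarrow> ('w \<Rightarrow> 'a) set \<Rightarrow> ('w \<Rightarrow> 'b) set \<Rightarrow> ('w \<Rightarrow> 'c) set" where
  "rv_map2 M h X Y = (\<Union>f\<in>X. \<Union>g\<in>Y. rv_class M (\<lambda>\<omega>. h (f \<omega>) (g \<omega>)))"

definition rv_le :: "'w measure \<Rightarrow> ('w \<Rightarrow> 'b::{topological_space, ord}) set \<Rightarrow> ('w \<Rightarrow> 'b) set \<Rightarrow> bool" where
  "rv_le M X Y \<longleftrightarrow> (\<exists>f\<in>X. \<exists>g\<in>Y. AE \<omega> in M. f \<omega> \<le> g \<omega>)"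

text \<open>This is strict inequality almost everywhere on the whole space, not the strict part of
  \<^const>\<open>rv_le\<close>.\<close>

definition rv_less :: "'w measure \<Rightarrow> ('w \<Rightarrow> 'b::{topological_space, ord}) set \<Rightarrow> ('w \<Rightarrow> 'b) set \<Rightarrow> bool" where
  "rv_less M X Y \<longleftrightarrow> (\<exists>f\<in>X. \<exists>g\<in>Y. AE \<omega> in M. f \<omega> < g \<omega>)"

lemma equiv_ae_eq: "equiv (borel_measurable M) (ae_eq M)"
  by (rule equivI) (auto simp: ae_eq_def refl_on_def sym_def trans_def)

lemma rv_class_in_rv [intro]: "f \<in> borel_measurable M \<Longrightarrow> rv_class M f \<in> rv M"
  by (simp add: rv_class_def rv_def quotientI)

lemma rv_cases:
  assumes "X \<in> rv M"
  obtains f where "f \<in> borel_measurable M" "X = rv_class M f"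
  using assms unfolding rv_def rv_class_def by (rule quotientE) blast

lemma mem_rv_class_iff:
  "f \<in> borel_measurable M \<Longrightarrow>
    g \<in> rv_class M f \<longleftrightarrow> g \<in> borel_measurable M \<and> (AE \<omega> in M. f \<omega> = g \<omega>)"
  by (auto simp: rv_class_def ae_eq_def)

lemma rv_class_eq_iff:
  assumes "f \<in> borel_measurable M" "g \<in> borel_measurable M"
  shows "rv_class M f = rv_class M g \<longleftrightarrow> (AE \<omega> in M. f \<omega> = g \<omega>)"
  using eq_equiv_class_iff[OF equiv_ae_eq, of f M g] assms
  by (simp add: rv_class_def) (simp add: ae_eq_def)

lemma rv_map_class:
  fixes M :: "'w measure" and h :: "'a::topological_space \<Rightarrow> 'b::topological_space"
  assumes h: "\<And>g. g \<in> borel_measurable M \<Longrightarrow> (\<lambda>\<omega>. h (g \<omega>)) \<in> borel_measurable M"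
    and f: "f \<in> borel_measurable M"
  shows "rv_map M h (rv_class M f) = rv_class M (\<lambda>\<omega>. h (f \<omega>))"
proof -
  have "(\<lambda>f. rv_class M (\<lambda>\<omega>. h (f \<omega>))) respects ae_eq M"
  proof (rule congruentI)
    fix f f' :: "'w \<Rightarrow> 'a"
    assume *: "(f, f') \<in> ae_eq M"
    then have "AE \<omega> in M. f \<omega> = f' \<omega>"
      by (simp add: ae_eq_def)
    then have "AE \<omega> in M. h (f \<omega>) = h (f' \<omega>)"
      by eventually_elim simp
    with * show "rv_class M (\<lambda>\<omega>. h (f \<omega>)) = rv_class M (\<lambda>\<omega>. h (f' \<omega>))"
      by (subst rv_class_eq_iff) (simp_all add: ae_eq_def h)
  qed
  from UN_equiv_class[OF equiv_ae_eq this f] show ?thesis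
    by (simp add: rv_map_def rv_class_def)
qed

lemma rv_map2_class:
  fixes M :: "'w measure"
    and h :: "'a::topological_space \<Rightarrow> 'b::topological_space \<Rightarrow> 'c::topological_space"
  assumes h: "\<And>f g. f \<in> borel_measurable M \<Longrightarrow> g \<in> borel_measurable M \<Longrightarrow>
      (\<lambda>\<omega>. h (f \<omega>) (g \<omega>)) \<in> borel_measurable M"
    and f: "f \<in> borel_measurable M" and g: "g \<in> borel_measurable M"
  shows "rv_map2 M h (rv_class M f) (rv_class M g) = rv_class M (\<lambda>\<omega>. h (f \<omega>) (g \<omega>))"
proof -
  have "congruent2 (ae_eq M) (ae_eq M) (\<lambda>f g. rv_class M (\<lambda>\<omega>. h (f \<omega>) (g \<omega>)))"
  proof (rule congruent2I')
    fix f f' :: "'w \<Rightarrow> 'a" and g g' :: "'w \<Rightarrow> 'b"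
    assume *: "(f, f') \<in> ae_eq M" "(g, g') \<in> ae_eq M"
    then have "AE \<omega> in M. f \<omega> = f' \<omega>" "AE \<omega> in M. g \<omega> = g' \<omega>"
      by (simp_all add: ae_eq_def)
    then have "AE \<omega> in M. h (f \<omega>) (g \<omega>) = h (f' \<omega>) (g' \<omega>)"
      by eventually_elim simp
    with * show "rv_class M (\<lambda>\<omega>. h (f \<omega>) (g \<omega>)) = rv_class M (\<lambda>\<omega>. h (f' \<omega>) (g' \<omega>))"
      by (subst rv_class_eq_iff) (simp_all add: ae_eq_def h)
  qed
  from UN_equiv_class2[OF equiv_ae_eq equiv_ae_eq this f g] show ?thesis
    by (simp add: rv_map2_def rv_class_def)
qed

lemma rv_le_class:
  fixes f g :: "'w \<Rightarrow> 'b::{topological_space, ord}"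
  assumes "f \<in> borel_measurable M" "g \<in> borel_measurable M"
  shows "rv_le M (rv_class M f) (rv_class M g) \<longleftrightarrow> (AE \<omega> in M. f \<omega> \<le> g \<omega>)"
proof
  assume "rv_le M (rv_class M f) (rv_class M g)"
  then obtain f' g' where "AE \<omega> in M. f \<omega> = f' \<omega>" "AE \<omega> in M. g \<omega> = g' \<omega>" "AE \<omega> in M. f' \<omega> \<le> g' \<omega>"
    using assms by (auto simp: rv_le_def mem_rv_class_iff)
  then show "AE \<omega> in M. f \<omega> \<le> g \<omega>" by eventually_elim simp
next
  have "f \<in> rv_class M f" "g \<in> rv_class M g"
    using assms by (simp_all add: mem_rv_class_iff)
  moreover assume "AE \<omega> in M. f \<omega> \<le> g \<omega>"
  ultimately show "rv_le M (rv_class M f) (rv_class M g)"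
    unfolding rv_le_def by blast
qed

lemma rv_less_class:
  fixes f g :: "'w \<Rightarrow> 'b::{topological_space, ord}"
  assumes "f \<in> borel_measurable M" "g \<in> borel_measurable M"
  shows "rv_less M (rv_class M f) (rv_class M g) \<longleftrightarrow> (AE \<omega> in M. f \<omega> < g \<omega>)"
proof
  assume "rv_less M (rv_class M f) (rv_class M g)"
  then obtain f' g' where "AE \<omega> in M. f \<omega> = f' \<omega>" "AE \<omega> in M. g \<omega> = g' \<omega>" "AE \<omega> in M. f' \<omega> < g' \<omega>"
    using assms by (auto simp: rv_less_def mem_rv_class_iff)
  then show "AE \<omega> in M. f \<omega> < g \<omega>" by eventually_elim simp
next
  have "f \<in> rv_class M f" "g \<in> rv_class M g"
    using assms by (simp_all add: mem_rv_class_iff)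
  moreover assume "AE \<omega> in M. f \<omega> < g \<omega>"
  ultimately show "rv_less M (rv_class M f) (rv_class M g)"
    unfolding rv_less_def by blast
qed


section \<open>Random normed modules\<close>

record ('w, 'e) rn_module = "(('w \<Rightarrow> real) set, 'e) module" +
  rnorm :: "'e \<Rightarrow> ('w \<Rightarrow> real) set"

text \<open>\<open>L0 M\<close> serves both as the scalar ring and as a random normed module over itself.\<close>

definition L0 :: "'w measure \<Rightarrow> ('w, ('w \<Rightarrow> real) set) rn_module" where
  "L0 M = \<lparr>carrier = rv M, mult = rv_map2 M (*), one = rv_const M 1,
    zero = rv_const M 0, add = rv_map2 M (+), smult = rv_map2 M (*), rnorm = rv_map M abs\<rparr>"

definition L0_plus :: "'w measure \<Rightarrow> ('w \<Rightarrow> real) set set" where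
  "L0_plus M = {\<xi> \<in> carrier (L0 M). rv_le M \<zero>\<^bsub>L0 M\<^esub> \<xi>}"

definition L0bar :: "'w measure \<Rightarrow> ('w \<Rightarrow> ereal) set gorder" where
  "L0bar M = \<lparr>carrier = rv M, eq = (=), le = rv_le M\<rparr>"

abbreviation to_L0bar :: "'w measure \<Rightarrow> ('w \<Rightarrow> real) set \<Rightarrow> ('w \<Rightarrow> ereal) set" where
  "to_L0bar M \<equiv> rv_map M ereal"

text \<open>The products below use \<open>0 * \<infinity> = 0\<close>, which is the convention of \<^typ>\<open>ereal\<close>.\<close>

abbreviation L0bar_add :: "'w measure \<Rightarrow> ('w \<Rightarrow> ereal) set \<Rightarrow> ('w \<Rightarrow> ereal) set \<Rightarrow> ('w \<Rightarrow> ereal) set" where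
  "L0bar_add M \<equiv> rv_map2 M (+)"

abbreviation L0bar_mult :: "'w measure \<Rightarrow> ('w \<Rightarrow> ereal) set \<Rightarrow> ('w \<Rightarrow> ereal) set \<Rightarrow> ('w \<Rightarrow> ereal) set" where
  "L0bar_mult M \<equiv> rv_map2 M (*)"

locale rn_module = prob_space M + Module.module "L0 M" E
  for M :: "'w measure" and E :: "('w, 'e) rn_module" (structure) +
  assumes rnorm_closed: "x \<in> carrier E \<Longrightarrow> rnorm E x \<in> L0_plus M"
    and rnorm_smult: "\<xi> \<in> carrier (L0 M) \<Longrightarrow> x \<in> carrier E \<Longrightarrow>
      rnorm E (\<xi> \<odot> x) = rv_map M abs \<xi> \<otimes>\<^bsub>L0 M\<^esub> rnorm E x"
    and rnorm_triangle: "x \<in> carrier E \<Longrightarrow> y \<in> carrier E \<Longrightarrow>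
      rv_le M (rnorm E (x \<oplus> y)) (rnorm E x \<oplus>\<^bsub>L0 M\<^esub> rnorm E y)"
    and rnorm_eq_zero: "x \<in> carrier E \<Longrightarrow> rnorm E x = \<zero>\<^bsub>L0 M\<^esub> \<Longrightarrow> x = \<zero>"

lemma carrier_L0 [simp]: "carrier (L0 M) = rv M"
  by (simp add: L0_def)

lemma L0_zero: "\<zero>\<^bsub>L0 M\<^esub> = rv_class M (\<lambda>_. 0)"
  and L0_one: "\<one>\<^bsub>L0 M\<^esub> = rv_class M (\<lambda>_. 1)"
  by (simp_all add: L0_def rv_const_def)

lemma L0_abs_class:
  "f \<in> borel_measurable M \<Longrightarrow> rnorm (L0 M) (rv_class M f) = rv_class M (\<lambda>\<omega>. \<bar>f \<omega>\<bar>)"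
  "f \<in> borel_measurable M \<Longrightarrow> rv_map M abs (rv_class M f) = rv_class M (\<lambda>\<omega>. \<bar>f \<omega> :: real\<bar>)"
  by (simp_all add: L0_def rv_map_class)

lemma L0_class_simps:
  assumes "f \<in> borel_measurable M" "g \<in> borel_measurable M"
  shows "rv_class M f \<oplus>\<^bsub>L0 M\<^esub> rv_class M g = rv_class M (\<lambda>\<omega>. f \<omega> + g \<omega>)"
    and "rv_class M f \<otimes>\<^bsub>L0 M\<^esub> rv_class M g = rv_class M (\<lambda>\<omega>. f \<omega> * g \<omega>)"
    and "rv_class M f \<odot>\<^bsub>L0 M\<^esub> rv_class M g = rv_class M (\<lambda>\<omega>. f \<omega> * g \<omega>)"
  using assms by (simp_all add: L0_def rv_map2_class)

lemma abelian_group_L0: "abelian_group (L0 M)"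
proof (rule abelian_groupI)
  fix X assume "X \<in> carrier (L0 M)"
  then obtain f where f [measurable]: "f \<in> borel_measurable M" and X: "X = rv_class M f"
    by (auto elim: rv_cases)
  have "rv_class M (\<lambda>\<omega>. - f \<omega>) \<oplus>\<^bsub>L0 M\<^esub> X = \<zero>\<^bsub>L0 M\<^esub>"
    unfolding X by (simp add: L0_class_simps(1) L0_zero)
  moreover have "rv_class M (\<lambda>\<omega>. - f \<omega>) \<in> carrier (L0 M)"
    by (simp add: rv_class_in_rv)
  ultimately show "\<exists>Y\<in>carrier (L0 M). Y \<oplus>\<^bsub>L0 M\<^esub> X = \<zero>\<^bsub>L0 M\<^esub>"
    by blast
qed (auto elim!: rv_cases simp: L0_class_simps L0_zero rv_class_in_rv add_ac)

lemma cring_L0: "cring (L0 M)"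
  by (rule cringI[OF abelian_group_L0 comm_monoidI])
    (auto elim!: rv_cases simp: L0_class_simps L0_one rv_class_in_rv mult_ac distrib_left)

lemma module_L0: "Module.module (L0 M) (L0 M)"
  by (rule moduleI[OF cring_L0 abelian_group_L0])
    (auto elim!: rv_cases simp: L0_class_simps L0_one rv_class_in_rv mult_ac distrib_left)

lemma rn_module_L0:
  assumes "prob_space M"
  shows "rn_module M (L0 M)"
proof -
  interpret prob_space M by fact
  interpret Module.module "L0 M" "L0 M" by (rule module_L0)
  show ?thesis
  proof
    fix X \<xi> :: "('a \<Rightarrow> real) set"
    assume "X \<in> carrier (L0 M)" "\<xi> \<in> carrier (L0 M)"
    then obtain f g where [measurable]: "f \<in> borel_measurable M" "g \<in> borel_measurable M"
      and X: "X = rv_class M f" and \<xi>: "\<xi> = rv_class M g"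
      by (auto elim!: rv_cases)
    show "rnorm (L0 M) X \<in> L0_plus M"
      by (simp add: X L0_abs_class L0_plus_def L0_zero rv_le_class rv_class_in_rv)
    show "rnorm (L0 M) (\<xi> \<odot>\<^bsub>L0 M\<^esub> X) = rv_map M abs \<xi> \<otimes>\<^bsub>L0 M\<^esub> rnorm (L0 M) X"
      by (simp add: X \<xi> L0_abs_class L0_class_simps abs_mult)
    show "rv_le M (rnorm (L0 M) (X \<oplus>\<^bsub>L0 M\<^esub> \<xi>)) (rnorm (L0 M) X \<oplus>\<^bsub>L0 M\<^esub> rnorm (L0 M) \<xi>)"
      by (simp add: X \<xi> L0_abs_class L0_class_simps rv_le_class abs_triangle_ineq)
    show "X = \<zero>\<^bsub>L0 M\<^esub>" if "rnorm (L0 M) X = \<zero>\<^bsub>L0 M\<^esub>"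
      using that by (simp add: X L0_abs_class L0_zero rv_class_eq_iff)
  qed
qed

definition rn_ball :: "'w measure \<Rightarrow> ('w, 'e) rn_module \<Rightarrow> 'e \<Rightarrow> real \<Rightarrow> real \<Rightarrow> 'e set" where
  "rn_ball M E x \<epsilon> \<delta> = {y \<in> carrier E. \<exists>f\<in>rnorm E (y \<ominus>\<^bsub>E\<^esub> x).
    measure M {\<omega> \<in> space M. f \<omega> < \<epsilon>} > 1 - \<delta>}"

definition rn_topology :: "'w measure \<Rightarrow> ('w, 'e) rn_module \<Rightarrow> 'e topology" where
  "rn_topology M E = topology (\<lambda>U. U \<subseteq> carrier E \<and>
    (\<forall>x\<in>U. \<exists>\<epsilon> \<delta>. 0 < \<epsilon> \<and> 0 < \<delta> \<and> \<delta> < 1 \<and> rn_ball M E x \<epsilon> \<delta> \<subseteq> U))"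

lemma (in rn_module) rn_ball_mono:
  assumes "x \<in> carrier E" "\<epsilon> \<le> \<epsilon>'" "\<delta> \<le> \<delta>'"
  shows "rn_ball M E x \<epsilon> \<delta> \<subseteq> rn_ball M E x \<epsilon>' \<delta>'"
proof
  fix y assume "y \<in> rn_ball M E x \<epsilon> \<delta>"
  then obtain f where y: "y \<in> carrier E" and f: "f \<in> rnorm E (y \<ominus> x)"
    and lt: "1 - \<delta> < prob {\<omega> \<in> space M. f \<omega> < \<epsilon>}"
    by (auto simp: rn_ball_def)
  have "rnorm E (y \<ominus> x) \<in> rv M"
    using rnorm_closed[of "y \<ominus> x"] y assms(1) by (simp add: L0_plus_def)
  with f have [measurable]: "f \<in> borel_measurable M"
    by (auto elim!: rv_cases simp: mem_rv_class_iff)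
  have "prob {\<omega> \<in> space M. f \<omega> < \<epsilon>} \<le> prob {\<omega> \<in> space M. f \<omega> < \<epsilon>'}"
    using assms(2) by (intro finite_measure_mono) auto
  with lt assms(3) have "1 - \<delta>' < prob {\<omega> \<in> space M. f \<omega> < \<epsilon>'}"
    by linarith
  with y f show "y \<in> rn_ball M E x \<epsilon>' \<delta>'"
    by (auto simp: rn_ball_def)
qed

lemma (in rn_module) openin_rn_topology:
  "openin (rn_topology M E) U \<longleftrightarrow> U \<subseteq> carrier E \<and>
    (\<forall>x\<in>U. \<exists>\<epsilon> \<delta>. 0 < \<epsilon> \<and> 0 < \<delta> \<and> \<delta> < 1 \<and> rn_ball M E x \<epsilon> \<delta> \<subseteq> U)"
proof -
  let ?P = "\<lambda>U. U \<subseteq> carrier E \<and>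
    (\<forall>x\<in>U. \<exists>\<epsilon> \<delta>. 0 < \<epsilon> \<and> 0 < \<delta> \<and> \<delta> < 1 \<and> rn_ball M E x \<epsilon> \<delta> \<subseteq> U)"
  have "?P (S \<inter> T)" if S: "?P S" and T: "?P T" for S T
  proof (intro conjI ballI)
    fix x assume x: "x \<in> S \<inter> T"
    then obtain \<epsilon>1 \<delta>1 \<epsilon>2 \<delta>2 where
      1: "0 < \<epsilon>1" "0 < \<delta>1" "\<delta>1 < 1" "rn_ball M E x \<epsilon>1 \<delta>1 \<subseteq> S" and
      2: "0 < \<epsilon>2" "0 < \<delta>2" "\<delta>2 < 1" "rn_ball M E x \<epsilon>2 \<delta>2 \<subseteq> T"
      using S[THEN conjunct2, rule_format, of x] T[THEN conjunct2, rule_format, of x] by auto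
    have x': "x \<in> carrier E" using x S by blast
    have "rn_ball M E x (min \<epsilon>1 \<epsilon>2) (min \<delta>1 \<delta>2) \<subseteq> S \<inter> T"
      using rn_ball_mono[OF x', of "min \<epsilon>1 \<epsilon>2" \<epsilon>1 "min \<delta>1 \<delta>2" \<delta>1]
        rn_ball_mono[OF x', of "min \<epsilon>1 \<epsilon>2" \<epsilon>2 "min \<delta>1 \<delta>2" \<delta>2] 1 2 by auto
    with 1 2 show "\<exists>\<epsilon> \<delta>. 0 < \<epsilon> \<and> 0 < \<delta> \<and> \<delta> < 1 \<and> rn_ball M E x \<epsilon> \<delta> \<subseteq> S \<inter> T"
      by (intro exI[of _ "min \<epsilon>1 \<epsilon>2"] exI[of _ "min \<delta>1 \<delta>2"]) auto
  qed (use S in blast)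
  moreover have "?P (\<Union>\<K>)" if "\<forall>K\<in>\<K>. ?P K" for \<K>
  proof (intro conjI ballI)
    fix x assume "x \<in> \<Union>\<K>"
    then obtain K where K: "K \<in> \<K>" "x \<in> K" by blast
    with that obtain \<epsilon> \<delta> where "0 < \<epsilon>" "0 < \<delta>" "\<delta> < 1" "rn_ball M E x \<epsilon> \<delta> \<subseteq> K"
      by meson
    with K show "\<exists>\<epsilon> \<delta>. 0 < \<epsilon> \<and> 0 < \<delta> \<and> \<delta> < 1 \<and> rn_ball M E x \<epsilon> \<delta> \<subseteq> \<Union>\<K>"
      by (meson Union_upper subset_trans)
  qed (use that in blast)
  ultimately have "istopology ?P"
    unfolding istopology_def by simp
  then show ?thesis
    unfolding rn_topology_def by (simp add: topology_inverse')
qed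

definition rn_Cauchy :: "'w measure \<Rightarrow> ('w, 'e) rn_module \<Rightarrow> (nat \<Rightarrow> 'e) \<Rightarrow> bool" where
  "rn_Cauchy M E X \<longleftrightarrow> range X \<subseteq> carrier E \<and>
    (\<forall>\<epsilon> \<delta>. 0 < \<epsilon> \<longrightarrow> 0 < \<delta> \<longrightarrow> \<delta> < 1 \<longrightarrow> (\<exists>N. \<forall>m\<ge>N. \<forall>n\<ge>N. X m \<in> rn_ball M E (X n) \<epsilon> \<delta>))"

text \<open>The topology is metrizable and linear, so Cauchy sequences suffice for completeness.\<close>

definition rn_complete :: "'w measure \<Rightarrow> ('w, 'e) rn_module \<Rightarrow> bool" where
  "rn_complete M E \<longleftrightarrow>
    (\<forall>X. rn_Cauchy M E X \<longrightarrow> (\<exists>x. limitin (rn_topology M E) X x sequentially))"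

text \<open>\<^term>\<open>L0bar M\<close> is a complete lattice, so the least upper bound exists and is unique.\<close>

definition full_support :: "'w measure \<Rightarrow> ('w, 'e) rn_module \<Rightarrow> bool" where
  "full_support M E \<longleftrightarrow>
    rv_less M (rv_const M 0) (\<Squnion>\<^bsub>L0bar M\<^esub> ((\<lambda>x. to_L0bar M (rnorm E x)) ` carrier E))"

text \<open>The ring multiplication is not part of the module structure; its components in the two
  records built next are left unspecified.\<close>

definition rn_prod :: "'w measure \<Rightarrow> ('w, 'e) rn_module \<Rightarrow> ('w, 'f) rn_module \<Rightarrow> ('w, 'e \<times> 'f) rn_module" where
  "rn_prod M E F = \<lparr>carrier = carrier E \<times> carrier F, mult = undefined, one = undefined,
    zero = (\<zero>\<^bsub>E\<^esub>, \<zero>\<^bsub>F\<^esub>), add = (\<lambda>(x, r) (y, s). (x \<oplus>\<^bsub>E\<^esub> y, r \<oplus>\<^bsub>F\<^esub> s)),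
    smult = (\<lambda>\<xi> (x, r). (\<xi> \<odot>\<^bsub>E\<^esub> x, \<xi> \<odot>\<^bsub>F\<^esub> r)),
    rnorm = (\<lambda>(x, r). rnorm E x \<oplus>\<^bsub>L0 M\<^esub> rnorm F r)\<rparr>"

lemma L0_plus_add:
  assumes "a \<in> L0_plus M" "b \<in> L0_plus M"
  shows "a \<oplus>\<^bsub>L0 M\<^esub> b \<in> L0_plus M"
    and "a \<oplus>\<^bsub>L0 M\<^esub> b = \<zero>\<^bsub>L0 M\<^esub> \<Longrightarrow> a = \<zero>\<^bsub>L0 M\<^esub> \<and> b = \<zero>\<^bsub>L0 M\<^esub>"
proof -
  from assms obtain f g where [measurable]: "f \<in> borel_measurable M" "g \<in> borel_measurable M"
    and ab: "a = rv_class M f" "b = rv_class M g"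
    by (auto simp: L0_plus_def elim!: rv_cases)
  have pos: "AE \<omega> in M. 0 \<le> f \<omega>" "AE \<omega> in M. 0 \<le> g \<omega>"
    using assms by (auto simp: L0_plus_def L0_zero ab rv_le_class)
  then have "AE \<omega> in M. 0 \<le> f \<omega> + g \<omega>" by eventually_elim simp
  then show "a \<oplus>\<^bsub>L0 M\<^esub> b \<in> L0_plus M"
    by (simp add: ab L0_plus_def L0_zero L0_class_simps rv_le_class rv_class_in_rv)
  assume "a \<oplus>\<^bsub>L0 M\<^esub> b = \<zero>\<^bsub>L0 M\<^esub>"
  then have "AE \<omega> in M. f \<omega> + g \<omega> = 0"
    by (simp add: ab L0_zero L0_class_simps rv_class_eq_iff)
  with pos have "AE \<omega> in M. f \<omega> = 0 \<and> g \<omega> = 0" by eventually_elim auto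
  then show "a = \<zero>\<^bsub>L0 M\<^esub> \<and> b = \<zero>\<^bsub>L0 M\<^esub>"
    by (simp add: ab L0_zero rv_class_eq_iff)
qed

lemma L0_le_add_pairs:
  assumes "rv_le M p (a \<oplus>\<^bsub>L0 M\<^esub> b)" "rv_le M q (c \<oplus>\<^bsub>L0 M\<^esub> d)"
    and "p \<in> rv M" "q \<in> rv M" "a \<in> rv M" "b \<in> rv M" "c \<in> rv M" "d \<in> rv M"
  shows "rv_le M (p \<oplus>\<^bsub>L0 M\<^esub> q) ((a \<oplus>\<^bsub>L0 M\<^esub> c) \<oplus>\<^bsub>L0 M\<^esub> (b \<oplus>\<^bsub>L0 M\<^esub> d))"
proof -
  from assms(3-) obtain p' q' a' b' c' d' where [measurable]: "p' \<in> borel_measurable M"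
    "q' \<in> borel_measurable M" "a' \<in> borel_measurable M" "b' \<in> borel_measurable M"
    "c' \<in> borel_measurable M" "d' \<in> borel_measurable M"
    and eq: "p = rv_class M p'" "q = rv_class M q'" "a = rv_class M a'" "b = rv_class M b'"
      "c = rv_class M c'" "d = rv_class M d'"
    by (elim rv_cases) blast
  have "AE \<omega> in M. p' \<omega> \<le> a' \<omega> + b' \<omega>" "AE \<omega> in M. q' \<omega> \<le> c' \<omega> + d' \<omega>"
    using assms(1,2) by (simp_all add: eq L0_class_simps rv_le_class)
  then have "AE \<omega> in M. p' \<omega> + q' \<omega> \<le> (a' \<omega> + c' \<omega>) + (b' \<omega> + d' \<omega>)"
    by eventually_elim simp
  then show ?thesis by (simp add: eq L0_class_simps rv_le_class)
qed

lemma rn_module_prod: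
  fixes M :: "'a measure" and E :: "('a, 'b) rn_module" and F :: "('a, 'c) rn_module"
  assumes "rn_module M E" "rn_module M F"
  shows "rn_module M (rn_prod M E F)"
proof -
  interpret E: rn_module M E by fact
  interpret F: rn_module M F by fact
  have ag: "abelian_group (rn_prod M E F)"
  proof (rule abelian_groupI)
    fix x assume x: "x \<in> carrier (rn_prod M E F)"
    show "\<exists>y\<in>carrier (rn_prod M E F). y \<oplus>\<^bsub>rn_prod M E F\<^esub> x = \<zero>\<^bsub>rn_prod M E F\<^esub>"
      using x by (intro bexI[of _ "(\<ominus>\<^bsub>E\<^esub> fst x, \<ominus>\<^bsub>F\<^esub> snd x)"]) (auto simp: rn_prod_def E.l_neg F.l_neg)
  qed (auto simp: rn_prod_def E.a_ac F.a_ac)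
  have m: "Module.module (L0 M) (rn_prod M E F)"
  proof (rule moduleI[OF cring_L0 ag])
  qed (auto simp del: carrier_L0 simp: rn_prod_def E.smult_l_distr F.smult_l_distr E.smult_r_distr F.smult_r_distr
        E.smult_assoc1 F.smult_assoc1)
  interpret Module.module "L0 M" "rn_prod M E F" using m by simp
  have c: "\<And>x. x \<in> carrier E \<Longrightarrow> rnorm E x \<in> rv M" "\<And>x. x \<in> carrier F \<Longrightarrow> rnorm F x \<in> rv M"
    using E.rnorm_closed F.rnorm_closed by (auto simp: L0_plus_def)
  have a: "rv_map M abs \<xi> \<in> rv M" if "\<xi> \<in> rv M" for \<xi> :: "('a \<Rightarrow> real) set"
    using that by (auto elim!: rv_cases simp: L0_abs_class rv_class_in_rv)
  show ?thesis
  proof (intro rn_module.intro rn_module_axioms.intro E.prob_space_axioms m)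
    fix x y :: "'b \<times> 'c" and \<xi>
    assume x: "x \<in> carrier (rn_prod M E F)"
    show "rnorm (rn_prod M E F) x \<in> L0_plus M"
      using x by (auto simp: rn_prod_def L0_plus_add E.rnorm_closed F.rnorm_closed)
    show "rnorm (rn_prod M E F) (\<xi> \<odot>\<^bsub>rn_prod M E F\<^esub> x) = rv_map M abs \<xi> \<otimes>\<^bsub>L0 M\<^esub> rnorm (rn_prod M E F) x"
      if "\<xi> \<in> carrier (L0 M)"
      using x that by (auto simp: rn_prod_def E.rnorm_smult F.rnorm_smult E.R.r_distr a c)
    show "rv_le M (rnorm (rn_prod M E F) (x \<oplus>\<^bsub>rn_prod M E F\<^esub> y))
       (rnorm (rn_prod M E F) x \<oplus>\<^bsub>L0 M\<^esub> rnorm (rn_prod M E F) y)"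
      if "y \<in> carrier (rn_prod M E F)"
      using x that by (auto simp: rn_prod_def intro!: L0_le_add_pairs E.rnorm_triangle F.rnorm_triangle c)
    show "x = \<zero>\<^bsub>rn_prod M E F\<^esub>" if "rnorm (rn_prod M E F) x = \<zero>\<^bsub>L0 M\<^esub>"
      using that x L0_plus_add(2)[OF E.rnorm_closed F.rnorm_closed, of "fst x" "snd x"]
      by (auto simp: rn_prod_def intro: E.rnorm_eq_zero F.rnorm_eq_zero)
  qed
qed

definition cont_module_hom ::
  "'w measure \<Rightarrow> ('w, 'e) rn_module \<Rightarrow> ('w, 'f) rn_module \<Rightarrow> ('e \<Rightarrow> 'f) set" where
  "cont_module_hom M E F = {h \<in> carrier E \<rightarrow> carrier F.
    (\<forall>x\<in>carrier E. \<forall>y\<in>carrier E. h (x \<oplus>\<^bsub>E\<^esub> y) = h x \<oplus>\<^bsub>F\<^esub> h y) \<and>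
    (\<forall>\<xi>\<in>carrier (L0 M). \<forall>x\<in>carrier E. h (\<xi> \<odot>\<^bsub>E\<^esub> x) = \<xi> \<odot>\<^bsub>F\<^esub> h x) \<and>
    continuous_map (rn_topology M E) (rn_topology M F) h}"

definition cont_module_auto :: "'w measure \<Rightarrow> ('w, 'e) rn_module \<Rightarrow> ('e \<Rightarrow> 'e) set" where
  "cont_module_auto M E = {h \<in> cont_module_hom M E E. bij_betw h (carrier E) (carrier E)}"

definition rn_dual ::
  "'w measure \<Rightarrow> ('w, 'e) rn_module \<Rightarrow> (('w \<Rightarrow> real) set, 'e \<Rightarrow> ('w \<Rightarrow> real) set) module" where
  "rn_dual M E = \<lparr>carrier = cont_module_hom M E (L0 M) \<inter> extensional (carrier E),
    mult = undefined, one = undefined,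
    zero = (\<lambda>x\<in>carrier E. \<zero>\<^bsub>L0 M\<^esub>), add = (\<lambda>u v. \<lambda>x\<in>carrier E. u x \<oplus>\<^bsub>L0 M\<^esub> v x),
    smult = (\<lambda>\<xi> u. \<lambda>x\<in>carrier E. \<xi> \<otimes>\<^bsub>L0 M\<^esub> u x)\<rparr>"

definition rn_adjoint ::
  "('w, 'e) rn_module \<Rightarrow> ('e \<Rightarrow> 'e) \<Rightarrow> ('e \<Rightarrow> ('w \<Rightarrow> real) set) \<Rightarrow> 'e \<Rightarrow> ('w \<Rightarrow> real) set" where
  "rn_adjoint E H u = (\<lambda>x\<in>carrier E. u (H x))"


section \<open>Proper lower semicontinuous convex functions and operators on them\<close>

definition L0_dom :: "'w measure \<Rightarrow> ('w, 'e) rn_module \<Rightarrow> ('e \<Rightarrow> ('w \<Rightarrow> ereal) set) \<Rightarrow> 'e set" where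
  "L0_dom M E f = {x \<in> carrier E. rv_less M (f x) (rv_const M \<infinity>)}"

definition L0_epi ::
  "'w measure \<Rightarrow> ('w, 'e) rn_module \<Rightarrow> ('e \<Rightarrow> ('w \<Rightarrow> ereal) set) \<Rightarrow> ('e \<times> ('w \<Rightarrow> real) set) set" where
  "L0_epi M E f = {(x, r). x \<in> carrier E \<and> r \<in> carrier (L0 M) \<and> f x \<sqsubseteq>\<^bsub>L0bar M\<^esub> to_L0bar M r}"

definition L0_convex :: "'w measure \<Rightarrow> ('w, 'e) rn_module \<Rightarrow> ('e \<Rightarrow> ('w \<Rightarrow> ereal) set) \<Rightarrow> bool" where
  "L0_convex M E f \<longleftrightarrow> (\<forall>x\<in>carrier E. \<forall>y\<in>carrier E. \<forall>\<xi>\<in>L0_plus M. rv_le M \<xi> \<one>\<^bsub>L0 M\<^esub> \<longrightarrow>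
    f (\<xi> \<odot>\<^bsub>E\<^esub> x \<oplus>\<^bsub>E\<^esub> (\<one>\<^bsub>L0 M\<^esub> \<ominus>\<^bsub>L0 M\<^esub> \<xi>) \<odot>\<^bsub>E\<^esub> y) \<sqsubseteq>\<^bsub>L0bar M\<^esub>
      L0bar_add M (L0bar_mult M (to_L0bar M \<xi>) (f x))
        (L0bar_mult M (to_L0bar M (\<one>\<^bsub>L0 M\<^esub> \<ominus>\<^bsub>L0 M\<^esub> \<xi>)) (f y)))"

definition Cvx :: "'w measure \<Rightarrow> ('w, 'e) rn_module \<Rightarrow> ('e \<Rightarrow> ('w \<Rightarrow> ereal) set) set" where
  "Cvx M E = {f \<in> carrier E \<rightarrow>\<^sub>E carrier (L0bar M).
    (\<forall>x\<in>carrier E. rv_less M (rv_const M (-\<infinity>)) (f x)) \<and>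
    L0_dom M E f \<noteq> {} \<and>
    L0_convex M E f \<and>
    closedin (rn_topology M (rn_prod M E (L0 M))) (L0_epi M E f)}"

definition fun_le ::
  "'w measure \<Rightarrow> ('w, 'e) rn_module \<Rightarrow> ('e \<Rightarrow> ('w \<Rightarrow> ereal) set) \<Rightarrow> ('e \<Rightarrow> ('w \<Rightarrow> ereal) set) \<Rightarrow> bool" where
  "fun_le M E f g \<longleftrightarrow> (\<forall>x\<in>carrier E. f x \<sqsubseteq>\<^bsub>L0bar M\<^esub> g x)"

definition paste ::
  "'w measure \<Rightarrow> ('w, 'e) rn_module \<Rightarrow> 'w set \<Rightarrow> ('e \<Rightarrow> ('w \<Rightarrow> ereal) set)
    \<Rightarrow> ('e \<Rightarrow> ('w \<Rightarrow> ereal) set) \<Rightarrow> 'e \<Rightarrow> ('w \<Rightarrow> ereal) set" where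
  "paste M E A f g = (\<lambda>x\<in>carrier E.
    L0bar_add M (L0bar_mult M (rv_ind M A) (f x)) (L0bar_mult M (rv_ind M (space M - A)) (g x)))"

definition order_preserving_op ::
  "'w measure \<Rightarrow> ('w, 'e) rn_module
    \<Rightarrow> (('e \<Rightarrow> ('w \<Rightarrow> ereal) set) \<Rightarrow> 'e \<Rightarrow> ('w \<Rightarrow> ereal) set) \<Rightarrow> bool" where
  "order_preserving_op M E T \<longleftrightarrow>
    (\<forall>f\<in>Cvx M E. \<forall>g\<in>Cvx M E. fun_le M E f g \<longrightarrow> fun_le M E (T f) (T g))"

definition stable_op ::
  "'w measure \<Rightarrow> ('w, 'e) rn_module
    \<Rightarrow> (('e \<Rightarrow> ('w \<Rightarrow> ereal) set) \<Rightarrow> 'e \<Rightarrow> ('w \<Rightarrow> ereal) set) \<Rightarrow> bool" where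
  "stable_op M E T \<longleftrightarrow> (\<forall>A\<in>sets M. \<forall>f\<in>Cvx M E. \<forall>g\<in>Cvx M E.
    T (paste M E A f g) = paste M E A (T f) (T g))"

definition involution_op ::
  "'w measure \<Rightarrow> ('w, 'e) rn_module
    \<Rightarrow> (('e \<Rightarrow> ('w \<Rightarrow> ereal) set) \<Rightarrow> 'e \<Rightarrow> ('w \<Rightarrow> ereal) set) \<Rightarrow> bool" where
  "involution_op M E T \<longleftrightarrow> (\<forall>f\<in>Cvx M E. T (T f) = f)"

end

theory Submission
  imports Defs
begin

text \<open>
  Point functions, finite at a single point only, are exactly the functions whose upper set is a chain
  up to pasting, so a stable order automorphism \<open>T\<close> permutes them: it sends the point function of
  \<open>(x, r)\<close> to that of \<open>(\<phi> x, \<psi> x r)\<close>, and the epigraph of \<open>T f\<close> is the image of that of \<open>f\<close>. Testing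
  with functions supported on random segments shows that \<open>\<phi>\<close> maps segments to segments and that
  \<open>\<psi>\<close> intertwines the interpolations. This is a Pexider equation, so \<open>\<psi> z r = \<alpha> z * r + \<beta> z\<close>; moreover
  \<open>1 / \<alpha>\<close> is affine and positive on the whole module, hence constant, and \<open>\<alpha> = 1\<close> because \<open>T\<close> is an
  involution. Then \<open>\<phi>\<close> and \<open>\<beta>\<close> are affine. No separation theorem is needed. Continuity follows from
  the images under \<open>T\<close> of the zero function and of the norm: they are finite and lower
  semicontinuous, hence by a Baire argument bounded in probability on some ball.
\<close>


text \<open>The obstacle is that two elements can agree on one event and differ on another, while an
  argument about two distinct points has to run for almost every \<open>\<omega>\<close> at once.
  Two devices deal with this. Locality: indicator weights paste elements, so a convex function, and
  later \<open>\<phi>\<close> and \<open>\<psi>\<close>, cannot tell x from y on the event where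
  \<open>N (x \<ominus> y)\<close> vanishes. Separation: the weight of a point on a segment is a
  quotient of norms, so segments join only points with \<open>N (x \<ominus> y)\<close> positive
  almost everywhere; full support yields an element of nowhere vanishing norm, and pasting it in
  turns any pair into a separated one. If z has weight g between x and y and its image has weight t,
  comparing coefficients gives \<alpha> z * g = t * \<alpha> x and \<alpha> z * (1 - g) = (1 - t) *
  \<alpha> y; division by the slopes and addition shows that 1 / \<alpha> is affine. When \<alpha> =
  1 this says t = g, which is why \<phi> and \<beta> respect weights. The constant 1/2: an
  involution forces \<beta> (\<phi> x) = - \<beta> x, so with c = \<phi> 0 and w = \<beta> 0 -
  \<beta> one gets w c = 2 * \<beta> 0, and - \<beta> x = w x - w c / 2.\<close>

section \<open>Representatives of random variables\<close>

text \<open>A chosen representative turns every identity or inequality between classes into an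
  almost sure one between functions, which is then settled for each \<open>\<omega>\<close>
  separately. Nothing is known of the choice beyond a null set, see
  \<open>rp_rv_class\<close>.\<close>

definition rp :: "('w \<Rightarrow> 'b) set \<Rightarrow> 'w \<Rightarrow> 'b" where
  "rp X = (SOME f. f \<in> X)"

lemma rp_rv:
  assumes "X \<in> rv M"
  shows rp_measurable: "rp X \<in> borel_measurable M" and rv_class_rp: "rv_class M (rp X) = X"
proof -
  from assms obtain f where f: "f \<in> borel_measurable M" and X: "X = rv_class M f"
    by (rule rv_cases)
  have "f \<in> X" using f by (simp add: X mem_rv_class_iff)
  then have "rp X \<in> X" unfolding rp_def by (rule someI[of "\<lambda>f. f \<in> X"])
  then have *: "rp X \<in> borel_measurable M" "AE \<omega> in M. f \<omega> = rp X \<omega>"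
    using f by (simp_all add: X mem_rv_class_iff)
  then show "rp X \<in> borel_measurable M" "rv_class M (rp X) = X"
    using rv_class_eq_iff[OF f *(1)] by (simp_all add: X)
qed

lemma rp_rv_class:
  assumes "f \<in> borel_measurable M"
  shows "AE \<omega> in M. rp (rv_class M f) \<omega> = f \<omega>"
proof -
  have X: "rv_class M f \<in> rv M" using assms by auto
  from rv_class_rp[OF X] rv_class_eq_iff[OF rp_measurable[OF X] assms]
  show ?thesis by simp
qed

lemma rv_eq_iff:
  assumes "X \<in> rv M" "Y \<in> rv M"
  shows "X = Y \<longleftrightarrow> (AE \<omega> in M. rp X \<omega> = rp Y \<omega>)"
  using rv_class_eq_iff[OF rp_measurable[OF assms(1)] rp_measurable[OF assms(2)]]
  by (simp add: rv_class_rp assms)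

lemma rv_le_iff:
  fixes X Y :: "('w \<Rightarrow> 'b::{topological_space, ord}) set"
  assumes "X \<in> rv M" "Y \<in> rv M"
  shows "rv_le M X Y \<longleftrightarrow> (AE \<omega> in M. rp X \<omega> \<le> rp Y \<omega>)"
  using rv_le_class[OF rp_measurable[OF assms(1)] rp_measurable[OF assms(2)]]
  by (simp add: rv_class_rp assms)

lemma rv_less_iff:
  fixes X Y :: "('w \<Rightarrow> 'b::{topological_space, ord}) set"
  assumes "X \<in> rv M" "Y \<in> rv M"
  shows "rv_less M X Y \<longleftrightarrow> (AE \<omega> in M. rp X \<omega> < rp Y \<omega>)"
  using rv_less_class[OF rp_measurable[OF assms(1)] rp_measurable[OF assms(2)]]
  by (simp add: rv_class_rp assms)

lemma rv_const_rv: "rv_const M c \<in> rv M"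
  by (auto simp: rv_const_def)

lemma rp_rv_const: "AE \<omega> in M. rp (rv_const M c) \<omega> = c"
  unfolding rv_const_def by (rule rp_rv_class) simp

lemma rv_map2_rv:
  assumes "X \<in> rv M" "Y \<in> rv M"
    and "\<And>f g. f \<in> borel_measurable M \<Longrightarrow> g \<in> borel_measurable M \<Longrightarrow>
      (\<lambda>\<omega>. h (f \<omega>) (g \<omega>)) \<in> borel_measurable M"
  shows "rv_map2 M h X Y = rv_class M (\<lambda>\<omega>. h (rp X \<omega>) (rp Y \<omega>))"
    and "rv_map2 M h X Y \<in> rv M"
    and "AE \<omega> in M. rp (rv_map2 M h X Y) \<omega> = h (rp X \<omega>) (rp Y \<omega>)"
proof -
  note m = rp_measurable[OF assms(1)] rp_measurable[OF assms(2)]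
  show *: "rv_map2 M h X Y = rv_class M (\<lambda>\<omega>. h (rp X \<omega>) (rp Y \<omega>))"
    using rv_map2_class[OF assms(3) m] by (simp add: rv_class_rp assms)
  show "rv_map2 M h X Y \<in> rv M" unfolding * by (intro rv_class_in_rv assms(3) m)
  show "AE \<omega> in M. rp (rv_map2 M h X Y) \<omega> = h (rp X \<omega>) (rp Y \<omega>)"
    unfolding * by (intro rp_rv_class assms(3) m)
qed

lemma rv_map_rv:
  assumes "X \<in> rv M"
    and "\<And>f. f \<in> borel_measurable M \<Longrightarrow> (\<lambda>\<omega>. h (f \<omega>)) \<in> borel_measurable M"
  shows "rv_map M h X = rv_class M (\<lambda>\<omega>. h (rp X \<omega>))"
    and "rv_map M h X \<in> rv M"
    and "AE \<omega> in M. rp (rv_map M h X) \<omega> = h (rp X \<omega>)"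
proof -
  note m = rp_measurable[OF assms(1)]
  show *: "rv_map M h X = rv_class M (\<lambda>\<omega>. h (rp X \<omega>))"
    using rv_map_class[OF assms(2) m] by (simp add: rv_class_rp assms)
  show "rv_map M h X \<in> rv M" unfolding * by (intro rv_class_in_rv assms(2) m)
  show "AE \<omega> in M. rp (rv_map M h X) \<omega> = h (rp X \<omega>)"
    unfolding * by (intro rp_rv_class assms(2) m)
qed

lemma L0_add_rp:
  assumes "X \<in> rv M" "Y \<in> rv M"
  shows "AE \<omega> in M. rp (X \<oplus>\<^bsub>L0 M\<^esub> Y) \<omega> = rp X \<omega> + rp Y \<omega>"
  using rv_map2_rv(3)[OF assms, of "(+)"] by (simp add: L0_def)

lemma L0_mult_rp:
  assumes "X \<in> rv M" "Y \<in> rv M"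
  shows "AE \<omega> in M. rp (X \<otimes>\<^bsub>L0 M\<^esub> Y) \<omega> = rp X \<omega> * rp Y \<omega>"
  using rv_map2_rv(3)[OF assms, of "(*)"] by (simp add: L0_def)

lemma L0_closed:
  fixes X Y :: "('w \<Rightarrow> real) set"
  assumes "X \<in> rv M" "Y \<in> rv M"
  shows "X \<oplus>\<^bsub>L0 M\<^esub> Y \<in> rv M" "X \<otimes>\<^bsub>L0 M\<^esub> Y \<in> rv M" "X \<ominus>\<^bsub>L0 M\<^esub> Y \<in> rv M"
    "X \<odot>\<^bsub>L0 M\<^esub> Y \<in> rv M"
proof -
  interpret cring "L0 M" by (rule cring_L0)
  interpret Module.module "L0 M" "L0 M" by (rule module_L0)
  show "X \<oplus>\<^bsub>L0 M\<^esub> Y \<in> rv M" "X \<otimes>\<^bsub>L0 M\<^esub> Y \<in> rv M" "X \<ominus>\<^bsub>L0 M\<^esub> Y \<in> rv M"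
    "X \<odot>\<^bsub>L0 M\<^esub> Y \<in> rv M"
    using a_closed[of X Y] m_closed[of X Y] minus_closed[of X Y] smult_closed[of X Y] assms by simp_all
qed

text \<open>Negation in \<open>L0 M\<close> is known only through the group laws, so the value is
  found by cancelling Y in X = (X - Y) + Y.\<close>

lemma L0_minus_rp:
  assumes X: "X \<in> rv M" and Y: "Y \<in> rv M"
  shows "AE \<omega> in M. rp (X \<ominus>\<^bsub>L0 M\<^esub> Y) \<omega> = rp X \<omega> - rp Y \<omega>"
proof -
  interpret cring "L0 M" by (rule cring_L0)
  have "X = (X \<ominus>\<^bsub>L0 M\<^esub> Y) \<oplus>\<^bsub>L0 M\<^esub> Y"
    using X Y by (simp del: carrier_L0 add: carrier_L0[symmetric] minus_eq a_assoc l_neg)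
  then have "AE \<omega> in M. rp X \<omega> = rp (X \<ominus>\<^bsub>L0 M\<^esub> Y) \<omega> + rp Y \<omega>"
    using L0_add_rp[OF L0_closed(3)[OF X Y] Y] by simp
  then show ?thesis by eventually_elim simp
qed

lemma L0_minus_class:
  assumes [measurable]: "f \<in> borel_measurable M" "g \<in> borel_measurable M"
  shows "rv_class M f \<ominus>\<^bsub>L0 M\<^esub> rv_class M g = rv_class M (\<lambda>\<omega>. f \<omega> - g \<omega>)"
proof -
  have rv: "rv_class M f \<in> rv M" "rv_class M g \<in> rv M" "rv_class M (\<lambda>\<omega>. f \<omega> - g \<omega>) \<in> rv M"
    by auto
  show ?thesis
    unfolding rv_eq_iff[OF L0_closed(3)[OF rv(1,2)] rv(3)]
    using L0_minus_rp[OF rv(1,2)] rp_rv_class[OF assms(1)] rp_rv_class[OF assms(2)]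
      rp_rv_class[of "\<lambda>\<omega>. f \<omega> - g \<omega>" M]
    by (auto elim!: AE_mp)
qed

lemma to_L0bar_rp:
  assumes "X \<in> rv M"
  shows "to_L0bar M X \<in> rv M" "AE \<omega> in M. rp (to_L0bar M X) \<omega> = ereal (rp X \<omega>)"
  using rv_map_rv(2,3)[OF assms, of ereal] by simp_all

lemma L0bar_add_rp:
  assumes "X \<in> rv M" "Y \<in> rv M"
  shows "L0bar_add M X Y \<in> rv M" "AE \<omega> in M. rp (L0bar_add M X Y) \<omega> = rp X \<omega> + rp Y \<omega>"
  using rv_map2_rv(2,3)[OF assms, of "(+)"] by simp_all

lemma L0bar_mult_rp:
  assumes "X \<in> rv M" "Y \<in> rv M"
  shows "L0bar_mult M X Y \<in> rv M" "AE \<omega> in M. rp (L0bar_mult M X Y) \<omega> = rp X \<omega> * rp Y \<omega>"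
  using rv_map2_rv(2,3)[OF assms, of "(*)"] by simp_all

lemma rv_ind_rp:
  assumes "A \<in> sets M"
  shows "(rv_ind M A :: ('w \<Rightarrow> ereal) set) \<in> rv M"
    "AE \<omega> in M. rp (rv_ind M A :: ('w \<Rightarrow> ereal) set) \<omega> = indicator A \<omega>"
proof -
  have m: "(indicator A :: 'w \<Rightarrow> ereal) \<in> borel_measurable M"
    using assms by simp
  show "(rv_ind M A :: ('w \<Rightarrow> ereal) set) \<in> rv M"
    "AE \<omega> in M. rp (rv_ind M A :: ('w \<Rightarrow> ereal) set) \<omega> = indicator A \<omega>"
    unfolding rv_ind_def using rp_rv_class[OF m] rv_class_in_rv[OF m] by auto
qed

lemma L0_zero_rv: "\<zero>\<^bsub>L0 M\<^esub> \<in> rv M" and L0_one_rv: "\<one>\<^bsub>L0 M\<^esub> \<in> rv M"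
  by (auto simp: L0_zero L0_one)

lemma L0_zero_rp: "AE \<omega> in M. rp (\<zero>\<^bsub>L0 M\<^esub>) \<omega> = 0" and L0_one_rp: "AE \<omega> in M. rp (\<one>\<^bsub>L0 M\<^esub>) \<omega> = 1"
  by (auto simp: L0_zero L0_one intro: rp_rv_class)

lemma AE_allI: "(\<And>n::nat. AE \<omega> in M. P n \<omega>) \<Longrightarrow> AE \<omega> in M. \<forall>n. P n \<omega>"
  by (simp add: AE_all_countable)

lemma rv_class_cong:
  assumes "f \<in> borel_measurable M" "g \<in> borel_measurable M" "AE \<omega> in M. f \<omega> = g \<omega>"
  shows "rv_class M f = rv_class M g"
  using assms by (simp add: rv_class_eq_iff)


section \<open>Pointwise norms and random scalars\<close>

context rn_module
begin

definition N :: "'e \<Rightarrow> 'w \<Rightarrow> real" where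
  "N x = rp (rnorm E x)"

definition sm :: "('w \<Rightarrow> real) \<Rightarrow> 'e \<Rightarrow> 'e" where
  "sm g x = rv_class M g \<odot> x"

text \<open>The weight is not confined to the unit interval: weights above 1 extend a line beyond
  its endpoint, and an indicator as weight (\<open>cmb\<close>) glues x on an event to y off
  it.\<close>

definition cv :: "('w \<Rightarrow> real) \<Rightarrow> 'e \<Rightarrow> 'e \<Rightarrow> 'e" where
  "cv g x y = sm g x \<oplus> sm (\<lambda>\<omega>. 1 - g \<omega>) y"

abbreviation cmb :: "'w set \<Rightarrow> 'e \<Rightarrow> 'e \<Rightarrow> 'e" where
  "cmb A \<equiv> cv (indicat_real A)"

lemma rnorm_rv: "x \<in> carrier E \<Longrightarrow> rnorm E x \<in> rv M"
  using rnorm_closed[of x] by (simp add: L0_plus_def)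

lemma N_meas [measurable]: "x \<in> carrier E \<Longrightarrow> N x \<in> borel_measurable M"
  unfolding N_def by (rule rp_measurable[OF rnorm_rv])

lemma N_nonneg: "x \<in> carrier E \<Longrightarrow> AE \<omega> in M. 0 \<le> N x \<omega>"
proof -
  assume x: "x \<in> carrier E"
  then have "AE \<omega> in M. rp (\<zero>\<^bsub>L0 M\<^esub>) \<omega> \<le> N x \<omega>"
    using rnorm_closed[OF x] rv_le_iff[OF L0_zero_rv rnorm_rv[OF x]] by (simp add: L0_plus_def N_def)
  with L0_zero_rp show ?thesis by eventually_elim simp
qed

lemma sm_closed [simp, intro]: "g \<in> borel_measurable M \<Longrightarrow> x \<in> carrier E \<Longrightarrow> sm g x \<in> carrier E"
  unfolding sm_def by (rule smult_closed) auto

lemma cv_closed [simp, intro]: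
  "g \<in> borel_measurable M \<Longrightarrow> x \<in> carrier E \<Longrightarrow> y \<in> carrier E \<Longrightarrow> cv g x y \<in> carrier E"
  unfolding cv_def by simp

lemma smult_eq_sm: "\<xi> \<in> rv M \<Longrightarrow> \<xi> \<odot> x = sm (rp \<xi>) x"
  by (simp add: sm_def rv_class_rp)

lemma N_sm:
  assumes [measurable]: "g \<in> borel_measurable M" and x: "x \<in> carrier E"
  shows "AE \<omega> in M. N (sm g x) \<omega> = \<bar>g \<omega>\<bar> * N x \<omega>"
proof -
  have g: "rv_class M g \<in> rv M" by auto
  have a: "rv_class M (\<lambda>\<omega>. \<bar>g \<omega>\<bar>) \<in> rv M" by auto
  have "rnorm E (sm g x) = rv_class M (\<lambda>\<omega>. \<bar>g \<omega>\<bar>) \<otimes>\<^bsub>L0 M\<^esub> rnorm E x"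
    using rnorm_smult[of "rv_class M g" x] g x by (simp add: sm_def L0_abs_class)
  then have "AE \<omega> in M. N (sm g x) \<omega> = rp (rv_class M (\<lambda>\<omega>. \<bar>g \<omega>\<bar>)) \<omega> * N x \<omega>"
    using L0_mult_rp[OF a rnorm_rv[OF x]] by (simp add: N_def)
  moreover have "AE \<omega> in M. rp (rv_class M (\<lambda>\<omega>. \<bar>g \<omega>\<bar>)) \<omega> = \<bar>g \<omega>\<bar>"
    by (rule rp_rv_class) simp
  ultimately show ?thesis by eventually_elim simp
qed

lemma N_triangle:
  assumes "x \<in> carrier E" "y \<in> carrier E"
  shows "AE \<omega> in M. N (x \<oplus> y) \<omega> \<le> N x \<omega> + N y \<omega>"
proof -
  have "AE \<omega> in M. N (x \<oplus> y) \<omega> \<le> rp (rnorm E x \<oplus>\<^bsub>L0 M\<^esub> rnorm E y) \<omega>"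
    using rnorm_triangle[OF assms] assms
    by (subst (asm) rv_le_iff) (auto simp: rnorm_rv N_def intro!: L0_closed)
  with L0_add_rp[OF rnorm_rv[OF assms(1)] rnorm_rv[OF assms(2)]]
  show ?thesis by eventually_elim (simp add: N_def)
qed

lemma sm_sm:
  assumes "g \<in> borel_measurable M" "h \<in> borel_measurable M" "x \<in> carrier E"
  shows "sm g (sm h x) = sm (\<lambda>\<omega>. g \<omega> * h \<omega>) x"
  using assms smult_assoc1[of "rv_class M g" "rv_class M h" x]
  by (simp add: sm_def L0_class_simps rv_class_in_rv)

lemma sm_add_left:
  assumes "g \<in> borel_measurable M" "h \<in> borel_measurable M" "x \<in> carrier E"
  shows "sm (\<lambda>\<omega>. g \<omega> + h \<omega>) x = sm g x \<oplus> sm h x"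
  using assms smult_l_distr[of "rv_class M g" "rv_class M h" x]
  by (simp add: sm_def L0_class_simps rv_class_in_rv)

lemma sm_add_right:
  assumes "g \<in> borel_measurable M" "x \<in> carrier E" "y \<in> carrier E"
  shows "sm g (x \<oplus> y) = sm g x \<oplus> sm g y"
  using assms smult_r_distr[of "rv_class M g" x y] by (simp add: sm_def rv_class_in_rv)

lemma sm_one: "x \<in> carrier E \<Longrightarrow> sm (\<lambda>_. 1) x = x"
  using smult_one[of x] by (simp add: sm_def L0_one)

lemma sm_zero: "x \<in> carrier E \<Longrightarrow> sm (\<lambda>_. 0) x = \<zero>"
  using smult_l_null[of x] by (simp add: sm_def L0_zero)

lemma sm_cong:
  assumes "g \<in> borel_measurable M" "h \<in> borel_measurable M" "AE \<omega> in M. g \<omega> = h \<omega>"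
  shows "sm g x = sm h x"
  unfolding sm_def using rv_class_cong[OF assms] by simp

lemma cv_cong:
  assumes [measurable]: "g \<in> borel_measurable M" "h \<in> borel_measurable M" and "AE \<omega> in M. g \<omega> = h \<omega>"
  shows "cv g x y = cv h x y"
proof -
  have "sm g x = sm h x" "sm (\<lambda>\<omega>. 1 - g \<omega>) y = sm (\<lambda>\<omega>. 1 - h \<omega>) y"
    using assms by (auto intro!: sm_cong)
  then show ?thesis by (simp add: cv_def)
qed

lemma sm_uminus_one:
  assumes x: "x \<in> carrier E" shows "sm (\<lambda>_. -1) x = \<ominus> x"
proof -
  have "sm (\<lambda>_. -1) x \<oplus> x = \<zero>"
    using sm_add_left[of "\<lambda>_. -1" "\<lambda>_. 1" x] x by (simp add: sm_zero sm_one)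
  then show ?thesis
    using minus_equality[of "sm (\<lambda>_. -1) x" x] x by simp
qed

lemma sm_a_inv:
  assumes "g \<in> borel_measurable M" "x \<in> carrier E"
  shows "sm g (\<ominus> x) = \<ominus> sm g x"
  using assms by (simp flip: sm_uminus_one add: sm_sm)

lemma sm_minus:
  assumes "g \<in> borel_measurable M" "x \<in> carrier E" "y \<in> carrier E"
  shows "sm g (x \<ominus> y) = sm g x \<ominus> sm g y"
  using assms by (simp add: a_minus_def sm_add_right sm_a_inv)

lemma N_zero: "AE \<omega> in M. N \<zero> \<omega> = 0"
  using N_sm[of "\<lambda>_. 0" \<zero>] by (simp add: sm_zero)

lemma N_minus_commute:
  assumes "x \<in> carrier E" "y \<in> carrier E"
  shows "AE \<omega> in M. N (x \<ominus> y) \<omega> = N (y \<ominus> x) \<omega>"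
proof -
  have "sm (\<lambda>_. -1) (y \<ominus> x) = x \<ominus> y"
    using assms by (simp add: sm_uminus_one a_minus_def minus_add a_comm)
  with N_sm[of "\<lambda>_. -1" "y \<ominus> x"] assms show ?thesis by simp
qed

lemma N_eq_zero_iff:
  assumes "x \<in> carrier E"
  shows "x = \<zero> \<longleftrightarrow> (AE \<omega> in M. N x \<omega> = 0)"
proof
  assume "AE \<omega> in M. N x \<omega> = 0"
  with L0_zero_rp have "AE \<omega> in M. N x \<omega> = rp (\<zero>\<^bsub>L0 M\<^esub>) \<omega>" by eventually_elim simp
  then have "rnorm E x = \<zero>\<^bsub>L0 M\<^esub>"
    using rv_eq_iff[OF rnorm_rv[OF assms] L0_zero_rv] by (simp add: N_def)
  with rnorm_eq_zero assms show "x = \<zero>" by blast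
qed (simp add: N_zero)

lemma minus_eq_zero_iff:
  assumes "x \<in> carrier E" "y \<in> carrier E"
  shows "x \<ominus> y = \<zero> \<longleftrightarrow> x = y"
proof
  assume "x \<ominus> y = \<zero>"
  then have "(x \<ominus> y) \<oplus> y = y" using assms by simp
  then show "x = y" using assms by (simp add: a_minus_def a_assoc l_neg)
qed (use assms in \<open>simp add: a_minus_def r_neg\<close>)

lemma eq_iff_N:
  assumes "x \<in> carrier E" "y \<in> carrier E"
  shows "x = y \<longleftrightarrow> (AE \<omega> in M. N (x \<ominus> y) \<omega> = 0)"
  using N_eq_zero_iff[of "x \<ominus> y"] minus_eq_zero_iff[OF assms] assms by simp

lemma minus_telescope:
  assumes "x \<in> carrier E" "y \<in> carrier E" "z \<in> carrier E"
  shows "(x \<ominus> y) \<oplus> (y \<ominus> z) = x \<ominus> z"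
  using assms by (simp add: a_minus_def a_assoc r_neg1)

lemma minus_zero_right: "x \<in> carrier E \<Longrightarrow> x \<ominus> \<zero> = x"
  using minus_equality[of \<zero> \<zero>] by (simp add: a_minus_def)

lemma minus_self: "x \<in> carrier E \<Longrightarrow> x \<ominus> x = \<zero>"
  by (simp add: a_minus_def r_neg)

lemma N_minus_self: "x \<in> carrier E \<Longrightarrow> AE \<omega> in M. N (x \<ominus> x) \<omega> = 0"
  by (simp add: minus_self N_zero)

lemma N_triangle_minus:
  assumes "x \<in> carrier E" "y \<in> carrier E" "z \<in> carrier E"
  shows "AE \<omega> in M. N (x \<ominus> z) \<omega> \<le> N (x \<ominus> y) \<omega> + N (y \<ominus> z) \<omega>"
  using N_triangle[of "x \<ominus> y" "y \<ominus> z"] assms by (simp add: minus_telescope)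

lemma add_minus_add:
  assumes "x \<in> carrier E" "y \<in> carrier E" "x' \<in> carrier E" "y' \<in> carrier E"
  shows "(x \<oplus> y) \<ominus> (x' \<oplus> y') = (x \<ominus> x') \<oplus> (y \<ominus> y')"
  using assms by (simp add: a_minus_def minus_add a_ac)

lemma cv_minus_cv:
  assumes [measurable]: "g \<in> borel_measurable M"
    and "x \<in> carrier E" "y \<in> carrier E" "x' \<in> carrier E" "y' \<in> carrier E"
  shows "cv g x y \<ominus> cv g x' y' = cv g (x \<ominus> x') (y \<ominus> y')"
  using assms by (simp add: cv_def add_minus_add sm_minus)

lemma cv_same:
  assumes [measurable]: "g \<in> borel_measurable M" and "x \<in> carrier E"
  shows "cv g x x = x"
  using sm_add_left[of g "\<lambda>\<omega>. 1 - g \<omega>" x] assms by (simp add: cv_def sm_one)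

lemma cv_minus:
  assumes "g \<in> borel_measurable M" "x \<in> carrier E" "y \<in> carrier E" "z \<in> carrier E"
  shows "cv g x y \<ominus> z = cv g (x \<ominus> z) (y \<ominus> z)"
  using cv_minus_cv[of g x y z z] assms by (simp add: cv_same)

lemma cv_zero_right: "g \<in> borel_measurable M \<Longrightarrow> x \<in> carrier E \<Longrightarrow> cv g x \<zero> = sm g x"
  using smult_r_null[of "rv_class M (\<lambda>\<omega>. 1 - g \<omega>)"] by (auto simp: cv_def sm_def rv_class_in_rv)

lemma cv_zero_left:
  "g \<in> borel_measurable M \<Longrightarrow> x \<in> carrier E \<Longrightarrow> cv g \<zero> x = sm (\<lambda>\<omega>. 1 - g \<omega>) x"
  using smult_r_null[of "rv_class M g"] by (auto simp: cv_def sm_def rv_class_in_rv)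

lemma N_cv_minus_right:
  assumes [measurable]: "g \<in> borel_measurable M" and "x \<in> carrier E" "y \<in> carrier E"
  shows "AE \<omega> in M. N (cv g x y \<ominus> y) \<omega> = \<bar>g \<omega>\<bar> * N (x \<ominus> y) \<omega>"
  using N_sm[of g "x \<ominus> y"] assms by (simp add: cv_minus minus_self cv_zero_right)

lemma N_cv_minus_left:
  assumes [measurable]: "g \<in> borel_measurable M" and "x \<in> carrier E" "y \<in> carrier E"
  shows "AE \<omega> in M. N (cv g x y \<ominus> x) \<omega> = \<bar>1 - g \<omega>\<bar> * N (x \<ominus> y) \<omega>"
proof -
  have "AE \<omega> in M. N (cv g x y \<ominus> x) \<omega> = \<bar>1 - g \<omega>\<bar> * N (y \<ominus> x) \<omega>"
    using N_sm[of "\<lambda>\<omega>. 1 - g \<omega>" "y \<ominus> x"] assms by (simp add: cv_minus minus_self cv_zero_left)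
  with N_minus_commute[OF assms(3,2)] show ?thesis by eventually_elim simp
qed

lemma N_cv_le:
  assumes [measurable]: "g \<in> borel_measurable M" and "x \<in> carrier E" "y \<in> carrier E"
  shows "AE \<omega> in M. N (cv g x y) \<omega> \<le> \<bar>g \<omega>\<bar> * N x \<omega> + \<bar>1 - g \<omega>\<bar> * N y \<omega>"
proof -
  have "AE \<omega> in M. N (cv g x y) \<omega> \<le> N (sm g x) \<omega> + N (sm (\<lambda>\<omega>. 1 - g \<omega>) y) \<omega>"
    unfolding cv_def by (rule N_triangle) (use assms in auto)
  moreover have "AE \<omega> in M. N (sm g x) \<omega> = \<bar>g \<omega>\<bar> * N x \<omega>" using assms by (intro N_sm)
  moreover have "AE \<omega> in M. N (sm (\<lambda>\<omega>. 1 - g \<omega>) y) \<omega> = \<bar>1 - g \<omega>\<bar> * N y \<omega>"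
    using assms by (intro N_sm) auto
  ultimately show ?thesis by eventually_elim simp
qed

lemma N_cv_minus_le:
  assumes [measurable]: "g \<in> borel_measurable M" and "x \<in> carrier E" "y \<in> carrier E" "z \<in> carrier E"
  shows "AE \<omega> in M. N (cv g x y \<ominus> z) \<omega> \<le> \<bar>g \<omega>\<bar> * N (x \<ominus> z) \<omega> + \<bar>1 - g \<omega>\<bar> * N (y \<ominus> z) \<omega>"
  using N_cv_le[of g "x \<ominus> z" "y \<ominus> z"] assms by (simp add: cv_minus)

text \<open>The glued element is at distance zero from x on A and from y off A; the triangle
  inequality in both directions then transfers the distance to z.\<close>

lemma N_cmb_minus:
  assumes A: "A \<in> sets M" and c: "x \<in> carrier E" "y \<in> carrier E" "z \<in> carrier E"
  shows "AE \<omega> in M. N (cmb A x y \<ominus> z) \<omega> = (if \<omega> \<in> A then N (x \<ominus> z) \<omega> else N (y \<ominus> z) \<omega>)"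
proof -
  have [measurable]: "indicat_real A \<in> borel_measurable M" using A by simp
  let ?c = "cmb A x y"
  have cc: "?c \<in> carrier E" using c by auto
  have 1: "AE \<omega> in M. N (?c \<ominus> x) \<omega> = \<bar>1 - indicator A \<omega>\<bar> * N (x \<ominus> y) \<omega>"
    using c by (intro N_cv_minus_left) auto
  have 2: "AE \<omega> in M. N (?c \<ominus> y) \<omega> = \<bar>indicator A \<omega>\<bar> * N (x \<ominus> y) \<omega>"
    using c by (intro N_cv_minus_right) auto
  show ?thesis
    using 1 2 N_triangle_minus[OF cc c(1) c(3)] N_triangle_minus[OF cc c(2) c(3)]
      N_triangle_minus[OF c(1) cc c(3)] N_triangle_minus[OF c(2) cc c(3)]
      N_minus_commute[OF cc c(1)] N_minus_commute[OF cc c(2)]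
    by eventually_elim (auto simp: indicator_def split: if_splits)
qed

lemma N_cmb:
  assumes A: "A \<in> sets M" and c: "x \<in> carrier E" "y \<in> carrier E"
  shows "AE \<omega> in M. N (cmb A x y) \<omega> = (if \<omega> \<in> A then N x \<omega> else N y \<omega>)"
  using N_cmb_minus[OF A c zero_closed] c A minus_zero_right[of x] minus_zero_right[of y]
    minus_zero_right[of "cmb A x y"] by (simp split del: if_split cong: if_cong)

text \<open>Mostly applied with A the event where \<open>N (x \<ominus> y)\<close> vanishes and z =
  y: then pasting x into y on A changes nothing, which is the source of all locality
  statements.\<close>

lemma eq_cmbI:
  assumes A: "A \<in> sets M" and c: "x \<in> carrier E" "y \<in> carrier E" "z \<in> carrier E"
    and "AE \<omega> in M. \<omega> \<in> A \<longrightarrow> N (x \<ominus> z) \<omega> = 0" "AE \<omega> in M. \<omega> \<notin> A \<longrightarrow> N (y \<ominus> z) \<omega> = 0"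
  shows "cmb A x y = z"
proof -
  have [measurable]: "indicat_real A \<in> borel_measurable M" using A by simp
  have "AE \<omega> in M. N (cmb A x y \<ominus> z) \<omega> = 0"
    using N_cmb_minus[OF A c] assms(5,6) by eventually_elim auto
  then show ?thesis using eq_iff_N[of "cmb A x y" z] c by auto
qed

end

section \<open>The topology and almost sure convergence\<close>

lemma (in prob_space) prob_tendsto_1_AE:
  assumes [measurable]: "\<And>n. A n \<in> events" and ev: "AE \<omega> in M. eventually (\<lambda>n. \<omega> \<in> A n) sequentially"
  shows "(\<lambda>n. prob (A n)) \<longlonglongrightarrow> 1"
proof -
  have "(\<lambda>n. \<integral>\<omega>. indicat_real (A n) \<omega> \<partial>M) \<longlonglongrightarrow> (\<integral>\<omega>. 1 \<partial>M)"
  proof (rule integral_dominated_convergence[where w = "\<lambda>_. 1"])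
    show "AE \<omega> in M. (\<lambda>n. indicat_real (A n) \<omega>) \<longlonglongrightarrow> 1"
      using ev by eventually_elim (auto intro!: tendsto_eventually elim: eventually_mono)
  qed auto
  then show ?thesis by (simp add: prob_space)
qed

context rn_module
begin

text \<open>The definition of a ball asks for some representative of the norm; all of them give the
  same probability, so the chosen one may be used.\<close>

lemma rn_ball_iff:
  assumes x: "x \<in> carrier E"
  shows "y \<in> rn_ball M E x \<epsilon> \<delta> \<longleftrightarrow>
    y \<in> carrier E \<and> 1 - \<delta> < prob {\<omega> \<in> space M. N (y \<ominus> x) \<omega> < \<epsilon>}"
proof (cases "y \<in> carrier E")
  case True
  then have c: "y \<ominus> x \<in> carrier E" using x by simp
  have cl: "rnorm E (y \<ominus> x) = rv_class M (N (y \<ominus> x))"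
    by (simp add: N_def rv_class_rp[OF rnorm_rv[OF c]])
  have [measurable]: "N (y \<ominus> x) \<in> borel_measurable M" by (rule N_meas[OF c])
  have *: "prob {\<omega> \<in> space M. f \<omega> < \<epsilon>} = prob {\<omega> \<in> space M. N (y \<ominus> x) \<omega> < \<epsilon>}"
    if "f \<in> rnorm E (y \<ominus> x)" for f
  proof -
    from that have [measurable]: "f \<in> borel_measurable M" and ae: "AE \<omega> in M. N (y \<ominus> x) \<omega> = f \<omega>"
      by (auto simp: cl mem_rv_class_iff)
    show ?thesis by (rule finite_measure_eq_AE) (use ae in \<open>auto elim!: AE_mp\<close>)
  qed
  have "N (y \<ominus> x) \<in> rnorm E (y \<ominus> x)"
    by (simp add: cl mem_rv_class_iff)
  then have "(\<exists>f\<in>rnorm E (y \<ominus> x). 1 - \<delta> < prob {\<omega> \<in> space M. f \<omega> < \<epsilon>}) \<longleftrightarrow>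
      1 - \<delta> < prob {\<omega> \<in> space M. N (y \<ominus> x) \<omega> < \<epsilon>}"
    using * by (metis (no_types, lifting))
  with True show ?thesis by (simp add: rn_ball_def)
qed (auto simp: rn_ball_def)

lemma topspace_rn_topology: "topspace (rn_topology M E) = carrier E"
proof -
  have "openin (rn_topology M E) (carrier E)"
    unfolding openin_rn_topology by (auto simp: rn_ball_def intro!: exI[of _ 1] exI[of _ "1/2"])
  then show ?thesis
    by (metis openin_rn_topology openin_subset openin_topspace subset_antisym)
qed

text \<open>The topology is that of convergence in probability. Almost sure convergence is stronger,
  but it determines the same closed sets by passing to subsequences, and it allows limits to be
  taken for each \<open>\<omega>\<close>.\<close>

definition as_conv :: "(nat \<Rightarrow> 'e) \<Rightarrow> 'e \<Rightarrow> bool" where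
  "as_conv X x \<longleftrightarrow> range X \<subseteq> carrier E \<and> x \<in> carrier E \<and> (AE \<omega> in M. (\<lambda>n. N (X n \<ominus> x) \<omega>) \<longlonglongrightarrow> 0)"

lemma as_conv_ball:
  assumes "as_conv X x" "0 < \<epsilon>" "0 < \<delta>"
  shows "eventually (\<lambda>n. X n \<in> rn_ball M E x \<epsilon> \<delta>) sequentially"
proof -
  have c: "\<And>n. X n \<in> carrier E" "x \<in> carrier E" and
    ae: "AE \<omega> in M. (\<lambda>n. N (X n \<ominus> x) \<omega>) \<longlonglongrightarrow> 0"
    using assms(1) by (auto simp: as_conv_def)
  note [measurable] = N_meas[OF minus_closed[OF c(1) c(2)]]
  have "(\<lambda>n. prob {\<omega> \<in> space M. N (X n \<ominus> x) \<omega> < \<epsilon>}) \<longlonglongrightarrow> 1"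
  proof (rule prob_tendsto_1_AE)
    show "AE \<omega> in M. \<forall>\<^sub>F n in sequentially. \<omega> \<in> {\<omega> \<in> space M. N (X n \<ominus> x) \<omega> < \<epsilon>}"
      using ae AE_space
    proof eventually_elim
      case (elim \<omega>)
      then show ?case using order_tendstoD(2)[OF elim(1) \<open>0 < \<epsilon>\<close>] by simp
    qed
  qed simp
  then have "eventually (\<lambda>n. 1 - \<delta> < prob {\<omega> \<in> space M. N (X n \<ominus> x) \<omega> < \<epsilon>}) sequentially"
    by (rule order_tendstoD) (use \<open>0 < \<delta>\<close> in simp)
  then show ?thesis by (simp add: rn_ball_iff c)
qed

text \<open>The exceptional events have summable probabilities, so by Borel-Cantelli almost every
  \<open>\<omega>\<close> lies in only finitely many of them.\<close>

lemma as_convI_ball: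
  assumes c: "x \<in> carrier E" and X: "\<And>n. X n \<in> rn_ball M E x ((1/2) ^ Suc n) ((1/2) ^ Suc n)"
  shows "as_conv X x"
proof -
  have Xc: "X n \<in> carrier E" for n using X[of n] by (simp add: rn_ball_iff[OF c])
  note [measurable] = N_meas[OF minus_closed[OF Xc c]]
  let ?A = "\<lambda>n. {\<omega> \<in> space M. (1/2) ^ Suc n \<le> N (X n \<ominus> x) \<omega>}"
  have le: "prob (?A n) \<le> (1/2) ^ Suc n" for n
  proof -
    have "?A n = space M - {\<omega> \<in> space M. N (X n \<ominus> x) \<omega> < (1/2) ^ Suc n}" by auto
    moreover have "prob (space M - {\<omega> \<in> space M. N (X n \<ominus> x) \<omega> < (1/2) ^ Suc n})
        = 1 - prob {\<omega> \<in> space M. N (X n \<ominus> x) \<omega> < (1/2) ^ Suc n}"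
      by (rule prob_compl) simp
    ultimately show ?thesis using X[of n] by (simp add: rn_ball_iff[OF c])
  qed
  have "AE \<omega> in M. eventually (\<lambda>n. \<omega> \<in> space M - ?A n) sequentially"
  proof (rule borel_cantelli_AE1)
    have "summable (\<lambda>n. (1/2::real) ^ Suc n)" by (simp add: summable_geometric)
    then show "summable (\<lambda>n. prob (?A n))"
      by (rule summable_comparison_test') (use le in auto)
  qed (simp_all add: emeasure_eq_measure)
  moreover have "AE \<omega> in M. \<forall>n. 0 \<le> N (X n \<ominus> x) \<omega>"
    unfolding AE_all_countable using N_nonneg Xc c by simp
  ultimately have "AE \<omega> in M. (\<lambda>n. N (X n \<ominus> x) \<omega>) \<longlonglongrightarrow> 0"
  proof eventually_elim
    case (elim \<omega>)
    have lim: "(\<lambda>n. (1/2::real) ^ Suc n) \<longlonglongrightarrow> 0"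
      by (rule LIMSEQ_Suc) (simp add: LIMSEQ_realpow_zero)
    show ?case
      by (rule tendsto_sandwich[OF _ _ tendsto_const lim])
        (use elim in \<open>auto elim!: eventually_mono\<close>)
  qed
  then show ?thesis using Xc c by (auto simp: as_conv_def)
qed

text \<open>If a point of the complement is not interior to it, each ball of radius and level
  \<open>(1/2) ^ Suc n\<close> around it meets C, and the points picked converge almost surely by
  \<open>as_convI_ball\<close>.\<close>

lemma closedin_rn_topology:
  "closedin (rn_topology M E) C \<longleftrightarrow>
    C \<subseteq> carrier E \<and> (\<forall>X x. range X \<subseteq> C \<longrightarrow> as_conv X x \<longrightarrow> x \<in> C)"
proof (intro iffI conjI allI impI)
  assume cl: "closedin (rn_topology M E) C"
  then show "C \<subseteq> carrier E" using closedin_subset topspace_rn_topology by metis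
  fix X x assume X: "range X \<subseteq> C" and xc: "as_conv X x"
  show "x \<in> C"
  proof (rule ccontr)
    assume "x \<notin> C"
    moreover have "openin (rn_topology M E) (carrier E - C)"
      using cl by (simp add: closedin_def topspace_rn_topology)
    moreover have "x \<in> carrier E" using xc by (simp add: as_conv_def)
    ultimately obtain \<epsilon> \<delta> where "0 < \<epsilon>" "0 < \<delta>" "rn_ball M E x \<epsilon> \<delta> \<subseteq> carrier E - C"
      unfolding openin_rn_topology by blast
    moreover obtain n where "X n \<in> rn_ball M E x \<epsilon> \<delta>"
      using as_conv_ball[OF xc \<open>0 < \<epsilon>\<close> \<open>0 < \<delta>\<close>] by (auto simp: eventually_sequentially)
    ultimately show False using X by blast
  qed
next
  assume *: "C \<subseteq> carrier E \<and> (\<forall>X x. range X \<subseteq> C \<longrightarrow> as_conv X x \<longrightarrow> x \<in> C)"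
  have "openin (rn_topology M E) (carrier E - C)"
    unfolding openin_rn_topology
  proof (intro conjI ballI)
    fix x assume x: "x \<in> carrier E - C"
    show "\<exists>\<epsilon> \<delta>. 0 < \<epsilon> \<and> 0 < \<delta> \<and> \<delta> < 1 \<and> rn_ball M E x \<epsilon> \<delta> \<subseteq> carrier E - C"
    proof (rule ccontr)
      assume no: "\<not> ?thesis"
      have "\<exists>y. y \<in> rn_ball M E x ((1/2) ^ Suc n) ((1/2) ^ Suc n) \<and> y \<in> C" for n
      proof -
        have "(0::real) < (1/2) ^ Suc n" "(1/2::real) ^ Suc n < 1"
          by (simp, rule power_Suc_less_one) simp_all
        with no have "\<not> rn_ball M E x ((1/2) ^ Suc n) ((1/2) ^ Suc n) \<subseteq> carrier E - C" by blast
        then show ?thesis using rn_ball_iff x by blast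
      qed
      then obtain X where "\<And>n. X n \<in> rn_ball M E x ((1/2) ^ Suc n) ((1/2) ^ Suc n)" "\<And>n. X n \<in> C"
        by metis
      then show False using as_convI_ball[of x X] * x by blast
    qed
  qed auto
  then show "closedin (rn_topology M E) C"
    using * by (simp add: closedin_def topspace_rn_topology)
qed

end

lemma N_rn_prod:
  fixes M :: "'w measure" and E :: "('w, 'e) rn_module"
  assumes "rn_module M E" and x: "x \<in> carrier E" "y \<in> carrier E" and r: "r \<in> rv M" "s \<in> rv M"
  shows "AE \<omega> in M. rn_module.N (rn_prod M E (L0 M)) ((x, r) \<ominus>\<^bsub>rn_prod M E (L0 M)\<^esub> (y, s)) \<omega>
    = rn_module.N E (x \<ominus>\<^bsub>E\<^esub> y) \<omega> + \<bar>rp r \<omega> - rp s \<omega>\<bar>"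
proof -
  interpret E: rn_module M E by fact
  interpret L: rn_module M "L0 M" using E.prob_space_axioms by (rule rn_module_L0)
  let ?P = "rn_prod M E (L0 M)"
  interpret P: rn_module M ?P using E.rn_module_axioms L.rn_module_axioms by (rule rn_module_prod)
  have c: "(y, s) \<in> carrier ?P" "(x, r) \<in> carrier ?P" using x r by (simp_all add: rn_prod_def)
  have inv: "\<ominus>\<^bsub>?P\<^esub> (y, s) = (\<ominus>\<^bsub>E\<^esub> y, \<ominus>\<^bsub>L0 M\<^esub> s)"
  proof (rule P.minus_equality)
    show "(\<ominus>\<^bsub>E\<^esub> y, \<ominus>\<^bsub>L0 M\<^esub> s) \<oplus>\<^bsub>?P\<^esub> (y, s) = \<zero>\<^bsub>?P\<^esub>"
      using x r abelian_group.l_neg[OF abelian_group_L0, of s] by (simp add: rn_prod_def E.l_neg)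
    show "(\<ominus>\<^bsub>E\<^esub> y, \<ominus>\<^bsub>L0 M\<^esub> s) \<in> carrier ?P"
      using x r abelian_group.a_inv_closed[OF abelian_group_L0, of s] by (simp add: rn_prod_def)
  qed (rule c)
  have eq: "(x, r) \<ominus>\<^bsub>?P\<^esub> (y, s) = (x \<ominus>\<^bsub>E\<^esub> y, r \<ominus>\<^bsub>L0 M\<^esub> s)"
    unfolding a_minus_def inv by (simp add: rn_prod_def)
  have rs: "r \<ominus>\<^bsub>L0 M\<^esub> s \<in> rv M" using r by (rule L0_closed)
  have nrs: "rnorm (L0 M) (r \<ominus>\<^bsub>L0 M\<^esub> s) \<in> rv M"
    using L.rnorm_rv rs by simp
  have abs: "AE \<omega> in M. rp (rnorm (L0 M) (r \<ominus>\<^bsub>L0 M\<^esub> s)) \<omega> = \<bar>rp (r \<ominus>\<^bsub>L0 M\<^esub> s) \<omega>\<bar>"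
    using rv_map_rv(3)[OF rs, of abs] by (simp add: L0_def)
  have "P.N ((x, r) \<ominus>\<^bsub>?P\<^esub> (y, s)) = rp (rnorm E (x \<ominus>\<^bsub>E\<^esub> y) \<oplus>\<^bsub>L0 M\<^esub> rnorm (L0 M) (r \<ominus>\<^bsub>L0 M\<^esub> s))"
    unfolding P.N_def eq by (simp add: rn_prod_def)
  then show ?thesis
    using L0_add_rp[OF E.rnorm_rv[of "x \<ominus>\<^bsub>E\<^esub> y"] nrs] L0_minus_rp[OF r] abs x
    by (auto simp: E.N_def elim!: AE_mp)
qed

context rn_module
begin

text \<open>The norm of the product is a sum of two nonnegative terms, so it tends to zero exactly
  when both coordinates converge.\<close>

lemma closedin_prod:
  "closedin (rn_topology M (rn_prod M E (L0 M))) C \<longleftrightarrow> C \<subseteq> carrier E \<times> rv M \<and>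
    (\<forall>X x R r. (\<forall>n. (X n, R n) \<in> C) \<longrightarrow> as_conv X x \<longrightarrow> r \<in> rv M \<longrightarrow>
      (AE \<omega> in M. (\<lambda>n. rp (R n) \<omega>) \<longlonglongrightarrow> rp r \<omega>) \<longrightarrow> (x, r) \<in> C)"
proof -
  interpret L: rn_module M "L0 M" using prob_space_axioms by (rule rn_module_L0)
  let ?P = "rn_prod M E (L0 M)"
  interpret P: rn_module M ?P using rn_module_axioms L.rn_module_axioms by (rule rn_module_prod)
  have carr: "carrier ?P = carrier E \<times> rv M" by (simp add: rn_prod_def)
  have conv: "P.as_conv Z (x, r) \<longleftrightarrow> as_conv (fst \<circ> Z) x \<and> r \<in> rv M \<and>
      (AE \<omega> in M. (\<lambda>n. rp (snd (Z n)) \<omega>) \<longlonglongrightarrow> rp r \<omega>)"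
    if Z: "range Z \<subseteq> carrier E \<times> rv M" for Z x r
  proof (cases "x \<in> carrier E \<and> r \<in> rv M")
    case True
    have Zc: "fst (Z n) \<in> carrier E" "snd (Z n) \<in> rv M" for n
      using subsetD[OF Z rangeI[of Z n]] by (simp_all add: mem_Times_iff)
    have "AE \<omega> in M. \<forall>n. P.N (Z n \<ominus>\<^bsub>?P\<^esub> (x, r)) \<omega>
        = N (fst (Z n) \<ominus> x) \<omega> + \<bar>rp (snd (Z n)) \<omega> - rp r \<omega>\<bar>"
      unfolding AE_all_countable
    proof
      fix n
      show "AE \<omega> in M. P.N (Z n \<ominus>\<^bsub>?P\<^esub> (x, r)) \<omega> = N (fst (Z n) \<ominus> x) \<omega> + \<bar>rp (snd (Z n)) \<omega> - rp r \<omega>\<bar>"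
        using N_rn_prod[OF rn_module_axioms Zc(1) _ Zc(2), of x r n n] True by simp
    qed
    moreover have "AE \<omega> in M. \<forall>n. 0 \<le> N (fst (Z n) \<ominus> x) \<omega>"
      unfolding AE_all_countable using N_nonneg Zc True by simp
    ultimately have *: "AE \<omega> in M. (\<lambda>n. P.N (Z n \<ominus>\<^bsub>?P\<^esub> (x, r)) \<omega>) \<longlonglongrightarrow> 0 \<longleftrightarrow>
        (\<lambda>n. N (fst (Z n) \<ominus> x) \<omega>) \<longlonglongrightarrow> 0 \<and> (\<lambda>n. rp (snd (Z n)) \<omega>) \<longlonglongrightarrow> rp r \<omega>"
    proof eventually_elim
      case (elim \<omega>)
      let ?a = "\<lambda>n. N (fst (Z n) \<ominus> x) \<omega>" and ?b = "\<lambda>n. \<bar>rp (snd (Z n)) \<omega> - rp r \<omega>\<bar>"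
      have "(\<lambda>n. ?a n + ?b n) \<longlonglongrightarrow> 0 \<longleftrightarrow> ?a \<longlonglongrightarrow> 0 \<and> ?b \<longlonglongrightarrow> 0"
      proof
        assume s: "(\<lambda>n. ?a n + ?b n) \<longlonglongrightarrow> 0"
        have "?a \<longlonglongrightarrow> 0" "?b \<longlonglongrightarrow> 0"
          by (rule tendsto_sandwich[OF _ _ tendsto_const s]; use elim in simp)+
        then show "?a \<longlonglongrightarrow> 0 \<and> ?b \<longlonglongrightarrow> 0" by simp
      qed (use tendsto_add[of ?a 0 _ ?b 0] in simp)
      also have "?b \<longlonglongrightarrow> 0 \<longleftrightarrow> (\<lambda>n. rp (snd (Z n)) \<omega>) \<longlonglongrightarrow> rp r \<omega>"
        by (simp only: tendsto_rabs_zero_iff LIM_zero_iff)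
      finally show ?case using elim by simp
    qed
    have "(AE \<omega> in M. (\<lambda>n. P.N (Z n \<ominus>\<^bsub>?P\<^esub> (x, r)) \<omega>) \<longlonglongrightarrow> 0) \<longleftrightarrow>
       (AE \<omega> in M. (\<lambda>n. N (fst (Z n) \<ominus> x) \<omega>) \<longlonglongrightarrow> 0 \<and> (\<lambda>n. rp (snd (Z n)) \<omega>) \<longlonglongrightarrow> rp r \<omega>)"
      (is "?l \<longleftrightarrow> ?r")
    proof
      show ?r if ?l using that * by eventually_elim simp
      show ?l if ?r using that * by eventually_elim simp
    qed
    then show ?thesis
      unfolding as_conv_def P.as_conv_def carr using Z True Zc by (simp add: image_subset_iff)
  qed (auto simp: as_conv_def P.as_conv_def carr)
  show ?thesis
    unfolding P.closedin_rn_topology carr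
  proof (intro conj_cong refl iffI allI impI)
    fix X x R r
    assume C: "C \<subseteq> carrier E \<times> rv M" and *: "\<forall>Z z. range Z \<subseteq> C \<longrightarrow> P.as_conv Z z \<longrightarrow> z \<in> C"
      and XR: "\<forall>n. (X n, R n) \<in> C" "as_conv X x" "r \<in> rv M" "AE \<omega> in M. (\<lambda>n. rp (R n) \<omega>) \<longlonglongrightarrow> rp r \<omega>"
    have "range (\<lambda>n. (X n, R n)) \<subseteq> C" using XR by auto
    moreover have "P.as_conv (\<lambda>n. (X n, R n)) (x, r)"
      using XR C \<open>range _ \<subseteq> C\<close> by (subst conv) (auto simp: comp_def)
    ultimately show "(x, r) \<in> C" using * by blast
  next
    fix Z z
    assume C: "C \<subseteq> carrier E \<times> rv M" and Z: "range Z \<subseteq> C" "P.as_conv Z z"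
      and *: "\<forall>X x R r. (\<forall>n. (X n, R n) \<in> C) \<longrightarrow> as_conv X x \<longrightarrow> r \<in> rv M \<longrightarrow>
      (AE \<omega> in M. (\<lambda>n. rp (R n) \<omega>) \<longlonglongrightarrow> rp r \<omega>) \<longrightarrow> (x, r) \<in> C"
    obtain x r where z: "z = (x, r)" by (cases z)
    have "as_conv (fst \<circ> Z) x \<and> r \<in> rv M \<and> (AE \<omega> in M. (\<lambda>n. rp (snd (Z n)) \<omega>) \<longlonglongrightarrow> rp r \<omega>)"
      using conv[of Z x r] Z C by (auto simp: z)
    moreover have "(fst \<circ> Z) n = fst (Z n)" "((fst \<circ> Z) n, (snd \<circ> Z) n) \<in> C" for n
      using Z(1) by auto
    ultimately show "z \<in> C"
      unfolding z using *[rule_format, of "fst \<circ> Z" "snd \<circ> Z" x r] by simp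
  qed
qed


section \<open>Convex functions in terms of representatives\<close>

lemma Cvx_rv: "f \<in> Cvx M E \<Longrightarrow> x \<in> carrier E \<Longrightarrow> f x \<in> rv M"
  by (auto simp: Cvx_def L0bar_def)

lemma Cvx_meas [measurable]: "f \<in> Cvx M E \<Longrightarrow> x \<in> carrier E \<Longrightarrow> rp (f x) \<in> borel_measurable M"
  by (rule rp_measurable[OF Cvx_rv])

lemma Cvx_eqI:
  assumes "f \<in> Cvx M E" "g \<in> Cvx M E" "\<And>x. x \<in> carrier E \<Longrightarrow> AE \<omega> in M. rp (f x) \<omega> = rp (g x) \<omega>"
  shows "f = g"
proof (rule extensionalityI)
  show "f \<in> extensional (carrier E)" "g \<in> extensional (carrier E)"
    using assms by (auto simp: Cvx_def PiE_def)
  show "f x = g x" if "x \<in> carrier E" for x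
    using assms(3)[OF that] rv_eq_iff[OF Cvx_rv[OF assms(1) that] Cvx_rv[OF assms(2) that]] by simp
qed

lemma Cvx_gt_MInfty:
  assumes f: "f \<in> Cvx M E" and x: "x \<in> carrier E"
  shows "AE \<omega> in M. -\<infinity> < rp (f x) \<omega>"
proof -
  have "rv_less M (rv_const M (-\<infinity>)) (f x)" using assms by (simp add: Cvx_def)
  then have "AE \<omega> in M. rp (rv_const M (-\<infinity>)) \<omega> < rp (f x) \<omega>"
    by (simp only: rv_less_iff[OF rv_const_rv Cvx_rv[OF f x]])
  with rp_rv_const[of M "-\<infinity>::ereal"] show ?thesis by eventually_elim simp
qed

lemma Cvx_dom:
  assumes f: "f \<in> Cvx M E"
  obtains x where "x \<in> carrier E" "AE \<omega> in M. rp (f x) \<omega> < \<infinity>"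
proof -
  have "L0_dom M E f \<noteq> {}" using f by (simp add: Cvx_def)
  then obtain x where x: "x \<in> carrier E" and "rv_less M (f x) (rv_const M \<infinity>)"
    by (auto simp: L0_dom_def)
  then have "AE \<omega> in M. rp (f x) \<omega> < rp (rv_const M \<infinity>) \<omega>"
    by (simp only: rv_less_iff[OF Cvx_rv[OF f x] rv_const_rv])
  with rp_rv_const[of M "\<infinity>::ereal"] have "AE \<omega> in M. rp (f x) \<omega> < \<infinity>" by eventually_elim simp
  with x that show ?thesis by blast
qed

lemma convex_term_rp:
  assumes \<xi>: "\<xi> \<in> rv M" and xy: "x \<in> carrier E" "y \<in> carrier E" and a: "a \<in> rv M" "b \<in> rv M"
  shows "\<xi> \<odot> x \<oplus> (\<one>\<^bsub>L0 M\<^esub> \<ominus>\<^bsub>L0 M\<^esub> \<xi>) \<odot> y = cv (rp \<xi>) x y"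
    and "L0bar_add M (L0bar_mult M (to_L0bar M \<xi>) a)
        (L0bar_mult M (to_L0bar M (\<one>\<^bsub>L0 M\<^esub> \<ominus>\<^bsub>L0 M\<^esub> \<xi>)) b) \<in> rv M"
    and "AE \<omega> in M. rp (L0bar_add M (L0bar_mult M (to_L0bar M \<xi>) a)
        (L0bar_mult M (to_L0bar M (\<one>\<^bsub>L0 M\<^esub> \<ominus>\<^bsub>L0 M\<^esub> \<xi>)) b)) \<omega> =
          ereal (rp \<xi> \<omega>) * rp a \<omega> + ereal (1 - rp \<xi> \<omega>) * rp b \<omega>"
proof -
  have 1: "\<one>\<^bsub>L0 M\<^esub> \<ominus>\<^bsub>L0 M\<^esub> \<xi> = rv_class M (\<lambda>\<omega>. 1 - rp \<xi> \<omega>)"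
    using L0_minus_class[of "\<lambda>_. 1" M "rp \<xi>"] \<xi> by (simp add: L0_one rp_measurable rv_class_rp)
  show "\<xi> \<odot> x \<oplus> (\<one>\<^bsub>L0 M\<^esub> \<ominus>\<^bsub>L0 M\<^esub> \<xi>) \<odot> y = cv (rp \<xi>) x y"
    by (simp add: 1 cv_def sm_def rv_class_rp \<xi>)
  have d: "\<one>\<^bsub>L0 M\<^esub> \<ominus>\<^bsub>L0 M\<^esub> \<xi> \<in> rv M" using L0_one_rv \<xi> by (rule L0_closed)
  have t: "to_L0bar M \<xi> \<in> rv M" "to_L0bar M (\<one>\<^bsub>L0 M\<^esub> \<ominus>\<^bsub>L0 M\<^esub> \<xi>) \<in> rv M"
    using \<xi> d by (simp_all add: to_L0bar_rp)
  have m: "L0bar_mult M (to_L0bar M \<xi>) a \<in> rv M"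
    "L0bar_mult M (to_L0bar M (\<one>\<^bsub>L0 M\<^esub> \<ominus>\<^bsub>L0 M\<^esub> \<xi>)) b \<in> rv M"
    using t a by (simp_all add: L0bar_mult_rp)
  show "L0bar_add M (L0bar_mult M (to_L0bar M \<xi>) a)
        (L0bar_mult M (to_L0bar M (\<one>\<^bsub>L0 M\<^esub> \<ominus>\<^bsub>L0 M\<^esub> \<xi>)) b) \<in> rv M"
    using m by (rule L0bar_add_rp)
  show "AE \<omega> in M. rp (L0bar_add M (L0bar_mult M (to_L0bar M \<xi>) a)
        (L0bar_mult M (to_L0bar M (\<one>\<^bsub>L0 M\<^esub> \<ominus>\<^bsub>L0 M\<^esub> \<xi>)) b)) \<omega> =
          ereal (rp \<xi> \<omega>) * rp a \<omega> + ereal (1 - rp \<xi> \<omega>) * rp b \<omega>"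
    using L0bar_add_rp(2)[OF m] L0bar_mult_rp(2)[OF t(1) a(1)] L0bar_mult_rp(2)[OF t(2) a(2)]
      to_L0bar_rp(2)[OF \<xi>] to_L0bar_rp(2)[OF d] L0_minus_rp[OF L0_one_rv \<xi>] L0_one_rp
    by eventually_elim simp
qed

lemma Cvx_convex:
  assumes f: "f \<in> Cvx M E" and x: "x \<in> carrier E" "y \<in> carrier E"
    and g [measurable]: "g \<in> borel_measurable M" and g01: "AE \<omega> in M. 0 \<le> g \<omega>" "AE \<omega> in M. g \<omega> \<le> 1"
  shows "AE \<omega> in M. rp (f (cv g x y)) \<omega> \<le> ereal (g \<omega>) * rp (f x) \<omega> + ereal (1 - g \<omega>) * rp (f y) \<omega>"
proof -
  let ?\<xi> = "rv_class M g"
  have \<xi>: "?\<xi> \<in> rv M" by auto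
  note fr = Cvx_rv[OF f x(1)] Cvx_rv[OF f x(2)]
  have r: "AE \<omega> in M. rp ?\<xi> \<omega> = g \<omega>" by (rule rp_rv_class) simp
  have cvr: "cv (rp ?\<xi>) x y = cv g x y"
    unfolding cv_def by (intro arg_cong2[of _ _ _ _ "(\<oplus>)"] sm_cong)
      (use r rp_measurable[OF \<xi>] in \<open>auto elim!: AE_mp\<close>)
  have "?\<xi> \<in> L0_plus M" "rv_le M ?\<xi> \<one>\<^bsub>L0 M\<^esub>"
    using g01 by (auto simp: L0_plus_def L0_zero L0_one rv_le_class rv_class_in_rv)
  moreover have "L0_convex M E f" using f by (simp add: Cvx_def)
  ultimately have "rv_le M (f (cv (rp ?\<xi>) x y)) (L0bar_add M (L0bar_mult M (to_L0bar M ?\<xi>) (f x))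
        (L0bar_mult M (to_L0bar M (\<one>\<^bsub>L0 M\<^esub> \<ominus>\<^bsub>L0 M\<^esub> ?\<xi>)) (f y)))"
    unfolding L0_convex_def convex_term_rp(1)[OF \<xi> x fr, symmetric] L0bar_def using x by simp
  then have "AE \<omega> in M. rp (f (cv g x y)) \<omega> \<le> rp (L0bar_add M (L0bar_mult M (to_L0bar M ?\<xi>) (f x))
        (L0bar_mult M (to_L0bar M (\<one>\<^bsub>L0 M\<^esub> \<ominus>\<^bsub>L0 M\<^esub> ?\<xi>)) (f y))) \<omega>"
    using x by (subst (asm) rv_le_iff) (auto simp: cvr intro!: Cvx_rv[OF f] convex_term_rp(2)[OF \<xi> x fr])
  with r convex_term_rp(3)[OF \<xi> x fr] show ?thesis by eventually_elim simp
qed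

lemma L0_epi_iff:
  assumes "f x \<in> rv M"
  shows "(x, r) \<in> L0_epi M E f \<longleftrightarrow>
    x \<in> carrier E \<and> r \<in> rv M \<and> (AE \<omega> in M. rp (f x) \<omega> \<le> ereal (rp r \<omega>))"
proof (cases "r \<in> rv M")
  case True
  have "rv_le M (f x) (to_L0bar M r) \<longleftrightarrow> (AE \<omega> in M. rp (f x) \<omega> \<le> rp (to_L0bar M r) \<omega>)"
    using assms to_L0bar_rp(1)[OF True] by (rule rv_le_iff)
  also have "\<dots> \<longleftrightarrow> (AE \<omega> in M. rp (f x) \<omega> \<le> ereal (rp r \<omega>))"
    using to_L0bar_rp(2)[OF True] by (auto elim!: AE_mp)
  finally show ?thesis using True by (simp add: L0_epi_def L0bar_def)
qed (simp add: L0_epi_def)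

text \<open>Closedness of the epigraph in the form used throughout; \<open>CvxI\<close> is the way
  back. Between them they keep classes and the product module out of all later arguments.\<close>

lemma Cvx_closed:
  assumes f: "f \<in> Cvx M E" and X: "as_conv X x"
    and R [measurable]: "\<And>n. R n \<in> borel_measurable M" "r \<in> borel_measurable M"
    and lim: "AE \<omega> in M. (\<lambda>n. R n \<omega>) \<longlonglongrightarrow> r \<omega>"
    and le: "\<And>n. AE \<omega> in M. rp (f (X n)) \<omega> \<le> ereal (R n \<omega>)"
  shows "AE \<omega> in M. rp (f x) \<omega> \<le> ereal (r \<omega>)"
proof -
  have c: "X n \<in> carrier E" "x \<in> carrier E" for n using X by (auto simp: as_conv_def)
  have r: "AE \<omega> in M. rp (rv_class M r) \<omega> = r \<omega>" by (rule rp_rv_class) simp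
  have Rn: "AE \<omega> in M. rp (rv_class M (R n)) \<omega> = R n \<omega>" for n by (rule rp_rv_class) simp
  have "AE \<omega> in M. \<forall>n. rp (rv_class M (R n)) \<omega> = R n \<omega>"
    unfolding AE_all_countable using Rn by blast
  then have l: "AE \<omega> in M. (\<lambda>n. rp (rv_class M (R n)) \<omega>) \<longlonglongrightarrow> rp (rv_class M r) \<omega>"
    using lim r by eventually_elim simp
  have mem: "(X n, rv_class M (R n)) \<in> L0_epi M E f" for n
  proof -
    have "AE \<omega> in M. rp (f (X n)) \<omega> \<le> ereal (rp (rv_class M (R n)) \<omega>)"
      using le[of n] Rn[of n] by eventually_elim simp
    then show ?thesis
      using c L0_epi_iff[of f "X n", OF Cvx_rv[OF f c(1)]] by (simp add: rv_class_in_rv)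
  qed
  have "closedin (rn_topology M (rn_prod M E (L0 M))) (L0_epi M E f)"
    using f by (simp add: Cvx_def)
  from conjunct2[OF iffD1[OF closedin_prod this], rule_format, OF mem X _ l]
  have "(x, rv_class M r) \<in> L0_epi M E f"
    by (simp add: rv_class_in_rv)
  then have "AE \<omega> in M. rp (f x) \<omega> \<le> ereal (rp (rv_class M r) \<omega>)"
    using L0_epi_iff[of f x, OF Cvx_rv[OF f c(2)]] by blast
  with r show ?thesis by eventually_elim simp
qed

lemma CvxI:
  assumes ext: "f \<in> carrier E \<rightarrow>\<^sub>E rv M"
    and gt: "\<And>x. x \<in> carrier E \<Longrightarrow> AE \<omega> in M. -\<infinity> < rp (f x) \<omega>"
    and d: "d \<in> carrier E" "AE \<omega> in M. rp (f d) \<omega> < \<infinity>"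
    and conv: "\<And>x y g. x \<in> carrier E \<Longrightarrow> y \<in> carrier E \<Longrightarrow> g \<in> borel_measurable M \<Longrightarrow>
      AE \<omega> in M. 0 \<le> g \<omega> \<Longrightarrow> AE \<omega> in M. g \<omega> \<le> 1 \<Longrightarrow>
      AE \<omega> in M. rp (f (cv g x y)) \<omega> \<le> ereal (g \<omega>) * rp (f x) \<omega> + ereal (1 - g \<omega>) * rp (f y) \<omega>"
    and cl: "\<And>X x R r. as_conv X x \<Longrightarrow> (\<And>n. R n \<in> borel_measurable M) \<Longrightarrow> r \<in> borel_measurable M \<Longrightarrow>
      AE \<omega> in M. (\<lambda>n. R n \<omega>) \<longlonglongrightarrow> r \<omega> \<Longrightarrow> (\<And>n. AE \<omega> in M. rp (f (X n)) \<omega> \<le> ereal (R n \<omega>)) \<Longrightarrow>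
      AE \<omega> in M. rp (f x) \<omega> \<le> ereal (r \<omega>)"
  shows "f \<in> Cvx M E"
proof -
  have fr: "f x \<in> rv M" if "x \<in> carrier E" for x using ext that by auto
  have "rv_less M (rv_const M (-\<infinity>)) (f x)" if "x \<in> carrier E" for x
    unfolding rv_less_iff[OF rv_const_rv fr[OF that]]
    using gt[OF that] rp_rv_const[of M "-\<infinity>::ereal"] by eventually_elim simp
  moreover have "d \<in> L0_dom M E f"
  proof -
    have "AE \<omega> in M. rp (f d) \<omega> < rp (rv_const M \<infinity>) \<omega>"
      using d(2) rp_rv_const[of M "\<infinity>::ereal"] by eventually_elim simp
    then show ?thesis
      unfolding L0_dom_def using d(1) rv_less_iff[OF fr[OF d(1)] rv_const_rv] by simp
  qed
  moreover have "L0_convex M E f"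
    unfolding L0_convex_def
  proof (intro ballI impI)
    fix x y \<xi> assume x: "x \<in> carrier E" "y \<in> carrier E" and "\<xi> \<in> L0_plus M" "rv_le M \<xi> \<one>\<^bsub>L0 M\<^esub>"
    then have \<xi>: "\<xi> \<in> rv M" and "rv_le M \<zero>\<^bsub>L0 M\<^esub> \<xi>" "rv_le M \<xi> \<one>\<^bsub>L0 M\<^esub>" by (auto simp: L0_plus_def)
    then have "AE \<omega> in M. rp \<zero>\<^bsub>L0 M\<^esub> \<omega> \<le> rp \<xi> \<omega>" "AE \<omega> in M. rp \<xi> \<omega> \<le> rp \<one>\<^bsub>L0 M\<^esub> \<omega>"
      by (simp_all add: rv_le_iff L0_zero_rv L0_one_rv)
    then have "AE \<omega> in M. 0 \<le> rp \<xi> \<omega> \<and> rp \<xi> \<omega> \<le> 1"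
      using L0_zero_rp[of M] L0_one_rp[of M] by eventually_elim simp
    then have 0: "AE \<omega> in M. 0 \<le> rp \<xi> \<omega>" and 1: "AE \<omega> in M. rp \<xi> \<omega> \<le> 1" by auto
    have [measurable]: "rp \<xi> \<in> borel_measurable M" by (rule rp_measurable[OF \<xi>])
    note t = convex_term_rp[OF \<xi> x fr[OF x(1)] fr[OF x(2)]]
    show "f (\<xi> \<odot> x \<oplus> (\<one>\<^bsub>L0 M\<^esub> \<ominus>\<^bsub>L0 M\<^esub> \<xi>) \<odot> y) \<sqsubseteq>\<^bsub>L0bar M\<^esub>
      L0bar_add M (L0bar_mult M (to_L0bar M \<xi>) (f x))
        (L0bar_mult M (to_L0bar M (\<one>\<^bsub>L0 M\<^esub> \<ominus>\<^bsub>L0 M\<^esub> \<xi>)) (f y))"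
    proof -
      have "cv (rp \<xi>) x y \<in> carrier E" using x by simp
      moreover have "AE \<omega> in M. rp (f (cv (rp \<xi>) x y)) \<omega> \<le>
          ereal (rp \<xi> \<omega>) * rp (f x) \<omega> + ereal (1 - rp \<xi> \<omega>) * rp (f y) \<omega>"
        by (rule conv[OF x _ 0 1]) simp
      with t(3) have "AE \<omega> in M. rp (f (cv (rp \<xi>) x y)) \<omega> \<le>
          rp (L0bar_add M (L0bar_mult M (to_L0bar M \<xi>) (f x))
        (L0bar_mult M (to_L0bar M (\<one>\<^bsub>L0 M\<^esub> \<ominus>\<^bsub>L0 M\<^esub> \<xi>)) (f y))) \<omega>"
        by eventually_elim simp
      ultimately show ?thesis
        unfolding t(1) using rv_le_iff[OF fr t(2)] by (simp add: L0bar_def)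
    qed
  qed
  moreover have "closedin (rn_topology M (rn_prod M E (L0 M))) (L0_epi M E f)"
    unfolding closedin_prod
  proof (intro conjI allI impI)
    show "L0_epi M E f \<subseteq> carrier E \<times> rv M" by (auto simp: L0_epi_def)
    fix X x R r
    assume XR: "\<forall>n. (X n, R n) \<in> L0_epi M E f" and conv: "as_conv X x" and r: "r \<in> rv M"
      and lim: "AE \<omega> in M. (\<lambda>n. rp (R n) \<omega>) \<longlonglongrightarrow> rp r \<omega>"
    have c: "X n \<in> carrier E" "x \<in> carrier E" for n using conv by (auto simp: as_conv_def)
    have Rn: "R n \<in> rv M" "AE \<omega> in M. rp (f (X n)) \<omega> \<le> ereal (rp (R n) \<omega>)" for n
      using XR L0_epi_iff[of f "X n" "R n"] fr[OF c(1)] by auto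
    show "(x, r) \<in> L0_epi M E f"
      unfolding L0_epi_iff[of f x r, OF fr[OF c(2)]]
      using cl[OF conv rp_measurable[OF Rn(1)] rp_measurable[OF r] lim Rn(2)] c r by simp
  qed
  ultimately show ?thesis using ext by (auto simp: Cvx_def L0bar_def)
qed


section \<open>Locality and pasting of convex functions\<close>

text \<open>Convexity with an indicator as weight: with A the event where x and y agree,
  \<open>cmb ?A x y = y\<close>, and on A the inequality reads f y \<le> f x because the term of
  weight zero vanishes even if it is infinite. Exchanging x and y gives equality.\<close>

lemma Cvx_local:
  assumes f: "f \<in> Cvx M E" and x: "x \<in> carrier E" "y \<in> carrier E"
  shows "AE \<omega> in M. N (x \<ominus> y) \<omega> = 0 \<longrightarrow> rp (f x) \<omega> = rp (f y) \<omega>"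
proof -
  have le: "AE \<omega> in M. N (x \<ominus> y) \<omega> = 0 \<longrightarrow> rp (f y) \<omega> \<le> rp (f x) \<omega>"
    if x: "x \<in> carrier E" "y \<in> carrier E" for x y
  proof -
    have [measurable]: "N (x \<ominus> y) \<in> borel_measurable M" using x by (intro N_meas) simp
    let ?A = "{\<omega> \<in> space M. N (x \<ominus> y) \<omega> = 0}"
    have A [measurable]: "?A \<in> events" by measurable
    have "cmb ?A x y = y"
      using x N_minus_self[OF x(2)] by (intro eq_cmbI A) (auto elim: AE_mp)
    moreover have "AE \<omega> in M. rp (f (cmb ?A x y)) \<omega> \<le> ereal (indicator ?A \<omega>) * rp (f x) \<omega>
        + ereal (1 - indicator ?A \<omega>) * rp (f y) \<omega>"
      using x by (intro Cvx_convex f) auto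
    ultimately have "AE \<omega> in M. rp (f y) \<omega> \<le> ereal (indicator ?A \<omega>) * rp (f x) \<omega>
        + ereal (1 - indicator ?A \<omega>) * rp (f y) \<omega>" by simp
    with AE_space show ?thesis
    proof eventually_elim
      case (elim \<omega>)
      then show ?case by (cases "N (x \<ominus> y) \<omega> = 0") (simp_all flip: zero_ereal_def one_ereal_def)
    qed
  qed
  show ?thesis
    using le[OF x] le[OF x(2,1)] N_minus_commute[OF x] by eventually_elim auto
qed

lemma N_diff_le:
  assumes c: "x \<in> carrier E" "y \<in> carrier E" "z \<in> carrier E"
  shows "AE \<omega> in M. \<bar>N (x \<ominus> z) \<omega> - N (y \<ominus> z) \<omega>\<bar> \<le> N (x \<ominus> y) \<omega>"
  using N_triangle_minus[OF c] N_triangle_minus[OF c(2,1,3)] N_minus_commute[OF c(1,2)]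
  by eventually_elim linarith

lemma as_conv_N:
  assumes X: "as_conv X x" and z: "z \<in> carrier E"
  shows "AE \<omega> in M. (\<lambda>n. N (X n \<ominus> z) \<omega>) \<longlonglongrightarrow> N (x \<ominus> z) \<omega>"
proof -
  have c: "X n \<in> carrier E" "x \<in> carrier E" for n using X by (auto simp: as_conv_def)
  have "AE \<omega> in M. \<forall>n. \<bar>N (X n \<ominus> z) \<omega> - N (x \<ominus> z) \<omega>\<bar> \<le> N (X n \<ominus> x) \<omega>"
    by (intro AE_allI N_diff_le c z)
  moreover have "AE \<omega> in M. (\<lambda>n. N (X n \<ominus> x) \<omega>) \<longlonglongrightarrow> 0" using X by (simp add: as_conv_def)
  ultimately show ?thesis
  proof eventually_elim
    case (elim \<omega>)
    have "(\<lambda>n. N (X n \<ominus> z) \<omega> - N (x \<ominus> z) \<omega>) \<longlonglongrightarrow> 0"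
      by (rule Lim_null_comparison[OF _ elim(2)]) (use elim(1) in simp)
    then show ?case by (simp only: LIM_zero_iff)
  qed
qed

lemma as_conv_N_norm:
  assumes "as_conv X x"
  shows "AE \<omega> in M. (\<lambda>n. N (X n) \<omega>) \<longlonglongrightarrow> N x \<omega>"
proof -
  have c: "X n \<in> carrier E" "x \<in> carrier E" for n using assms by (auto simp: as_conv_def)
  show ?thesis
    using as_conv_N[OF assms zero_closed] minus_zero_right[OF c(1)] minus_zero_right[OF c(2)] by simp
qed

lemma as_conv_cmb:
  assumes X: "as_conv X x" and A: "A \<in> events" and d: "d \<in> carrier E"
  shows "as_conv (\<lambda>n. cmb A (X n) d) (cmb A x d)"
proof -
  have c: "X n \<in> carrier E" "x \<in> carrier E" for n using X by (auto simp: as_conv_def)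
  have [measurable]: "indicat_real A \<in> borel_measurable M" using A by simp
  have "AE \<omega> in M. \<forall>n. N (cmb A (X n) d \<ominus> cmb A x d) \<omega>
      \<le> \<bar>indicator A \<omega>\<bar> * N (X n \<ominus> x) \<omega> + \<bar>1 - indicator A \<omega>\<bar> * N (d \<ominus> d) \<omega>"
    using c d N_cv_le[of "indicat_real A"] by (intro AE_allI) (simp add: cv_minus_cv)
  moreover have "AE \<omega> in M. \<forall>n. 0 \<le> N (cmb A (X n) d \<ominus> cmb A x d) \<omega>"
    using c d by (intro AE_allI N_nonneg) simp
  moreover have "AE \<omega> in M. (\<lambda>n. N (X n \<ominus> x) \<omega>) \<longlonglongrightarrow> 0" using X by (simp add: as_conv_def)
  ultimately have "AE \<omega> in M. (\<lambda>n. N (cmb A (X n) d \<ominus> cmb A x d) \<omega>) \<longlonglongrightarrow> 0"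
    using N_minus_self[OF d]
  proof eventually_elim
    case (elim \<omega>)
    have "(\<lambda>n. \<bar>indicat_real A \<omega>\<bar> * N (X n \<ominus> x) \<omega>) \<longlonglongrightarrow> 0"
      using tendsto_mult[OF tendsto_const elim(3), of "\<bar>indicat_real A \<omega>\<bar>"] by simp
    then show ?case
      by (rule Lim_null_comparison[rotated]) (use elim in simp)
  qed
  then show ?thesis using c d by (auto simp: as_conv_def)
qed

text \<open>Off A the sequence is replaced by a fixed point d at which f is finite, with its own
  value as bound. The hypotheses then hold on the whole space and \<open>Cvx_closed\<close> applies;
  locality removes d again on A.\<close>

lemma Cvx_closed_on:
  assumes f: "f \<in> Cvx M E" and X: "as_conv X x" and A: "A \<in> events"
    and R [measurable]: "\<And>n. R n \<in> borel_measurable M" "r \<in> borel_measurable M"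
    and lim: "AE \<omega> in M. \<omega> \<in> A \<longrightarrow> (\<lambda>n. R n \<omega>) \<longlonglongrightarrow> r \<omega>"
    and le: "\<And>n. AE \<omega> in M. \<omega> \<in> A \<longrightarrow> rp (f (X n)) \<omega> \<le> ereal (R n \<omega>)"
  shows "AE \<omega> in M. \<omega> \<in> A \<longrightarrow> rp (f x) \<omega> \<le> ereal (r \<omega>)"
proof -
  have c: "X n \<in> carrier E" "x \<in> carrier E" for n using X by (auto simp: as_conv_def)
  obtain d where d: "d \<in> carrier E" and fd: "AE \<omega> in M. rp (f d) \<omega> < \<infinity>" by (rule Cvx_dom[OF f])
  have [measurable]: "A \<in> sets M" "rp (f d) \<in> borel_measurable M"
    using A Cvx_meas[OF f d] by auto
  have [measurable]: "indicat_real A \<in> borel_measurable M" by simp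
  let ?d = "\<lambda>\<omega>. real_of_ereal (rp (f d) \<omega>)"
  have "AE \<omega> in M. rp (f (cmb A x d)) \<omega> \<le> ereal (if \<omega> \<in> A then r \<omega> else ?d \<omega>)"
  proof (rule Cvx_closed[OF f as_conv_cmb[OF X A d], where R = "\<lambda>n \<omega>. if \<omega> \<in> A then R n \<omega> else ?d \<omega>"])
    show "AE \<omega> in M. (\<lambda>n. if \<omega> \<in> A then R n \<omega> else ?d \<omega>) \<longlonglongrightarrow> (if \<omega> \<in> A then r \<omega> else ?d \<omega>)"
      using lim by eventually_elim auto
    fix n
    have e: "cmb A (X n) d \<in> carrier E" using c d by auto
    show "AE \<omega> in M. rp (f (cmb A (X n) d)) \<omega> \<le> ereal (if \<omega> \<in> A then R n \<omega> else ?d \<omega>)"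
      using le[of n] Cvx_local[OF f e c(1)[of n]] Cvx_local[OF f e d] N_cmb_minus[OF A c(1)[of n] d c(1)[of n]]
        N_cmb_minus[OF A c(1)[of n] d d] N_minus_self[OF d] N_minus_self[OF c(1)[of n]] fd Cvx_gt_MInfty[OF f d]
      by eventually_elim (auto simp: ereal_real)
  qed auto
  moreover have e: "cmb A x d \<in> carrier E" using c d by auto
  ultimately show ?thesis
    using Cvx_local[OF f e c(2)] N_cmb_minus[OF A c(2) d c(2)] N_minus_self[OF c(2)]
    by eventually_elim auto
qed

lemma paste_rp:
  assumes f: "f \<in> Cvx M E" and g: "g \<in> Cvx M E" and A: "A \<in> events" and x: "x \<in> carrier E"
  shows "paste M E A f g x \<in> rv M"
    and "AE \<omega> in M. rp (paste M E A f g x) \<omega> = (if \<omega> \<in> A then rp (f x) \<omega> else rp (g x) \<omega>)"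
proof -
  have A': "space M - A \<in> events" using A by auto
  note i = rv_ind_rp[OF A] rv_ind_rp[OF A']
  note m1 = L0bar_mult_rp[OF i(1) Cvx_rv[OF f x]] and m2 = L0bar_mult_rp[OF i(3) Cvx_rv[OF g x]]
  note s = L0bar_add_rp[OF m1(1) m2(1)]
  show "paste M E A f g x \<in> rv M" using s(1) x by (simp add: paste_def)
  show "AE \<omega> in M. rp (paste M E A f g x) \<omega> = (if \<omega> \<in> A then rp (f x) \<omega> else rp (g x) \<omega>)"
    using s(2) m1(2) m2(2) i(2,4) AE_space
    by eventually_elim (use x in \<open>simp add: paste_def indicator_def\<close>)
qed

text \<open>Properness comes from gluing a point of one domain to a point of the other; closedness
  is checked separately on A and on its complement, which is what \<open>Cvx_closed_on\<close> is
  for.\<close>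

lemma paste_Cvx:
  assumes f: "f \<in> Cvx M E" and g: "g \<in> Cvx M E" and A: "A \<in> events"
  shows "paste M E A f g \<in> Cvx M E"
proof -
  obtain d where d: "d \<in> carrier E" and fd: "AE \<omega> in M. rp (f d) \<omega> < \<infinity>" by (rule Cvx_dom[OF f])
  obtain e where e: "e \<in> carrier E" and ge: "AE \<omega> in M. rp (g e) \<omega> < \<infinity>" by (rule Cvx_dom[OF g])
  have [measurable]: "indicat_real A \<in> borel_measurable M" using A by simp
  note pr = paste_rp[OF f g A]
  show ?thesis
  proof (rule CvxI)
    show "paste M E A f g \<in> carrier E \<rightarrow>\<^sub>E rv M"
      using pr(1) by (auto simp: paste_def)
    show "AE \<omega> in M. -\<infinity> < rp (paste M E A f g x) \<omega>" if "x \<in> carrier E" for x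
      using Cvx_gt_MInfty[OF f that] Cvx_gt_MInfty[OF g that] pr(2)[OF that]
      by eventually_elim auto
    show c: "cmb A d e \<in> carrier E" using d e by auto
    show "AE \<omega> in M. rp (paste M E A f g (cmb A d e)) \<omega> < \<infinity>"
      using pr(2)[OF c] Cvx_local[OF f c d] Cvx_local[OF g c e] N_cmb_minus[OF A d e d]
        N_cmb_minus[OF A d e e] N_minus_self[OF d] N_minus_self[OF e] fd ge
      by eventually_elim auto
  next
    fix x y and h :: "'w \<Rightarrow> real" assume x: "x \<in> carrier E" "y \<in> carrier E" and h: "h \<in> borel_measurable M"
      "AE \<omega> in M. 0 \<le> h \<omega>" "AE \<omega> in M. h \<omega> \<le> 1"
    have c: "cv h x y \<in> carrier E" using x h by auto
    show "AE \<omega> in M. rp (paste M E A f g (cv h x y)) \<omega> \<le> ereal (h \<omega>) * rp (paste M E A f g x) \<omega> +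
        ereal (1 - h \<omega>) * rp (paste M E A f g y) \<omega>"
      using Cvx_convex[OF f x h] Cvx_convex[OF g x h] pr(2)[OF c] pr(2)[OF x(1)] pr(2)[OF x(2)]
      by eventually_elim auto
  next
    fix X x and R :: "nat \<Rightarrow> 'w \<Rightarrow> real" and r assume X: "as_conv X x" and m: "\<And>n. R n \<in> borel_measurable M" "r \<in> borel_measurable M"
      and lim: "AE \<omega> in M. (\<lambda>n. R n \<omega>) \<longlonglongrightarrow> r \<omega>"
      and le: "\<And>n. AE \<omega> in M. rp (paste M E A f g (X n)) \<omega> \<le> ereal (R n \<omega>)"
    have c: "X n \<in> carrier E" "x \<in> carrier E" for n using X by (auto simp: as_conv_def)
    have A': "space M - A \<in> events" using A by auto
    have "AE \<omega> in M. \<omega> \<in> A \<longrightarrow> rp (f x) \<omega> \<le> ereal (r \<omega>)"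
    proof (rule Cvx_closed_on[OF f X A m])
      show "AE \<omega> in M. \<omega> \<in> A \<longrightarrow> rp (f (X n)) \<omega> \<le> ereal (R n \<omega>)" for n
        using le[of n] pr(2)[OF c(1)[of n]] by eventually_elim auto
    qed (use lim in auto)
    moreover have "AE \<omega> in M. \<omega> \<in> space M - A \<longrightarrow> rp (g x) \<omega> \<le> ereal (r \<omega>)"
    proof (rule Cvx_closed_on[OF g X A' m])
      show "AE \<omega> in M. \<omega> \<in> space M - A \<longrightarrow> rp (g (X n)) \<omega> \<le> ereal (R n \<omega>)" for n
        using le[of n] pr(2)[OF c(1)[of n]] by eventually_elim auto
    qed (use lim in auto)
    ultimately show "AE \<omega> in M. rp (paste M E A f g x) \<omega> \<le> ereal (r \<omega>)"
      using pr(2)[OF c(2)] AE_space by eventually_elim auto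
  qed
qed


section \<open>Functions with given representatives\<close>

definition fn :: "('e \<Rightarrow> 'w \<Rightarrow> ereal) \<Rightarrow> 'e \<Rightarrow> ('w \<Rightarrow> ereal) set" where
  "fn F = (\<lambda>x\<in>carrier E. rv_class M (F x))"

lemma fn_rp:
  assumes "x \<in> carrier E" "F x \<in> borel_measurable M"
  shows "AE \<omega> in M. rp (fn F x) \<omega> = F x \<omega>"
  using rp_rv_class[OF assms(2)] assms(1) by (simp add: fn_def)

lemma fn_CvxI:
  assumes m: "\<And>x. x \<in> carrier E \<Longrightarrow> F x \<in> borel_measurable M"
    and gt: "\<And>x. x \<in> carrier E \<Longrightarrow> AE \<omega> in M. -\<infinity> < F x \<omega>"
    and d: "d \<in> carrier E" "AE \<omega> in M. F d \<omega> < \<infinity>"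
    and conv: "\<And>x y g. x \<in> carrier E \<Longrightarrow> y \<in> carrier E \<Longrightarrow> g \<in> borel_measurable M \<Longrightarrow>
      AE \<omega> in M. 0 \<le> g \<omega> \<Longrightarrow> AE \<omega> in M. g \<omega> \<le> 1 \<Longrightarrow>
      AE \<omega> in M. F (cv g x y) \<omega> \<le> ereal (g \<omega>) * F x \<omega> + ereal (1 - g \<omega>) * F y \<omega>"
    and cl: "\<And>X x R r. as_conv X x \<Longrightarrow> AE \<omega> in M. (\<lambda>n. R n \<omega>) \<longlonglongrightarrow> r \<omega> \<Longrightarrow>
      AE \<omega> in M. \<forall>n. F (X n) \<omega> \<le> ereal (R n \<omega>) \<Longrightarrow> AE \<omega> in M. F x \<omega> \<le> ereal (r \<omega>)"
  shows "fn F \<in> Cvx M E"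
proof (rule CvxI)
  show "fn F \<in> carrier E \<rightarrow>\<^sub>E rv M" using m by (auto simp: fn_def)
  have rp: "AE \<omega> in M. rp (fn F x) \<omega> = F x \<omega>" if "x \<in> carrier E" for x
    using that m by (intro fn_rp)
  show "AE \<omega> in M. -\<infinity> < rp (fn F x) \<omega>" if x: "x \<in> carrier E" for x
    using gt[OF x] rp[OF x] by eventually_elim simp
  show "d \<in> carrier E" by (rule d)
  show "AE \<omega> in M. rp (fn F d) \<omega> < \<infinity>"
    using d(2) rp[OF d(1)] by eventually_elim simp
  show "AE \<omega> in M. rp (fn F (cv g x y)) \<omega> \<le> ereal (g \<omega>) * rp (fn F x) \<omega> + ereal (1 - g \<omega>) * rp (fn F y) \<omega>"
    if x: "x \<in> carrier E" and y: "y \<in> carrier E" and g: "g \<in> borel_measurable M" "AE \<omega> in M. 0 \<le> g \<omega>" "AE \<omega> in M. g \<omega> \<le> 1"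
    for x y g
  proof -
    have c: "cv g x y \<in> carrier E" using x y g by auto
    show ?thesis
      using conv[OF x y g] rp[OF x] rp[OF y] rp[OF c] by eventually_elim simp
  qed
  fix X x and R :: "nat \<Rightarrow> 'w \<Rightarrow> real" and r assume X: "as_conv X x" and m: "\<And>n. R n \<in> borel_measurable M" "r \<in> borel_measurable M"
    and lim: "AE \<omega> in M. (\<lambda>n. R n \<omega>) \<longlonglongrightarrow> r \<omega>"
    and le: "\<And>n. AE \<omega> in M. rp (fn F (X n)) \<omega> \<le> ereal (R n \<omega>)"
  have c: "X n \<in> carrier E" "x \<in> carrier E" for n using X by (auto simp: as_conv_def)
  have "AE \<omega> in M. F (X n) \<omega> \<le> ereal (R n \<omega>)" for n
    using le[of n] rp[OF c(1), of n] by eventually_elim simp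
  then have "AE \<omega> in M. F x \<omega> \<le> ereal (r \<omega>)"
    by (intro cl[OF X lim] AE_allI)
  with rp[OF c(2)] show "AE \<omega> in M. rp (fn F x) \<omega> \<le> ereal (r \<omega>)" by eventually_elim simp
qed

text \<open>Its image under T is the negative of the offset, which later controls the functional
  part.\<close>

lemma zero_fn_Cvx: "fn (\<lambda>x \<omega>. 0) \<in> Cvx M E"
proof (rule fn_CvxI)
  fix X x and R :: "nat \<Rightarrow> 'w \<Rightarrow> real" and r assume "AE \<omega> in M. (\<lambda>n. R n \<omega>) \<longlonglongrightarrow> r \<omega>" "AE \<omega> in M. \<forall>n::nat. 0 \<le> ereal (R n \<omega>)"
  then show "AE \<omega> in M. 0 \<le> ereal (r \<omega>)"
    by eventually_elim (auto intro: LIMSEQ_le_const)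
qed auto

text \<open>Its image under T contains the norm of the image point, which later controls the module
  endomorphism.\<close>

lemma norm_fn_Cvx: "fn (\<lambda>x \<omega>. ereal (N x \<omega>)) \<in> Cvx M E"
proof (rule fn_CvxI[where d = \<zero>])
  fix x y and g :: "'w \<Rightarrow> real" assume c: "x \<in> carrier E" "y \<in> carrier E" and [measurable]: "g \<in> borel_measurable M"
    and g: "AE \<omega> in M. 0 \<le> g \<omega>" "AE \<omega> in M. g \<omega> \<le> 1"
  show "AE \<omega> in M. ereal (N (cv g x y) \<omega>) \<le> ereal (g \<omega>) * ereal (N x \<omega>) + ereal (1 - g \<omega>) * ereal (N y \<omega>)"
    using N_cv_le[of g x y] c g by (auto elim!: AE_mp)
next
  fix X x and R :: "nat \<Rightarrow> 'w \<Rightarrow> real" and r assume X: "as_conv X x" and 1: "AE \<omega> in M. (\<lambda>n. R n \<omega>) \<longlonglongrightarrow> r \<omega>"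
    and 2: "AE \<omega> in M. \<forall>n::nat. ereal (N (X n) \<omega>) \<le> ereal (R n \<omega>)"
  show "AE \<omega> in M. ereal (N x \<omega>) \<le> ereal (r \<omega>)"
    using 1 2 as_conv_N_norm[OF X]
  proof eventually_elim
    case (elim \<omega>)
    then show ?case by (auto intro: LIMSEQ_le)
  qed
next
  show "AE \<omega> in M. -\<infinity> < ereal (N x \<omega>)" for x by simp
qed auto

section \<open>Point functions\<close>

text \<open>Finiteness is decided separately at each \<open>\<omega>\<close>, by whether y agrees
  with x there, and not by y = x as elements; any member of \<open>Cvx M E\<close> has to be local
  in this sense.\<close>

definition pt :: "'e \<Rightarrow> ('w \<Rightarrow> real) \<Rightarrow> 'e \<Rightarrow> ('w \<Rightarrow> ereal) set" where
  "pt x r = fn (\<lambda>y \<omega>. if N (y \<ominus> x) \<omega> = 0 then ereal (r \<omega>) else \<infinity>)"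

lemma pt_rp:
  assumes x: "x \<in> carrier E" "y \<in> carrier E" and [measurable]: "r \<in> borel_measurable M"
  shows "AE \<omega> in M. rp (pt x r y) \<omega> = (if N (y \<ominus> x) \<omega> = 0 then ereal (r \<omega>) else \<infinity>)"
proof -
  have [measurable]: "N (y \<ominus> x) \<in> borel_measurable M" using x by (intro N_meas) simp
  show ?thesis unfolding pt_def by (rule fn_rp) (use x in simp_all)
qed

lemma pt_Cvx:
  assumes x: "x \<in> carrier E" and [measurable]: "r \<in> borel_measurable M"
  shows "pt x r \<in> Cvx M E"
  unfolding pt_def
proof (rule fn_CvxI[where d = x])
  show "(\<lambda>\<omega>. if N (y \<ominus> x) \<omega> = 0 then ereal (r \<omega>) else \<infinity>) \<in> borel_measurable M"
    if y: "y \<in> carrier E" for y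
  proof -
    have [measurable]: "N (y \<ominus> x) \<in> borel_measurable M" using x y by (intro N_meas) simp
    show ?thesis by measurable
  qed
  show "AE \<omega> in M. (if N (x \<ominus> x) \<omega> = 0 then ereal (r \<omega>) else \<infinity>) < \<infinity>"
    using N_minus_self[OF x] by eventually_elim simp
next
  fix u v and g :: "'w \<Rightarrow> real" assume c: "u \<in> carrier E" "v \<in> carrier E" and [measurable]: "g \<in> borel_measurable M"
    and g: "AE \<omega> in M. 0 \<le> g \<omega>" "AE \<omega> in M. g \<omega> \<le> 1"
  have gm: "g \<in> borel_measurable M" by simp
  have w: "cv g u v \<ominus> x \<in> carrier E" using c x by simp
  show "AE \<omega> in M. (if N (cv g u v \<ominus> x) \<omega> = 0 then ereal (r \<omega>) else \<infinity>)
    \<le> ereal (g \<omega>) * (if N (u \<ominus> x) \<omega> = 0 then ereal (r \<omega>) else \<infinity>)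
      + ereal (1 - g \<omega>) * (if N (v \<ominus> x) \<omega> = 0 then ereal (r \<omega>) else \<infinity>)"
    using N_cv_minus_le[OF gm c x] N_nonneg[OF w] g
  proof eventually_elim
    case (elim \<omega>)
    \<comment> \<open>At a weight 0 or 1 the other term drops out by 0 * \<infinity> = 0. In
      between, the right side is finite only if both points agree with x at this
      \<open>\<omega>\<close>, and then so does their combination.\<close>
    consider "g \<omega> = 0" | "g \<omega> = 1" | "0 < g \<omega>" "g \<omega> < 1" using elim by linarith
    then show ?case
    proof cases
      case 3
      then show ?thesis using elim by (auto simp: algebra_simps)
    qed (use elim in \<open>auto simp: zero_ereal_def[symmetric] one_ereal_def[symmetric]\<close>)
  qed
next
  fix X y and R :: "nat \<Rightarrow> 'w \<Rightarrow> real" and s assume X: "as_conv X y"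
    and 1: "AE \<omega> in M. (\<lambda>n. R n \<omega>) \<longlonglongrightarrow> s \<omega>"
    and 2: "AE \<omega> in M. \<forall>n::nat. (if N (X n \<ominus> x) \<omega> = 0 then ereal (r \<omega>) else \<infinity>) \<le> ereal (R n \<omega>)"
  show "AE \<omega> in M. (if N (y \<ominus> x) \<omega> = 0 then ereal (r \<omega>) else \<infinity>) \<le> ereal (s \<omega>)"
    using 1 2 as_conv_N[OF X x]
  proof eventually_elim
    case (elim \<omega>)
    have *: "N (X n \<ominus> x) \<omega> = 0 \<and> r \<omega> \<le> R n \<omega>" for n
      using elim(2)[rule_format, of n] by (auto split: if_splits)
    then have "N (y \<ominus> x) \<omega> = 0" using elim(3) by (simp add: LIMSEQ_const_iff)
    moreover have "r \<omega> \<le> s \<omega>" using elim(1) * by (auto intro: LIMSEQ_le_const)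
    ultimately show ?case by simp
  qed
qed (use x in auto)

section \<open>Affine lines and segment functions\<close>

lemma sm_diff_left:
  assumes [measurable]: "g \<in> borel_measurable M" "h \<in> borel_measurable M" and x: "x \<in> carrier E"
  shows "sm (\<lambda>\<omega>. g \<omega> - h \<omega>) x = sm g x \<ominus> sm h x"
proof -
  have "sm (\<lambda>\<omega>. g \<omega> + (- h \<omega>)) x = sm g x \<oplus> sm (\<lambda>\<omega>. - h \<omega>) x"
    by (rule sm_add_left) (use x in auto)
  moreover have "sm (\<lambda>\<omega>. - h \<omega>) x = \<ominus> sm h x"
    using sm_sm[of "\<lambda>_. -1" h x] sm_uminus_one[of "sm h x"] x by simp
  ultimately show ?thesis by (simp add: a_minus_def)
qed

lemma N_cv_diff:
  assumes [measurable]: "g \<in> borel_measurable M" "h \<in> borel_measurable M" and x: "x \<in> carrier E" "y \<in> carrier E"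
  shows "AE \<omega> in M. N (cv g x y \<ominus> cv h x y) \<omega> = \<bar>g \<omega> - h \<omega>\<bar> * N (x \<ominus> y) \<omega>"
proof -
  have "cv g x y \<ominus> cv h x y = sm (\<lambda>\<omega>. g \<omega> - h \<omega>) x \<oplus> sm (\<lambda>\<omega>. (1 - g \<omega>) - (1 - h \<omega>)) y"
  proof -
    have "sm g x \<ominus> sm h x = sm (\<lambda>\<omega>. g \<omega> - h \<omega>) x"
      "sm (\<lambda>\<omega>. 1 - g \<omega>) y \<ominus> sm (\<lambda>\<omega>. 1 - h \<omega>) y = sm (\<lambda>\<omega>. (1 - g \<omega>) - (1 - h \<omega>)) y"
      by (rule sm_diff_left[symmetric]; use x in simp)+
    then show ?thesis unfolding cv_def using x by (simp only: add_minus_add sm_closed[OF assms(1)]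
      sm_closed[OF assms(2)] sm_closed[of "\<lambda>\<omega>. 1 - g \<omega>"] sm_closed[of "\<lambda>\<omega>. 1 - h \<omega>"] borel_measurable_diff
      borel_measurable_const assms)
  qed
  also have "sm (\<lambda>\<omega>. (1 - g \<omega>) - (1 - h \<omega>)) y = sm (\<lambda>\<omega>. -1 * (g \<omega> - h \<omega>)) y"
    by (rule sm_cong) auto
  also have "\<dots> = \<ominus> sm (\<lambda>\<omega>. g \<omega> - h \<omega>) y"
    using sm_sm[of "\<lambda>_. -1" "\<lambda>\<omega>. g \<omega> - h \<omega>" y] sm_uminus_one[of "sm (\<lambda>\<omega>. g \<omega> - h \<omega>) y"] x by simp
  finally have "cv g x y \<ominus> cv h x y = sm (\<lambda>\<omega>. g \<omega> - h \<omega>) (x \<ominus> y)"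
    using x by (simp add: a_minus_def[symmetric] sm_minus)
  with N_sm[of "\<lambda>\<omega>. g \<omega> - h \<omega>" "x \<ominus> y"] x show ?thesis by simp
qed

text \<open>Affine combinations of two points of a line stay on it and their weights combine by the
  same rule. With weights outside the unit interval this recovers a point from an extrapolated
  one.\<close>

lemma cv_cv:
  assumes [measurable]: "g \<in> borel_measurable M" "s \<in> borel_measurable M" "t \<in> borel_measurable M"
    and x: "x \<in> carrier E" "y \<in> carrier E"
  shows "cv g (cv s x y) (cv t x y) = cv (\<lambda>\<omega>. g \<omega> * s \<omega> + (1 - g \<omega>) * t \<omega>) x y"
proof -
  have "cv g (cv s x y) (cv t x y) =
      (sm (\<lambda>\<omega>. g \<omega> * s \<omega>) x \<oplus> sm (\<lambda>\<omega>. (1 - g \<omega>) * t \<omega>) x) \<oplus>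
      (sm (\<lambda>\<omega>. g \<omega> * (1 - s \<omega>)) y \<oplus> sm (\<lambda>\<omega>. (1 - g \<omega>) * (1 - t \<omega>)) y)"
    using x by (simp add: cv_def sm_add_right sm_sm a_ac)
  also have "\<dots> = sm (\<lambda>\<omega>. g \<omega> * s \<omega> + (1 - g \<omega>) * t \<omega>) x \<oplus> sm (\<lambda>\<omega>. g \<omega> * (1 - s \<omega>) + (1 - g \<omega>) * (1 - t \<omega>)) y"
    using x by (simp add: sm_add_left)
  also have "sm (\<lambda>\<omega>. g \<omega> * (1 - s \<omega>) + (1 - g \<omega>) * (1 - t \<omega>)) y =
      sm (\<lambda>\<omega>. 1 - (g \<omega> * s \<omega> + (1 - g \<omega>) * t \<omega>)) y"
    by (rule sm_cong) (auto simp: algebra_simps)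
  finally show ?thesis by (simp add: cv_def)
qed


definition tau :: "'e \<Rightarrow> 'e \<Rightarrow> 'e \<Rightarrow> 'w \<Rightarrow> real" where
  "tau v x y = (\<lambda>\<omega>. N (v \<ominus> y) \<omega> / N (x \<ominus> y) \<omega>)"

lemma tau_meas [measurable]:
  "v \<in> carrier E \<Longrightarrow> x \<in> carrier E \<Longrightarrow> y \<in> carrier E \<Longrightarrow> tau v x y \<in> borel_measurable M"
  unfolding tau_def by (intro borel_measurable_divide N_meas) simp_all

text \<open>The weight of a point \<open>v\<close> of the random segment from \<open>y\<close> to \<open>x\<close> is recovered from norms as
  \<open>tau v x y\<close>; the segment function interpolates \<open>a\<close> at \<open>x\<close> and \<open>b\<close> at \<open>y\<close>.\<close>

definition seg_fun :: "'e \<Rightarrow> ('w \<Rightarrow> real) \<Rightarrow> 'e \<Rightarrow> ('w \<Rightarrow> real) \<Rightarrow> 'e \<Rightarrow> 'w \<Rightarrow> ereal" where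
  "seg_fun x a y b v \<omega> =
    (if N (v \<ominus> y) \<omega> \<le> N (x \<ominus> y) \<omega> \<and> N (v \<ominus> cv (tau v x y) x y) \<omega> = 0
     then ereal (tau v x y \<omega> * a \<omega> + (1 - tau v x y \<omega>) * b \<omega>) else \<infinity>)"

lemma seg_fun_meas:
  assumes x: "x \<in> carrier E" "y \<in> carrier E" "v \<in> carrier E"
    and [measurable]: "a \<in> borel_measurable M" "b \<in> borel_measurable M"
  shows "seg_fun x a y b v \<in> borel_measurable M"
proof -
  have [measurable]: "N (v \<ominus> y) \<in> borel_measurable M" "N (x \<ominus> y) \<in> borel_measurable M"
    "N (v \<ominus> cv (tau v x y) x y) \<in> borel_measurable M" "tau v x y \<in> borel_measurable M"
    using x by (auto intro!: N_meas tau_meas)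
  show ?thesis unfolding seg_fun_def by measurable
qed

text \<open>If v has weight t on the line, then N (v - y) is |t| times N (x - y). The norm recovers
  only |t|, hence the condition 0 \<le> t; dividing is safe because the endpoints are
  separated.\<close>

lemma seg_weight:
  assumes x: "x \<in> carrier E" "y \<in> carrier E" "v \<in> carrier E" and [measurable]: "t \<in> borel_measurable M"
    and pos: "AE \<omega> in M. 0 < N (x \<ominus> y) \<omega>"
  shows "AE \<omega> in M. N (v \<ominus> cv t x y) \<omega> = 0 \<longrightarrow> 0 \<le> t \<omega> \<longrightarrow>
    tau v x y \<omega> = t \<omega> \<and> N (v \<ominus> cv (tau v x y) x y) \<omega> = 0"
proof -
  have m [measurable]: "tau v x y \<in> borel_measurable M" using x by (intro tau_meas)
  have c: "cv t x y \<in> carrier E" "cv (tau v x y) x y \<in> carrier E" using x by simp_all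
  have v: "v \<ominus> cv (tau v x y) x y \<in> carrier E" using x c by simp
  show ?thesis
    using N_diff_le[OF x(3) c(1) x(2)] N_cv_minus_right[OF assms(4) x(1,2)]
      N_triangle_minus[OF x(3) c] N_cv_diff[OF assms(4) m x(1,2)] pos N_nonneg[OF v]
  proof eventually_elim
    case (elim \<omega>)
    show ?case
    proof (intro impI)
      assume 0: "N (v \<ominus> cv t x y) \<omega> = 0" and t: "0 \<le> t \<omega>"
      have "N (v \<ominus> y) \<omega> = t \<omega> * N (x \<ominus> y) \<omega>" using elim 0 t by simp
      then have "tau v x y \<omega> = t \<omega>" using elim by (simp add: tau_def)
      then show "tau v x y \<omega> = t \<omega> \<and> N (v \<ominus> cv (tau v x y) x y) \<omega> = 0" using elim 0 by simp
    qed
  qed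
qed

text \<open>On the segment the function is affine in the weight, so convexity holds there with
  equality; off the segment it is infinite. For closedness, the weight is continuous in v, being a
  quotient of norms with a fixed positive denominator.\<close>

lemma seg_Cvx:
  assumes x: "x \<in> carrier E" "y \<in> carrier E"
    and [measurable]: "a \<in> borel_measurable M" "b \<in> borel_measurable M"
    and pos: "AE \<omega> in M. 0 < N (x \<ominus> y) \<omega>"
  shows "fn (seg_fun x a y b) \<in> Cvx M E"
proof (rule fn_CvxI[where d = y])
  show "seg_fun x a y b v \<in> borel_measurable M" if "v \<in> carrier E" for v
    using x that by (intro seg_fun_meas) auto
  show "AE \<omega> in M. - \<infinity> < seg_fun x a y b v \<omega>" for v by (simp add: seg_fun_def)
  show "y \<in> carrier E" by (rule x)
  have "cv (\<lambda>_. 0) x y = y"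
    using x by (simp add: cv_def sm_zero sm_one)
  then show "AE \<omega> in M. seg_fun x a y b y \<omega> < \<infinity>"
    using seg_weight[OF x x(2) _ pos, of "\<lambda>_. 0"] N_minus_self[OF x(2)] pos
    by (auto simp: seg_fun_def elim!: AE_mp)
next
  fix u v and g :: "'w \<Rightarrow> real" assume c: "u \<in> carrier E" "v \<in> carrier E"
    and gm [measurable]: "g \<in> borel_measurable M"
    and g: "AE \<omega> in M. 0 \<le> g \<omega>" "AE \<omega> in M. g \<omega> \<le> 1"
  have [measurable]: "tau u x y \<in> borel_measurable M" "tau v x y \<in> borel_measurable M"
    using x c by (auto intro: tau_meas)
  \<comment> \<open>The weight that the combination must have if both u and v lie on the segment, by
    \<open>cv_cv\<close>.\<close>
  define s where "s = (\<lambda>\<omega>. g \<omega> * tau u x y \<omega> + (1 - g \<omega>) * tau v x y \<omega>)"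
  have sm [measurable]: "s \<in> borel_measurable M" unfolding s_def by measurable
  let ?w = "cv g u v" and ?u = "cv (tau u x y) x y" and ?v = "cv (tau v x y) x y"
  have cc: "?w \<in> carrier E" "?u \<in> carrier E" "?v \<in> carrier E" using c x by simp_all
  have cs: "cv s x y \<in> carrier E" using x by simp
  have "cv g ?u ?v = cv s x y" unfolding s_def by (rule cv_cv) (use x in auto)
  then have "?w \<ominus> cv s x y = cv g (u \<ominus> ?u) (v \<ominus> ?v)"
    using cv_minus_cv[OF gm c cc(2,3)] by simp
  then have le: "AE \<omega> in M. N (?w \<ominus> cv s x y) \<omega> \<le> \<bar>g \<omega>\<bar> * N (u \<ominus> ?u) \<omega> + \<bar>1 - g \<omega>\<bar> * N (v \<ominus> ?v) \<omega>"
    using N_cv_le[OF gm, of "u \<ominus> ?u" "v \<ominus> ?v"] c cc by simp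
  have n: "AE \<omega> in M. 0 \<le> N (u \<ominus> y) \<omega>" "AE \<omega> in M. 0 \<le> N (v \<ominus> y) \<omega>" "AE \<omega> in M. 0 \<le> N (?w \<ominus> cv s x y) \<omega>"
    using x c cs cc by (auto intro!: N_nonneg)
  show "AE \<omega> in M. seg_fun x a y b ?w \<omega> \<le> ereal (g \<omega>) * seg_fun x a y b u \<omega> + ereal (1 - g \<omega>) * seg_fun x a y b v \<omega>"
    using le seg_weight[OF x cc(1) sm pos] g n pos
  proof eventually_elim
    case (elim \<omega>)
    let ?ok = "\<lambda>v. N (v \<ominus> y) \<omega> \<le> N (x \<ominus> y) \<omega> \<and> N (v \<ominus> cv (tau v x y) x y) \<omega> = 0"
    let ?val = "\<lambda>v. tau v x y \<omega> * a \<omega> + (1 - tau v x y \<omega>) * b \<omega>"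
    have t0: "0 \<le> tau u x y \<omega>" "0 \<le> tau v x y \<omega>" using elim by (simp_all add: tau_def)
    have t1: "?ok v \<Longrightarrow> tau v x y \<omega> \<le> 1" for v using elim by (simp add: tau_def)
    \<comment> \<open>A point of weight zero in the combination is exempt: its value may be infinite
      without affecting the sum. Otherwise a point off the segment makes the right side
      infinite.\<close>
    show ?case
    proof (cases "(g \<omega> = 0 \<or> ?ok u) \<and> (g \<omega> = 1 \<or> ?ok v)")
      case True
      then have "N (?w \<ominus> cv s x y) \<omega> = 0" using elim by auto
      moreover have s0: "0 \<le> s \<omega>" using t0 elim by (simp add: s_def)
      ultimately have w: "tau ?w x y \<omega> = s \<omega>" "N (?w \<ominus> cv (tau ?w x y) x y) \<omega> = 0" using elim by auto
      have "g \<omega> * tau u x y \<omega> \<le> g \<omega>" "(1 - g \<omega>) * tau v x y \<omega> \<le> 1 - g \<omega>"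
        using True t1[of u] t1[of v] elim by (auto simp: mult_left_le)
      then have "s \<omega> \<le> 1" by (simp add: s_def)
      then have "N (?w \<ominus> y) \<omega> \<le> N (x \<ominus> y) \<omega>" using w(1) elim by (simp add: tau_def field_simps)
      then have 1: "seg_fun x a y b ?w \<omega> = ereal (s \<omega> * a \<omega> + (1 - s \<omega>) * b \<omega>)"
        using w by (simp add: seg_fun_def)
      have 2: "ereal (g \<omega>) * seg_fun x a y b u \<omega> = ereal (g \<omega> * ?val u)"
        using True by (auto simp: seg_fun_def zero_ereal_def[symmetric])
      have 3: "ereal (1 - g \<omega>) * seg_fun x a y b v \<omega> = ereal ((1 - g \<omega>) * ?val v)"
        using True by (auto simp: seg_fun_def zero_ereal_def[symmetric])
      show ?thesis unfolding 1 2 3 by (simp add: s_def algebra_simps)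
    next
      case False
      then have *: "ereal (g \<omega>) * seg_fun x a y b u \<omega> + ereal (1 - g \<omega>) * seg_fun x a y b v \<omega> = \<infinity>"
        using elim by (auto simp: seg_fun_def)
      show ?thesis unfolding * by (rule ereal_less_eq)
    qed
  qed
next
  fix X v and R :: "nat \<Rightarrow> 'w \<Rightarrow> real" and r assume X: "as_conv X v"
    and lim: "AE \<omega> in M. (\<lambda>n. R n \<omega>) \<longlonglongrightarrow> r \<omega>" and le: "AE \<omega> in M. \<forall>n. seg_fun x a y b (X n) \<omega> \<le> ereal (R n \<omega>)"
  have c: "X n \<in> carrier E" "v \<in> carrier E" for n using X by (auto simp: as_conv_def)
  let ?t = "\<lambda>v. tau v x y" and ?c = "\<lambda>v. cv (tau v x y) x y"
  have tm: "?t (X n) \<in> borel_measurable M" "?t v \<in> borel_measurable M" for n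
    using c x by (auto intro: tau_meas)
  have cc: "?c (X n) \<in> carrier E" "?c v \<in> carrier E" for n using tm x by simp_all
  have "AE \<omega> in M. \<forall>n. N (v \<ominus> ?c v) \<omega> \<le> N (v \<ominus> X n) \<omega> + N (X n \<ominus> ?c v) \<omega>"
    by (intro AE_allI N_triangle_minus c cc)
  moreover have "AE \<omega> in M. \<forall>n. N (X n \<ominus> ?c v) \<omega> \<le> N (X n \<ominus> ?c (X n)) \<omega> + N (?c (X n) \<ominus> ?c v) \<omega>"
    by (intro AE_allI N_triangle_minus c cc)
  moreover have "AE \<omega> in M. \<forall>n. N (v \<ominus> X n) \<omega> = N (X n \<ominus> v) \<omega>"
    by (intro AE_allI N_minus_commute c cc)
  moreover have "AE \<omega> in M. \<forall>n. N (?c (X n) \<ominus> ?c v) \<omega> = \<bar>?t (X n) \<omega> - ?t v \<omega>\<bar> * N (x \<ominus> y) \<omega>"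
    by (intro AE_allI N_cv_diff tm x)
  moreover have "AE \<omega> in M. (\<lambda>n. N (X n \<ominus> v) \<omega>) \<longlonglongrightarrow> 0" using X by (simp add: as_conv_def)
  moreover have "AE \<omega> in M. 0 \<le> N (v \<ominus> ?c v) \<omega>" using c cc by (intro N_nonneg) simp
  ultimately show "AE \<omega> in M. seg_fun x a y b v \<omega> \<le> ereal (r \<omega>)"
    using as_conv_N[OF X x(2)] lim le pos
  proof eventually_elim
    case (elim \<omega>)
    have ok: "N (X n \<ominus> y) \<omega> \<le> N (x \<ominus> y) \<omega>" "N (X n \<ominus> ?c (X n)) \<omega> = 0"
      "?t (X n) \<omega> * a \<omega> + (1 - ?t (X n) \<omega>) * b \<omega> \<le> R n \<omega>" for n
      using elim(9)[rule_format, of n] by (auto simp: seg_fun_def split: if_splits)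
    have tl: "(\<lambda>n. ?t (X n) \<omega>) \<longlonglongrightarrow> ?t v \<omega>"
      unfolding tau_def by (intro tendsto_divide elim(7) tendsto_const) (use elim in simp)
    have "N (v \<ominus> y) \<omega> \<le> N (x \<ominus> y) \<omega>"
      by (rule LIMSEQ_le_const2[OF elim(7)]) (use ok in auto)
    moreover have "N (v \<ominus> ?c v) \<omega> = 0"
    proof -
      \<comment> \<open>The term bounds the distance of v from the line point of its own weight: go
        from v to \<open>X n\<close>, which lies on the line, and along the line by the difference
        of the weights.\<close>
      have "(\<lambda>n. N (X n \<ominus> v) \<omega> + \<bar>?t (X n) \<omega> - ?t v \<omega>\<bar> * N (x \<ominus> y) \<omega>) \<longlonglongrightarrow> 0 + \<bar>?t v \<omega> - ?t v \<omega>\<bar> * N (x \<ominus> y) \<omega>"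
        by (intro tendsto_intros tl elim(5))
      moreover have "N (v \<ominus> ?c v) \<omega> \<le> N (X n \<ominus> v) \<omega> + \<bar>?t (X n) \<omega> - ?t v \<omega>\<bar> * N (x \<ominus> y) \<omega>" for n
        using elim(1)[rule_format, of n] elim(2)[rule_format, of n] elim(3)[rule_format, of n]
          elim(4)[rule_format, of n] ok(2)[of n] by linarith
      ultimately have "N (v \<ominus> ?c v) \<omega> \<le> 0" by (auto intro: LIMSEQ_le_const)
      then show ?thesis using elim by simp
    qed
    moreover have "?t v \<omega> * a \<omega> + (1 - ?t v \<omega>) * b \<omega> \<le> r \<omega>"
    proof (rule LIMSEQ_le[OF _ elim(8)])
      show "(\<lambda>n. ?t (X n) \<omega> * a \<omega> + (1 - ?t (X n) \<omega>) * b \<omega>) \<longlonglongrightarrow> ?t v \<omega> * a \<omega> + (1 - ?t v \<omega>) * b \<omega>"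
        by (intro tendsto_intros tl)
    qed (use ok(3) in blast)
    ultimately show ?case by (simp add: seg_fun_def)
  qed
qed

lemma seg_endpoints:
  assumes x: "x \<in> carrier E" "y \<in> carrier E"
    and [measurable]: "a \<in> borel_measurable M" "b \<in> borel_measurable M"
    and pos: "AE \<omega> in M. 0 < N (x \<ominus> y) \<omega>"
  shows "AE \<omega> in M. rp (fn (seg_fun x a y b) x) \<omega> = ereal (a \<omega>)"
    and "AE \<omega> in M. rp (fn (seg_fun x a y b) y) \<omega> = ereal (b \<omega>)"
proof -
  have 1: "cv (\<lambda>_. 0) x y = y" "cv (\<lambda>_. 1) x y = x"
    using x by (simp_all add: cv_def sm_zero sm_one)
  have m: "seg_fun x a y b x \<in> borel_measurable M" "seg_fun x a y b y \<in> borel_measurable M"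
    using x by (auto intro!: seg_fun_meas)
  show "AE \<omega> in M. rp (fn (seg_fun x a y b) x) \<omega> = ereal (a \<omega>)"
    using fn_rp[of x "seg_fun x a y b", OF x(1) m(1)] seg_weight[OF x x(1) _ pos, of "\<lambda>_. 1"] N_minus_self[OF x(1)]
    unfolding 1 by (auto simp: seg_fun_def elim!: AE_mp)
  show "AE \<omega> in M. rp (fn (seg_fun x a y b) y) \<omega> = ereal (b \<omega>)"
    using fn_rp[of y "seg_fun x a y b", OF x(2) m(2)] seg_weight[OF x x(2) _ pos, of "\<lambda>_. 0"] N_minus_self[OF x(2)] pos
    unfolding 1 by (auto simp: seg_fun_def elim!: AE_mp)
qed


section \<open>Order characterisation of point functions\<close>

lemma fun_le_iff:
  assumes "f \<in> Cvx M E" "g \<in> Cvx M E"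
  shows "fun_le M E f g \<longleftrightarrow> (\<forall>x\<in>carrier E. AE \<omega> in M. rp (f x) \<omega> \<le> rp (g x) \<omega>)"
  using assms by (auto simp: fun_le_def L0bar_def rv_le_iff Cvx_rv)

text \<open>This expresses membership of (x, r) in the epigraph of f purely through the order. Where
  y disagrees with x the point function is infinite; where it agrees, \<open>Cvx_local\<close>
  reduces y to x.\<close>

lemma fun_le_pt_iff:
  assumes f: "f \<in> Cvx M E" and x: "x \<in> carrier E" and r: "r \<in> borel_measurable M"
  shows "fun_le M E f (pt x r) \<longleftrightarrow> (AE \<omega> in M. rp (f x) \<omega> \<le> ereal (r \<omega>))"
  unfolding fun_le_iff[OF f pt_Cvx[OF x r]]
proof (intro iffI ballI)
  assume "\<forall>y\<in>carrier E. AE \<omega> in M. rp (f y) \<omega> \<le> rp (pt x r y) \<omega>"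
  then have "AE \<omega> in M. rp (f x) \<omega> \<le> rp (pt x r x) \<omega>" using x by blast
  then show "AE \<omega> in M. rp (f x) \<omega> \<le> ereal (r \<omega>)"
    using pt_rp[OF x x r] N_minus_self[OF x] by eventually_elim simp
next
  fix y assume le: "AE \<omega> in M. rp (f x) \<omega> \<le> ereal (r \<omega>)" and y: "y \<in> carrier E"
  show "AE \<omega> in M. rp (f y) \<omega> \<le> rp (pt x r y) \<omega>"
    using pt_rp[OF x y r] Cvx_local[OF f y x] le by eventually_elim simp
qed

lemma pt_cong:
  assumes "r \<in> borel_measurable M" "s \<in> borel_measurable M" "AE \<omega> in M. r \<omega> = s \<omega>" and x: "x \<in> carrier E"
  shows "pt x r = pt x s"
proof (rule Cvx_eqI)
  fix y assume y: "y \<in> carrier E"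
  show "AE \<omega> in M. rp (pt x r y) \<omega> = rp (pt x s y) \<omega>"
    using pt_rp[OF x y assms(1)] pt_rp[OF x y assms(2)] assms(3) by eventually_elim simp
qed (use pt_Cvx assms in auto)

lemma fun_le_pt_pt:
  assumes x: "x \<in> carrier E" "y \<in> carrier E" and r: "r \<in> borel_measurable M" "s \<in> borel_measurable M"
  shows "fun_le M E (pt x r) (pt y s) \<longleftrightarrow> x = y \<and> (AE \<omega> in M. r \<omega> \<le> s \<omega>)"
proof -
  have "fun_le M E (pt x r) (pt y s) \<longleftrightarrow> (AE \<omega> in M. rp (pt x r y) \<omega> \<le> ereal (s \<omega>))"
    by (intro fun_le_pt_iff pt_Cvx x r)
  also have "\<dots> \<longleftrightarrow> (AE \<omega> in M. N (y \<ominus> x) \<omega> = 0 \<and> r \<omega> \<le> s \<omega>)"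
    (is "?l \<longleftrightarrow> ?r")
  proof
    show ?r if ?l using that pt_rp[OF x r(1)] by eventually_elim (auto split: if_splits)
    show ?l if ?r using that pt_rp[OF x r(1)] by eventually_elim auto
  qed
  also have "\<dots> \<longleftrightarrow> (AE \<omega> in M. N (y \<ominus> x) \<omega> = 0) \<and> (AE \<omega> in M. r \<omega> \<le> s \<omega>)"
    by (rule AE_conj_iff)
  also have "(AE \<omega> in M. N (y \<ominus> x) \<omega> = 0) \<longleftrightarrow> x = y"
    using eq_iff_N[OF x(2,1)] by blast
  finally show ?thesis .
qed

lemma fun_le_refl: "f \<in> Cvx M E \<Longrightarrow> fun_le M E f f"
  by (simp add: fun_le_iff)

lemma pt_inject:
  assumes x: "x \<in> carrier E" "y \<in> carrier E" and r: "r \<in> borel_measurable M" "s \<in> borel_measurable M"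
    and eq: "pt x r = pt y s"
  shows "x = y" "AE \<omega> in M. r \<omega> = s \<omega>"
proof -
  have "fun_le M E (pt x r) (pt y s)" "fun_le M E (pt y s) (pt x r)"
    using fun_le_refl[OF pt_Cvx[OF x(1) r(1)]] by (simp_all add: eq)
  then have "x = y \<and> (AE \<omega> in M. r \<omega> \<le> s \<omega>)" "(AE \<omega> in M. s \<omega> \<le> r \<omega>)"
    using x r by (simp_all add: fun_le_pt_pt)
  then show "x = y" "AE \<omega> in M. r \<omega> = s \<omega>" by auto
qed

lemma paste_pt:
  assumes x: "x \<in> carrier E" "y \<in> carrier E" and r [measurable]: "r \<in> borel_measurable M" "s \<in> borel_measurable M"
    and A [measurable]: "A \<in> events"
  shows "paste M E A (pt x r) (pt y s) = pt (cmb A x y) (\<lambda>\<omega>. if \<omega> \<in> A then r \<omega> else s \<omega>)"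
proof (rule Cvx_eqI)
  have [measurable]: "indicat_real A \<in> borel_measurable M" by simp
  have c: "cmb A x y \<in> carrier E" using x by simp
  have m: "(\<lambda>\<omega>. if \<omega> \<in> A then r \<omega> else s \<omega>) \<in> borel_measurable M" by measurable
  note pc = pt_Cvx[OF x(1) r(1)] pt_Cvx[OF x(2) r(2)]
  show "paste M E A (pt x r) (pt y s) \<in> Cvx M E" by (intro paste_Cvx pc A)
  show "pt (cmb A x y) (\<lambda>\<omega>. if \<omega> \<in> A then r \<omega> else s \<omega>) \<in> Cvx M E" by (intro pt_Cvx c m)
  fix z assume z: "z \<in> carrier E"
  show "AE \<omega> in M. rp (paste M E A (pt x r) (pt y s) z) \<omega> =
      rp (pt (cmb A x y) (\<lambda>\<omega>. if \<omega> \<in> A then r \<omega> else s \<omega>) z) \<omega>"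
    using paste_rp(2)[OF pc A z] pt_rp[OF x(1) z r(1)] pt_rp[OF x(2) z r(2)] pt_rp[OF c z m]
      N_cmb_minus[OF A x z] N_minus_commute[OF c z] N_minus_commute[OF x(1) z] N_minus_commute[OF x(2) z]
    by eventually_elim simp
qed

text \<open>Two functions above a point function may be ordered one way on an event and the other
  way off it, so comparability is too much to ask. The condition says that one event splits the
  space into the two cases, using only \<open>fun_le\<close> and \<open>paste\<close>, which T
  respects.\<close>

definition random_chain_above :: "('e \<Rightarrow> ('w \<Rightarrow> ereal) set) \<Rightarrow> bool" where
  "random_chain_above f \<longleftrightarrow> (\<forall>g\<in>Cvx M E. \<forall>h\<in>Cvx M E. fun_le M E f g \<longrightarrow> fun_le M E f h \<longrightarrow>
    (\<exists>A\<in>events. fun_le M E (paste M E A g h) g \<and> fun_le M E (paste M E A g h) h))"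

text \<open>Anything above \<open>pt x r\<close> is infinite where its argument differs from x, so
  it is determined by its value at x; the event is where g is the smaller one at x.\<close>

lemma random_chain_above_pt:
  assumes x: "x \<in> carrier E" and r: "r \<in> borel_measurable M"
  shows "random_chain_above (pt x r)"
  unfolding random_chain_above_def
proof (intro ballI impI)
  fix g h assume g: "g \<in> Cvx M E" and h: "h \<in> Cvx M E"
    and le: "fun_le M E (pt x r) g" "fun_le M E (pt x r) h"
  have [measurable]: "rp (g x) \<in> borel_measurable M" "rp (h x) \<in> borel_measurable M"
    using Cvx_meas x g h by auto
  define A where "A = {\<omega> \<in> space M. rp (g x) \<omega> \<le> rp (h x) \<omega>}"
  have A: "A \<in> events" unfolding A_def by measurable
  note p = paste_Cvx[OF g h A]
  have "AE \<omega> in M. rp (paste M E A g h y) \<omega> \<le> rp (g y) \<omega> \<and> rp (paste M E A g h y) \<omega> \<le> rp (h y) \<omega>"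
    if y: "y \<in> carrier E" for y
  proof -
    have l: "AE \<omega> in M. rp (pt x r y) \<omega> \<le> rp (g y) \<omega>" "AE \<omega> in M. rp (pt x r y) \<omega> \<le> rp (h y) \<omega>"
      using le y fun_le_iff pt_Cvx[OF x r] g h by blast+
    show ?thesis
      using l pt_rp[OF x y r] Cvx_local[OF g y x] Cvx_local[OF h y x] paste_rp(2)[OF g h A y] AE_space
      by eventually_elim (auto simp: A_def split: if_splits)
  qed
  then have "fun_le M E (paste M E A g h) g" "fun_le M E (paste M E A g h) h"
    by (simp_all add: fun_le_iff p g h)
  then show "\<exists>A\<in>events. fun_le M E (paste M E A g h) g \<and> fun_le M E (paste M E A g h) h"
    using A by blast
qed

text \<open>If f were finite at two points that differ on an event of positive probability, the two
  point functions lying above f there could not be split by any event.\<close>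

lemma random_chain_above_imp_pt:
  assumes f: "f \<in> Cvx M E" and chain: "random_chain_above f"
  obtains x r where "x \<in> carrier E" "r \<in> borel_measurable M" "f = pt x r"
proof -
  obtain x where x: "x \<in> carrier E" and fx: "AE \<omega> in M. rp (f x) \<omega> < \<infinity>" by (rule Cvx_dom[OF f])
  define r where "r = (\<lambda>\<omega>. real_of_ereal (rp (f x) \<omega>))"
  have r [measurable]: "r \<in> borel_measurable M" unfolding r_def using Cvx_meas[OF f x] by measurable
  have fr: "AE \<omega> in M. rp (f x) \<omega> = ereal (r \<omega>)"
    using fx Cvx_gt_MInfty[OF f x] by eventually_elim (auto simp: r_def ereal_real)
  have "AE \<omega> in M. rp (f y) \<omega> = rp (pt x r y) \<omega>" if y: "y \<in> carrier E" for y
  proof -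
    have [measurable]: "rp (f y) \<in> borel_measurable M" by (rule Cvx_meas[OF f y])
    define B where "B = {\<omega> \<in> space M. rp (f y) \<omega> < \<infinity>}"
    have B: "B \<in> events" unfolding B_def by measurable
    have [measurable]: "indicat_real B \<in> borel_measurable M" using B by simp
    \<comment> \<open>f y need not be finite everywhere. Replacing y by x where it is infinite gives
      a point with finite value, which still equals y wherever f y matters.\<close>
    define z where "z = cmb B y x"
    have z: "z \<in> carrier E" using x y by (simp add: z_def)
    have zN: "AE \<omega> in M. N (z \<ominus> y) \<omega> = (if \<omega> \<in> B then N (y \<ominus> y) \<omega> else N (x \<ominus> y) \<omega>)"
      "AE \<omega> in M. N (z \<ominus> x) \<omega> = (if \<omega> \<in> B then N (y \<ominus> x) \<omega> else N (x \<ominus> x) \<omega>)"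
      unfolding z_def by (intro N_cmb_minus B x y)+
    define s where "s = (\<lambda>\<omega>. real_of_ereal (rp (f z) \<omega>))"
    have s [measurable]: "s \<in> borel_measurable M" unfolding s_def using Cvx_meas[OF f z] by measurable
    have fs: "AE \<omega> in M. rp (f z) \<omega> = ereal (s \<omega>)"
      using fx Cvx_gt_MInfty[OF f z] zN Cvx_local[OF f z x] Cvx_local[OF f z y] N_minus_self[OF x]
        N_minus_self[OF y] AE_space
      by eventually_elim (auto simp: s_def ereal_real B_def split: if_splits)
    have "fun_le M E f (pt x r)" "fun_le M E f (pt z s)"
      using fr fs by (auto simp: fun_le_pt_iff f x z elim!: AE_mp)
    then obtain A where A: "A \<in> events" and le: "fun_le M E (paste M E A (pt x r) (pt z s)) (pt x r)"
      "fun_le M E (paste M E A (pt x r) (pt z s)) (pt z s)"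
      using chain pt_Cvx[OF x r] pt_Cvx[OF z s] unfolding random_chain_above_def by blast
    note p = pt_Cvx[OF x r] pt_Cvx[OF z s]
    note pp = paste_Cvx[OF p A]
    have 1: "AE \<omega> in M. rp (paste M E A (pt x r) (pt z s) x) \<omega> \<le> ereal (r \<omega>)"
      "AE \<omega> in M. rp (paste M E A (pt x r) (pt z s) z) \<omega> \<le> ereal (s \<omega>)"
      using le by (simp_all add: fun_le_pt_iff pp x z)
    \<comment> \<open>On A the pasted function is \<open>pt x r\<close> and must be finite at z; off
      A it is \<open>pt z s\<close> and must be finite at x. Either way x and z agree.\<close>
    have "AE \<omega> in M. N (z \<ominus> x) \<omega> = 0"
      using 1 paste_rp(2)[OF p A x] paste_rp(2)[OF p A z] pt_rp[OF x z r] pt_rp[OF z x s]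
        N_minus_commute[OF x z]
      by eventually_elim (auto split: if_splits)
    then show ?thesis
      using zN(2) Cvx_local[OF f y x] fr pt_rp[OF x y r] AE_space
    proof eventually_elim
      case (elim \<omega>)
      show ?case
      proof (cases "N (y \<ominus> x) \<omega> = 0")
        case False
        then have "\<omega> \<notin> B" using elim by auto
        then show ?thesis using False elim by (simp add: B_def)
      qed (use elim in simp)
    qed
  qed
  then have "f = pt x r" by (intro Cvx_eqI f pt_Cvx x r)
  with x r that show ?thesis by blast
qed

end

section \<open>The action of an involution on points\<close>

text \<open>The last assumption is what full support and completeness provide, see
  \<open>full_support_nonvanishing\<close>. It is used to move a point away from another on the
  whole sample space at once.\<close>

locale stable_involution = rn_module +
  fixes T :: "('b \<Rightarrow> ('a \<Rightarrow> ereal) set) \<Rightarrow> 'b \<Rightarrow> ('a \<Rightarrow> ereal) set"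
  assumes T_Cvx: "f \<in> Cvx M E \<Longrightarrow> T f \<in> Cvx M E"
    and T_paste: "A \<in> events \<Longrightarrow> f \<in> Cvx M E \<Longrightarrow> g \<in> Cvx M E \<Longrightarrow>
      T (paste M E A f g) = paste M E A (T f) (T g)"
    and T_mono: "f \<in> Cvx M E \<Longrightarrow> g \<in> Cvx M E \<Longrightarrow> fun_le M E f g \<Longrightarrow> fun_le M E (T f) (T g)"
    and T_T: "f \<in> Cvx M E \<Longrightarrow> T (T f) = f"
    and ex_nonvanishing: "\<exists>e\<in>carrier E. AE \<omega> in M. 0 < N e \<omega>"
begin

text \<open>Functions above T f are images of functions above f, since T is its own inverse, and T
  carries a splitting event along because it commutes with pasting.\<close>

lemma random_chain_above_T:
  assumes f: "f \<in> Cvx M E" and chain: "random_chain_above f"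
  shows "random_chain_above (T f)"
  unfolding random_chain_above_def
proof (intro ballI impI)
  fix g h assume g: "g \<in> Cvx M E" and h: "h \<in> Cvx M E" and le: "fun_le M E (T f) g" "fun_le M E (T f) h"
  have "fun_le M E f (T g)" "fun_le M E f (T h)"
    using T_mono[OF T_Cvx[OF f] g le(1)] T_mono[OF T_Cvx[OF f] h le(2)] by (simp_all add: T_T f)
  then obtain A where A: "A \<in> events"
    and p: "fun_le M E (paste M E A (T g) (T h)) (T g)" "fun_le M E (paste M E A (T g) (T h)) (T h)"
    using chain T_Cvx[OF g] T_Cvx[OF h] unfolding random_chain_above_def by blast
  have "T (paste M E A (T g) (T h)) = paste M E A g h"
    by (simp add: T_paste A T_Cvx g h T_T)
  with T_mono[OF _ _ p(1)] T_mono[OF _ _ p(2)]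
  have "fun_le M E (paste M E A g h) g" "fun_le M E (paste M E A g h) h"
    by (simp_all add: paste_Cvx A T_Cvx g h T_T)
  with A show "\<exists>A\<in>events. fun_le M E (paste M E A g h) g \<and> fun_le M E (paste M E A g h) h" by blast
qed

lemma T_pt_ex:
  assumes x: "x \<in> carrier E" and r: "r \<in> borel_measurable M"
  obtains y s where "y \<in> carrier E" "s \<in> borel_measurable M" "T (pt x r) = pt y s"
  by (rule random_chain_above_imp_pt[OF T_Cvx[OF pt_Cvx[OF x r]]
        random_chain_above_T[OF pt_Cvx[OF x r] random_chain_above_pt[OF x r]]]) (rule that)

text \<open>The point function with the larger value max r s lies above both, so its image lies
  above both images, and comparable point functions sit at the same point.\<close>

lemma T_pt_same_point:
  assumes x: "x \<in> carrier E" and r [measurable]: "r \<in> borel_measurable M" "s \<in> borel_measurable M"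
    and y: "y \<in> carrier E" "z \<in> carrier E" and ab: "a \<in> borel_measurable M" "b \<in> borel_measurable M"
    and eq: "T (pt x r) = pt y a" "T (pt x s) = pt z b"
  shows "y = z"
proof -
  let ?m = "\<lambda>\<omega>. max (r \<omega>) (s \<omega>)"
  have m: "?m \<in> borel_measurable M" by measurable
  obtain w c where w: "w \<in> carrier E" "c \<in> borel_measurable M" "T (pt x ?m) = pt w c"
    by (rule T_pt_ex[OF x m])
  have "fun_le M E (T (pt x r)) (T (pt x ?m))" "fun_le M E (T (pt x s)) (T (pt x ?m))"
    by (intro T_mono pt_Cvx x m r; use x m r in \<open>simp add: fun_le_pt_pt\<close>)+
  then show ?thesis
    unfolding eq w(3) using y w ab by (simp add: fun_le_pt_pt)
qed

definition \<phi> :: "'b \<Rightarrow> 'b" where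
  "\<phi> x = (SOME y. y \<in> carrier E \<and> (\<exists>s\<in>borel_measurable M. T (pt x (\<lambda>_. 0)) = pt y s))"

text \<open>This acts on a whole random variable and depends on the choice of a representative of
  the result. That its value at \<open>\<omega>\<close> depends only on what r and x are at
  \<open>\<omega>\<close> is proved later, in \<open>\<psi>_local\<close>.\<close>

definition \<psi> :: "'b \<Rightarrow> ('a \<Rightarrow> real) \<Rightarrow> 'a \<Rightarrow> real" where
  "\<psi> x r = (SOME s. s \<in> borel_measurable M \<and> T (pt x r) = pt (\<phi> x) s)"

lemma \<phi>_closed_aux:
  assumes x: "x \<in> carrier E"
  shows "\<phi> x \<in> carrier E \<and> (\<exists>s\<in>borel_measurable M. T (pt x (\<lambda>_. 0)) = pt (\<phi> x) s)"
proof -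
  have "(\<lambda>_. 0::real) \<in> borel_measurable M" by simp
  from T_pt_ex[OF x this] show ?thesis
    unfolding \<phi>_def by (intro someI_ex[of "\<lambda>y. y \<in> carrier E \<and> (\<exists>s\<in>borel_measurable M. T (pt x (\<lambda>_. 0)) = pt y s)"]) metis
qed

lemma \<phi>_closed [simp, intro]: "x \<in> carrier E \<Longrightarrow> \<phi> x \<in> carrier E"
  using \<phi>_closed_aux by blast

lemma \<psi>_aux:
  assumes x: "x \<in> carrier E" and r: "r \<in> borel_measurable M"
  shows "\<psi> x r \<in> borel_measurable M \<and> T (pt x r) = pt (\<phi> x) (\<psi> x r)"
proof -
  obtain y s where y: "y \<in> carrier E" "s \<in> borel_measurable M" "T (pt x r) = pt y s"
    by (rule T_pt_ex[OF x r])
  obtain a where a: "a \<in> borel_measurable M" "T (pt x (\<lambda>_. 0)) = pt (\<phi> x) a"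
    using \<phi>_closed_aux[OF x] by blast
  have "y = \<phi> x"
    by (rule T_pt_same_point[OF x r _ y(1) \<phi>_closed[OF x] y(2) a(1) y(3) a(2)]) simp
  then have "\<exists>s. s \<in> borel_measurable M \<and> T (pt x r) = pt (\<phi> x) s" using y by blast
  then show ?thesis unfolding \<psi>_def by (rule someI_ex)
qed

lemma \<psi>_meas [measurable]: "x \<in> carrier E \<Longrightarrow> r \<in> borel_measurable M \<Longrightarrow> \<psi> x r \<in> borel_measurable M"
  and T_pt: "x \<in> carrier E \<Longrightarrow> r \<in> borel_measurable M \<Longrightarrow> T (pt x r) = pt (\<phi> x) (\<psi> x r)"
  using \<psi>_aux by blast+

lemma T_le_pt_iff:
  assumes f: "f \<in> Cvx M E" and x: "x \<in> carrier E" and r: "r \<in> borel_measurable M"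
  shows "(AE \<omega> in M. rp (T f (\<phi> x)) \<omega> \<le> ereal (\<psi> x r \<omega>)) \<longleftrightarrow> (AE \<omega> in M. rp (f x) \<omega> \<le> ereal (r \<omega>))"
proof -
  have "fun_le M E (T f) (T (pt x r)) \<longleftrightarrow> fun_le M E f (pt x r)"
    using T_mono[OF f pt_Cvx[OF x r]] T_mono[OF T_Cvx[OF f] T_Cvx[OF pt_Cvx[OF x r]]]
    by (auto simp: T_T f pt_Cvx[OF x r])
  then show ?thesis
    by (simp add: T_pt x r fun_le_pt_iff f T_Cvx \<psi>_meas)
qed

lemma \<psi>_mono:
  assumes x: "x \<in> carrier E" and r: "r \<in> borel_measurable M" "s \<in> borel_measurable M"
    and le: "AE \<omega> in M. r \<omega> \<le> s \<omega>"
  shows "AE \<omega> in M. \<psi> x r \<omega> \<le> \<psi> x s \<omega>"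
  using T_mono[OF pt_Cvx[OF x r(1)] pt_Cvx[OF x r(2)]] le
  by (simp add: T_pt x r fun_le_pt_pt \<psi>_meas)

lemma \<phi>\<psi>_inv:
  assumes x: "x \<in> carrier E" and r: "r \<in> borel_measurable M"
  shows "\<phi> (\<phi> x) = x" and "AE \<omega> in M. \<psi> (\<phi> x) (\<psi> x r) \<omega> = r \<omega>"
proof -
  have "pt (\<phi> (\<phi> x)) (\<psi> (\<phi> x) (\<psi> x r)) = pt x r"
    using T_T[OF pt_Cvx[OF x r]] by (simp add: T_pt x r \<psi>_meas)
  from pt_inject[OF _ _ _ _ this] show "\<phi> (\<phi> x) = x" "AE \<omega> in M. \<psi> (\<phi> x) (\<psi> x r) \<omega> = r \<omega>"
    using x r by (simp_all add: \<psi>_meas)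
qed

lemma \<phi>_\<phi>: "x \<in> carrier E \<Longrightarrow> \<phi> (\<phi> x) = x"
  by (rule \<phi>\<psi>_inv(1)[of x "\<lambda>_. 0"]) simp_all

lemma \<psi>_cong:
  assumes "r \<in> borel_measurable M" "s \<in> borel_measurable M" "AE \<omega> in M. r \<omega> = s \<omega>" "x \<in> carrier E"
  shows "\<psi> x r = \<psi> x s"
  unfolding \<psi>_def pt_cong[OF assms] ..

text \<open>Pasting two point functions gives the point function at the glued point, and T commutes
  with pasting; \<open>pt_inject\<close> compares the results.\<close>

lemma \<phi>\<psi>_cmb:
  assumes x: "x \<in> carrier E" "y \<in> carrier E" and r: "r \<in> borel_measurable M" "s \<in> borel_measurable M"
    and A: "A \<in> events"
  shows "\<phi> (cmb A x y) = cmb A (\<phi> x) (\<phi> y)"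
    and "AE \<omega> in M. \<psi> (cmb A x y) (\<lambda>\<omega>. if \<omega> \<in> A then r \<omega> else s \<omega>) \<omega> =
      (if \<omega> \<in> A then \<psi> x r \<omega> else \<psi> y s \<omega>)"
proof -
  have [measurable]: "indicat_real A \<in> borel_measurable M" using A by simp
  have c: "cmb A x y \<in> carrier E" "cmb A (\<phi> x) (\<phi> y) \<in> carrier E" using x by auto
  have m: "(\<lambda>\<omega>. if \<omega> \<in> A then r \<omega> else s \<omega>) \<in> borel_measurable M"
    "(\<lambda>\<omega>. if \<omega> \<in> A then \<psi> x r \<omega> else \<psi> y s \<omega>) \<in> borel_measurable M"
    using r A \<psi>_meas x by (auto intro!: measurable_If_set)
  have "pt (\<phi> (cmb A x y)) (\<psi> (cmb A x y) (\<lambda>\<omega>. if \<omega> \<in> A then r \<omega> else s \<omega>)) =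
      T (paste M E A (pt x r) (pt y s))"
    unfolding paste_pt[OF x r A] by (rule T_pt[OF c(1) m(1), symmetric])
  also have "\<dots> = paste M E A (pt (\<phi> x) (\<psi> x r)) (pt (\<phi> y) (\<psi> y s))"
    using T_paste[OF A pt_Cvx[OF x(1) r(1)] pt_Cvx[OF x(2) r(2)]] by (simp add: T_pt x r)
  also have "\<dots> = pt (cmb A (\<phi> x) (\<phi> y)) (\<lambda>\<omega>. if \<omega> \<in> A then \<psi> x r \<omega> else \<psi> y s \<omega>)"
    by (intro paste_pt \<phi>_closed x \<psi>_meas r A)
  finally have *: "pt (\<phi> (cmb A x y)) (\<psi> (cmb A x y) (\<lambda>\<omega>. if \<omega> \<in> A then r \<omega> else s \<omega>)) = \<dots>" .
  show "\<phi> (cmb A x y) = cmb A (\<phi> x) (\<phi> y)"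
    and "AE \<omega> in M. \<psi> (cmb A x y) (\<lambda>\<omega>. if \<omega> \<in> A then r \<omega> else s \<omega>) \<omega> =
      (if \<omega> \<in> A then \<psi> x r \<omega> else \<psi> y s \<omega>)"
    using pt_inject[OF _ _ _ _ *] c m by (simp_all add: \<psi>_meas)
qed

lemma \<phi>_local:
  assumes x: "x \<in> carrier E" "y \<in> carrier E"
  shows "AE \<omega> in M. N (x \<ominus> y) \<omega> = 0 \<longrightarrow> N (\<phi> x \<ominus> \<phi> y) \<omega> = 0"
proof -
  have [measurable]: "N (x \<ominus> y) \<in> borel_measurable M" using x by (intro N_meas) simp
  define A where "A = {\<omega> \<in> space M. N (x \<ominus> y) \<omega> = 0}"
  have A: "A \<in> events" unfolding A_def by measurable
  have "cmb A x y = y"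
    by (rule eq_cmbI[OF A x x(2)]) (use N_minus_self[OF x(2)] in \<open>auto simp: A_def elim!: AE_mp\<close>)
  then have "cmb A (\<phi> x) (\<phi> y) = \<phi> y"
    using \<phi>\<psi>_cmb(1)[OF x _ _ A, of "\<lambda>_. 0" "\<lambda>_. 0"] by simp
  then have "AE \<omega> in M. N (\<phi> y \<ominus> \<phi> x) \<omega> = (if \<omega> \<in> A then N (\<phi> x \<ominus> \<phi> x) \<omega> else N (\<phi> y \<ominus> \<phi> x) \<omega>)"
    using N_cmb_minus[OF A \<phi>_closed[OF x(1)] \<phi>_closed[OF x(2)] \<phi>_closed[OF x(1)]] by simp
  then show ?thesis
    using N_minus_self[OF \<phi>_closed[OF x(1)]] N_minus_commute[OF \<phi>_closed[OF x(1)] \<phi>_closed[OF x(2)]] AE_space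
    by eventually_elim (auto simp: A_def)
qed

text \<open>On the event A where both the points and the values agree, pasting the first pair into
  the second changes nothing, so by \<open>\<phi>\<psi>_cmb\<close> the images agree on A as
  well.\<close>

lemma \<psi>_local:
  assumes x: "x \<in> carrier E" "y \<in> carrier E" and r [measurable]: "r \<in> borel_measurable M" "s \<in> borel_measurable M"
  shows "AE \<omega> in M. N (x \<ominus> y) \<omega> = 0 \<longrightarrow> r \<omega> = s \<omega> \<longrightarrow> \<psi> x r \<omega> = \<psi> y s \<omega>"
proof -
  have [measurable]: "N (x \<ominus> y) \<in> borel_measurable M" using x by (intro N_meas) simp
  define A where "A = {\<omega> \<in> space M. N (x \<ominus> y) \<omega> = 0 \<and> r \<omega> = s \<omega>}"
  have A: "A \<in> events" unfolding A_def by measurable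
  have "cmb A x y = y"
    by (rule eq_cmbI[OF A x x(2)]) (use N_minus_self[OF x(2)] in \<open>auto simp: A_def elim!: AE_mp\<close>)
  moreover have "(\<lambda>\<omega>. if \<omega> \<in> A then r \<omega> else s \<omega>) = s" by (auto simp: A_def)
  ultimately have "AE \<omega> in M. \<psi> y s \<omega> = (if \<omega> \<in> A then \<psi> x r \<omega> else \<psi> y s \<omega>)"
    using \<phi>\<psi>_cmb(2)[OF x r A] by simp
  then show ?thesis using AE_space by eventually_elim (auto simp: A_def split: if_splits)
qed

text \<open>Locality applied to the images: where \<phi> x and \<phi> y agree, so do x = \<phi>
  (\<phi> x) and y = \<phi> (\<phi> y).\<close>

lemma \<phi>_pos:
  assumes x: "x \<in> carrier E" "y \<in> carrier E" and pos: "AE \<omega> in M. 0 < N (x \<ominus> y) \<omega>"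
  shows "AE \<omega> in M. 0 < N (\<phi> x \<ominus> \<phi> y) \<omega>"
proof -
  have c: "\<phi> x \<ominus> \<phi> y \<in> carrier E" using x by simp
  show ?thesis
    using \<phi>_local[OF \<phi>_closed[OF x(1)] \<phi>_closed[OF x(2)]] pos N_nonneg[OF c]
    by (simp add: \<phi>_\<phi> x) (auto elim!: AE_mp)
qed

text \<open>\<open>T\<close> maps the segment function through the images of \<open>(x, r)\<close> and \<open>(y, s)\<close> to a convex function
  that is at most \<open>r\<close> at \<open>x\<close> and at most \<open>s\<close> at \<open>y\<close>.\<close>

lemma segment_le:
  assumes x: "x \<in> carrier E" "y \<in> carrier E" and pos: "AE \<omega> in M. 0 < N (x \<ominus> y) \<omega>"
    and g [measurable]: "g \<in> borel_measurable M" and g01: "AE \<omega> in M. 0 \<le> g \<omega>" "AE \<omega> in M. g \<omega> \<le> 1"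
    and r [measurable]: "r \<in> borel_measurable M" "s \<in> borel_measurable M"
    and t_def: "t = tau (\<phi> (cv g x y)) (\<phi> x) (\<phi> y)"
  shows "AE \<omega> in M. 0 \<le> t \<omega>" "AE \<omega> in M. t \<omega> \<le> 1" "\<phi> (cv g x y) = cv t (\<phi> x) (\<phi> y)"
    and "AE \<omega> in M. t \<omega> * \<psi> x r \<omega> + (1 - t \<omega>) * \<psi> y s \<omega> \<le> \<psi> (cv g x y) (\<lambda>\<omega>. g \<omega> * r \<omega> + (1 - g \<omega>) * s \<omega>) \<omega>"
proof -
  define z where "z = cv g x y"
  define q where "q = (\<lambda>\<omega>. g \<omega> * r \<omega> + (1 - g \<omega>) * s \<omega>)"
  have z: "z \<in> carrier E" using x by (simp add: z_def)
  have q [measurable]: "q \<in> borel_measurable M" unfolding q_def by measurable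
  note X = \<phi>_closed[OF x(1)] \<phi>_closed[OF x(2)] and Z = \<phi>_closed[OF z]
  note P = \<phi>_pos[OF x pos]
  note m = \<psi>_meas[OF x(1) r(1)] \<psi>_meas[OF x(2) r(2)]
  have tm [measurable]: "t \<in> borel_measurable M" unfolding t_def z_def[symmetric] using X Z by (intro tau_meas)
  let ?sf = "seg_fun (\<phi> x) (\<psi> x r) (\<phi> y) (\<psi> y s)"
  define f where "f = T (fn ?sf)"
  have S: "fn ?sf \<in> Cvx M E" by (rule seg_Cvx[OF X m P])
  have f: "f \<in> Cvx M E" unfolding f_def by (rule T_Cvx[OF S])
  have Tf: "T f = fn ?sf" unfolding f_def by (rule T_T[OF S])
  have "AE \<omega> in M. rp (f x) \<omega> \<le> ereal (r \<omega>)"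
    unfolding T_le_pt_iff[OF f x(1) r(1), symmetric] Tf
    using seg_endpoints(1)[OF X m P] by eventually_elim simp
  moreover have "AE \<omega> in M. rp (f y) \<omega> \<le> ereal (s \<omega>)"
    unfolding T_le_pt_iff[OF f x(2) r(2), symmetric] Tf
    using seg_endpoints(2)[OF X m P] by eventually_elim simp
  ultimately have "AE \<omega> in M. rp (f z) \<omega> \<le> ereal (q \<omega>)"
    using Cvx_convex[OF f x g g01] g01
  proof eventually_elim
    case (elim \<omega>)
    have "rp (f z) \<omega> \<le> ereal (g \<omega>) * rp (f x) \<omega> + ereal (1 - g \<omega>) * rp (f y) \<omega>"
      using elim by (simp add: z_def)
    also have "\<dots> \<le> ereal (g \<omega>) * ereal (r \<omega>) + ereal (1 - g \<omega>) * ereal (s \<omega>)"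
      using elim by (intro add_mono ereal_mult_left_mono) auto
    finally show ?case by (simp add: q_def)
  qed
  then have "AE \<omega> in M. rp (fn ?sf (\<phi> z)) \<omega> \<le> ereal (\<psi> z q \<omega>)"
    using T_le_pt_iff[OF f z q] by (simp add: Tf)
  moreover have "AE \<omega> in M. rp (fn ?sf (\<phi> z)) \<omega> = ?sf (\<phi> z) \<omega>"
    by (rule fn_rp[of "\<phi> z" ?sf, OF Z seg_fun_meas[OF X Z m]])
  \<comment> \<open>Since the segment function is bounded by a real number at \<phi> z, the point
    \<phi> z must lie on the segment between the images, and the interpolated value there is the
    lower bound sought.\<close>
  ultimately have *: "AE \<omega> in M. N (\<phi> z \<ominus> \<phi> y) \<omega> \<le> N (\<phi> x \<ominus> \<phi> y) \<omega> \<and> N (\<phi> z \<ominus> cv t (\<phi> x) (\<phi> y)) \<omega> = 0 \<and>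
      t \<omega> * \<psi> x r \<omega> + (1 - t \<omega>) * \<psi> y s \<omega> \<le> \<psi> z q \<omega>"
    by eventually_elim (auto simp: seg_fun_def t_def z_def split: if_splits)
  have nn: "AE \<omega> in M. 0 \<le> N (\<phi> z \<ominus> \<phi> y) \<omega>" using X Z by (intro N_nonneg) simp
  show "AE \<omega> in M. 0 \<le> t \<omega>" "AE \<omega> in M. t \<omega> \<le> 1"
    using * P nn unfolding t_def z_def[symmetric] by (auto simp: tau_def elim!: AE_mp)
  show "\<phi> (cv g x y) = cv t (\<phi> x) (\<phi> y)"
    using * eq_iff_N[OF Z, of "cv t (\<phi> x) (\<phi> y)"] X by (auto simp: z_def)
  show "AE \<omega> in M. t \<omega> * \<psi> x r \<omega> + (1 - t \<omega>) * \<psi> y s \<omega> \<le> \<psi> (cv g x y) (\<lambda>\<omega>. g \<omega> * r \<omega> + (1 - g \<omega>) * s \<omega>) \<omega>"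
    using * by (auto simp: z_def q_def)
qed

text \<open>\<open>segment_le\<close> gives one inequality. The other comes from applying it to the
  images of x and y with weight t, since \<phi> and \<psi> are undone by themselves.\<close>

lemma segment_eq:
  assumes x: "x \<in> carrier E" "y \<in> carrier E" and pos: "AE \<omega> in M. 0 < N (x \<ominus> y) \<omega>"
    and g [measurable]: "g \<in> borel_measurable M" and g01: "AE \<omega> in M. 0 < g \<omega>" "AE \<omega> in M. g \<omega> < 1"
  obtains t where "t \<in> borel_measurable M" "AE \<omega> in M. 0 < t \<omega>" "AE \<omega> in M. t \<omega> < 1"
    "\<phi> (cv g x y) = cv t (\<phi> x) (\<phi> y)"
    "\<forall>r\<in>borel_measurable M. \<forall>s\<in>borel_measurable M.
      AE \<omega> in M. \<psi> (cv g x y) (\<lambda>\<omega>. g \<omega> * r \<omega> + (1 - g \<omega>) * s \<omega>) \<omega> = t \<omega> * \<psi> x r \<omega> + (1 - t \<omega>) * \<psi> y s \<omega>"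
proof -
  define z where "z = cv g x y"
  define t where "t = tau (\<phi> z) (\<phi> x) (\<phi> y)"
  have z: "z \<in> carrier E" using x by (simp add: z_def)
  note X = \<phi>_closed[OF x(1)] \<phi>_closed[OF x(2)] and Z = \<phi>_closed[OF z]
  note P = \<phi>_pos[OF x pos]
  have tm [measurable]: "t \<in> borel_measurable M" unfolding t_def using X Z by (intro tau_meas)
  have g': "AE \<omega> in M. 0 \<le> g \<omega>" "AE \<omega> in M. g \<omega> \<le> 1" using g01 by (auto elim!: AE_mp)
  note t = segment_le[OF x pos g g' _ _ t_def[unfolded z_def]]
  have t01: "AE \<omega> in M. 0 \<le> t \<omega>" "AE \<omega> in M. t \<omega> \<le> 1" and \<phi>z: "\<phi> z = cv t (\<phi> x) (\<phi> y)"
    using t(1-3)[of "\<lambda>_. 0" "\<lambda>_. 0"] by (simp_all add: z_def)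
  show ?thesis
  proof (rule that)
    \<comment> \<open>An interior point is separated from both endpoints, so its image is separated
      from theirs, which excludes the weights 0 and 1.\<close>
    have "AE \<omega> in M. 0 < N (z \<ominus> y) \<omega>" "AE \<omega> in M. 0 < N (z \<ominus> x) \<omega>"
      using N_cv_minus_right[OF g x] N_cv_minus_left[OF g x] g01 pos
      by (auto simp: z_def elim!: AE_mp)
    note \<phi>_pos[OF z x(2) this(1)] \<phi>_pos[OF z x(1) this(2)]
    then have "AE \<omega> in M. 0 < t \<omega> \<and> t \<omega> < 1"
      using N_cv_minus_right[OF tm X] N_cv_minus_left[OF tm X] t01 P
      unfolding \<phi>z
    proof eventually_elim
      case (elim \<omega>)
      then have "t \<omega> \<noteq> 0" "t \<omega> \<noteq> 1" by auto
      then show ?case using elim by simp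
    qed
    then show "AE \<omega> in M. 0 < t \<omega>" "AE \<omega> in M. t \<omega> < 1" by auto
    show "\<phi> (cv g x y) = cv t (\<phi> x) (\<phi> y)" using \<phi>z by (simp add: z_def)
    show "\<forall>r\<in>borel_measurable M. \<forall>s\<in>borel_measurable M.
      AE \<omega> in M. \<psi> (cv g x y) (\<lambda>\<omega>. g \<omega> * r \<omega> + (1 - g \<omega>) * s \<omega>) \<omega> = t \<omega> * \<psi> x r \<omega> + (1 - t \<omega>) * \<psi> y s \<omega>"
    proof (intro ballI)
      fix r s :: "'a \<Rightarrow> real" assume r [measurable]: "r \<in> borel_measurable M" "s \<in> borel_measurable M"
      define q where "q = (\<lambda>\<omega>. g \<omega> * r \<omega> + (1 - g \<omega>) * s \<omega>)"
      have q [measurable]: "q \<in> borel_measurable M" unfolding q_def by measurable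
      note m [measurable] = \<psi>_meas[OF x(1) r(1)] \<psi>_meas[OF x(2) r(2)] \<psi>_meas[OF z q]
      define u where "u = (\<lambda>\<omega>. t \<omega> * \<psi> x r \<omega> + (1 - t \<omega>) * \<psi> y s \<omega>)"
      have u [measurable]: "u \<in> borel_measurable M" unfolding u_def by measurable
      have le: "AE \<omega> in M. u \<omega> \<le> \<psi> z q \<omega>"
        using t(4)[OF r] by (simp add: u_def z_def q_def)
      \<comment> \<open>Going back, the weight produced by \<open>segment_le\<close> is the original
        g, because the image of \<phi> z is z and \<open>tau\<close> recovers the weight of
        z.\<close>
      have gz: "AE \<omega> in M. tau (\<phi> (cv t (\<phi> x) (\<phi> y))) (\<phi> (\<phi> x)) (\<phi> (\<phi> y)) \<omega> = g \<omega>"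
      proof -
        have "\<phi> (cv t (\<phi> x) (\<phi> y)) = z" by (simp add: \<phi>z[symmetric] \<phi>_\<phi> z)
        then show ?thesis
          using seg_weight[OF x z g pos] N_minus_self[OF z] g01
          by (auto simp: \<phi>_\<phi> x z_def elim!: AE_mp)
      qed
      have bck: "AE \<omega> in M. g \<omega> * r \<omega> + (1 - g \<omega>) * s \<omega> \<le> \<psi> (\<phi> z) u \<omega>"
        using segment_le(4)[OF X P tm t01 m(1,2) refl] gz \<phi>\<psi>_inv(2)[OF x(1) r(1)] \<phi>\<psi>_inv(2)[OF x(2) r(2)]
        unfolding \<phi>z[symmetric] u_def by eventually_elim simp
      have "AE \<omega> in M. \<psi> (\<phi> z) u \<omega> \<le> \<psi> (\<phi> z) (\<psi> z q) \<omega>"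
        by (rule \<psi>_mono[OF Z u m(3) le])
      \<comment> \<open>A squeeze: q is at most \<psi> (\<phi> z) u by \<open>bck\<close>, and this
        is at most \<psi> (\<phi> z) (\<psi> z q) = q by monotonicity. Applying \<psi> z to both
        sides then gives u.\<close>
      then have "AE \<omega> in M. \<psi> (\<phi> z) u \<omega> = q \<omega>"
        using bck \<phi>\<psi>_inv(2)[OF z q] by eventually_elim (simp add: q_def)
      then have e: "\<psi> z (\<psi> (\<phi> z) u) = \<psi> z q"
        by (intro \<psi>_cong \<psi>_meas Z u q z)
      have "AE \<omega> in M. \<psi> z q \<omega> = u \<omega>"
        using \<phi>\<psi>_inv(2)[OF Z u] unfolding \<phi>_\<phi>[OF z] e .
      then show "AE \<omega> in M. \<psi> (cv g x y) (\<lambda>\<omega>. g \<omega> * r \<omega> + (1 - g \<omega>) * s \<omega>) \<omega> = t \<omega> * \<psi> x r \<omega> + (1 - t \<omega>) * \<psi> y s \<omega>"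
        by (simp add: z_def q_def u_def)
    qed
  qed (rule tm)
qed


section \<open>The action on values is a translation\<close>

text \<open>With z as the midpoint of a separated pair, \<open>segment_eq\<close> is a Pexider
  equation whose two other unknown functions, those at x and y, are eliminated by evaluating it four
  times.\<close>

lemma \<psi>_additive:
  assumes z: "z \<in> carrier E" and u [measurable]: "u \<in> borel_measurable M" "v \<in> borel_measurable M"
  shows "AE \<omega> in M. \<psi> z (\<lambda>\<omega>. u \<omega> + v \<omega>) \<omega> - \<psi> z (\<lambda>_. 0) \<omega> =
    (\<psi> z u \<omega> - \<psi> z (\<lambda>_. 0) \<omega>) + (\<psi> z v \<omega> - \<psi> z (\<lambda>_. 0) \<omega>)"
proof -
  obtain e where e: "e \<in> carrier E" and pos: "AE \<omega> in M. 0 < N e \<omega>" using ex_nonvanishing by blast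
  \<comment> \<open>The pair is z + e and, by the weight 2, 2z - x = z - e; the nowhere vanishing e
    separates them and z is their midpoint.\<close>
  define x where "x = z \<oplus> e"
  define y where "y = cv (\<lambda>_. 2) z x"
  have x: "x \<in> carrier E" using z e by (simp add: x_def)
  have y: "y \<in> carrier E" using x z by (simp add: y_def)
  have "z \<ominus> x = \<ominus> e" using z e by (simp add: x_def a_minus_def minus_add r_neg2)
  then have "AE \<omega> in M. N (z \<ominus> x) \<omega> = N e \<omega>"
    using N_sm[of "\<lambda>_. -1" e] e by (simp add: sm_uminus_one)
  then have pos': "AE \<omega> in M. 0 < N (x \<ominus> y) \<omega>"
    using N_cv_minus_right[of "\<lambda>_. 2" z x] x z N_minus_commute[OF x y] pos
    by (auto simp: y_def elim!: AE_mp)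
  have mid: "cv (\<lambda>_. 1/2) x y = z"
  proof -
    have "cv (\<lambda>_. 0) z x = x" "cv (\<lambda>_. 1) z x = z" using x z by (simp_all add: cv_def sm_zero sm_one)
    then show ?thesis
      using cv_cv[of "\<lambda>_. 1/2" "\<lambda>_. 0" "\<lambda>_. 2" z x] x z by (simp add: y_def)
  qed
  have half: "(\<lambda>_. 1/2 :: real) \<in> borel_measurable M" "AE \<omega> in M. 0 < (1/2::real)" "AE \<omega> in M. (1/2::real) < 1"
    by simp_all
  obtain t where "t \<in> borel_measurable M" "AE \<omega> in M. 0 < t \<omega>" "AE \<omega> in M. t \<omega> < 1"
      "\<phi> (cv (\<lambda>_. 1/2) x y) = cv t (\<phi> x) (\<phi> y)"
    and eq: "\<forall>r\<in>borel_measurable M. \<forall>s\<in>borel_measurable M.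
      AE \<omega> in M. \<psi> (cv (\<lambda>_. 1/2) x y) (\<lambda>\<omega>. 1/2 * r \<omega> + (1 - 1/2) * s \<omega>) \<omega> =
        t \<omega> * \<psi> x r \<omega> + (1 - t \<omega>) * \<psi> y s \<omega>"
    by (rule segment_eq[OF x y pos' half])
  have id: "1/2 * (2 * a) + (1 - 1/2) * (2 * b) = a + b" for a b :: real by simp
  have m: "(\<lambda>\<omega>. 2 * u \<omega>) \<in> borel_measurable M" "(\<lambda>\<omega>. 2 * v \<omega>) \<in> borel_measurable M"
    "(\<lambda>\<omega>. 2 * 0 :: real) \<in> borel_measurable M" by measurable
  \<comment> \<open>Values 2u and 2v compensate for the halves. The first plus the last equation
    minus the two middle ones cancels everything at x and y, whatever t is.\<close>
  note E = eq[rule_format, OF m(1) m(2)] eq[rule_format, OF m(1) m(3)] eq[rule_format, OF m(3) m(2)]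
    eq[rule_format, OF m(3) m(3)]
  show ?thesis
    using E[unfolded mid id add_0 add_0_right] by eventually_elim (simp add: algebra_simps)
qed

text \<open>The coefficient \<open>\<alpha>\<close> of the overview, and \<open>offset\<close> is
  the constant term \<open>\<beta>\<close>.\<close>

definition slope :: "'b \<Rightarrow> 'a \<Rightarrow> real" where
  "slope z \<omega> = \<psi> z (\<lambda>_. 1) \<omega> - \<psi> z (\<lambda>_. 0) \<omega>"

definition offset :: "'b \<Rightarrow> 'a \<Rightarrow> real" where
  "offset z = \<psi> z (\<lambda>_. 0)"

lemma offset_meas [measurable]: "z \<in> carrier E \<Longrightarrow> offset z \<in> borel_measurable M"
  unfolding offset_def by (rule \<psi>_meas) simp_all

lemma slope_nonneg: "z \<in> carrier E \<Longrightarrow> AE \<omega> in M. 0 \<le> slope z \<omega>"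
  using \<psi>_mono[of z "\<lambda>_. 0" "\<lambda>_. 1"] by (simp add: slope_def)

lemma \<psi>_of_nat:
  assumes z: "z \<in> carrier E"
  shows "AE \<omega> in M. \<psi> z (\<lambda>_. real n * c) \<omega> - offset z \<omega> = real n * (\<psi> z (\<lambda>_. c) \<omega> - offset z \<omega>)"
proof (induction n)
  case (Suc n)
  have "(\<lambda>_::'a. real (Suc n) * c) = (\<lambda>_. real n * c + c)" by (simp add: algebra_simps)
  then have "AE \<omega> in M. \<psi> z (\<lambda>_. real (Suc n) * c) \<omega> - offset z \<omega> =
      (\<psi> z (\<lambda>_. real n * c) \<omega> - offset z \<omega>) + (\<psi> z (\<lambda>_. c) \<omega> - offset z \<omega>)"
    using \<psi>_additive[OF z, of "\<lambda>_. real n * c" "\<lambda>_. c"] by (simp add: offset_def)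
  with Suc show ?case by eventually_elim (simp add: algebra_simps)
qed (simp add: offset_def)

lemma \<psi>_uminus:
  assumes z: "z \<in> carrier E"
  shows "AE \<omega> in M. \<psi> z (\<lambda>_. - c) \<omega> - offset z \<omega> = - (\<psi> z (\<lambda>_. c) \<omega> - offset z \<omega>)"
proof -
  have "AE \<omega> in M. \<psi> z (\<lambda>\<omega>. c + - c) \<omega> - offset z \<omega> = (\<psi> z (\<lambda>_. c) \<omega> - offset z \<omega>) + (\<psi> z (\<lambda>_. - c) \<omega> - offset z \<omega>)"
    unfolding offset_def by (rule \<psi>_additive[OF z]) simp_all
  then show ?thesis by eventually_elim (simp add: offset_def)
qed

lemma \<psi>_rat:
  assumes z: "z \<in> carrier E" and q: "q \<in> \<rat>"
  shows "AE \<omega> in M. \<psi> z (\<lambda>_. q) \<omega> - offset z \<omega> = q * slope z \<omega>"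
proof -
  have pos: "AE \<omega> in M. \<psi> z (\<lambda>_. p) \<omega> - offset z \<omega> = p * slope z \<omega>" if "p \<in> \<rat>" "0 \<le> p" for p
  proof -
    obtain m n :: nat where n: "n \<noteq> 0" and "\<bar>p\<bar> = real m / real n"
      using Rats_abs_nat_div_natE[OF \<open>p \<in> \<rat>\<close>] by metis
    then have p: "real n * p = real m" using \<open>0 \<le> p\<close> by (simp add: field_simps)
    show ?thesis
      using \<psi>_of_nat[OF z, of n p] \<psi>_of_nat[OF z, of m 1]
    proof eventually_elim
      case (elim \<omega>)
      then have "real n * (\<psi> z (\<lambda>_. p) \<omega> - offset z \<omega>) = real n * (p * slope z \<omega>)"
        unfolding p by (simp add: slope_def offset_def mult.assoc[symmetric] p)
      then show ?case using n by simp
    qed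
  qed
  show ?thesis
  proof (cases "0 \<le> q")
    case False
    then have "AE \<omega> in M. \<psi> z (\<lambda>_. - q) \<omega> - offset z \<omega> = - q * slope z \<omega>" using q by (intro pos) auto
    with \<psi>_uminus[OF z, of q] show ?thesis by eventually_elim simp
  qed (use pos q in simp)
qed

text \<open>Monotonicity and locality carry the identity from rational constants to random variables.\<close>

lemma \<psi>_affine:
  assumes z: "z \<in> carrier E" and r [measurable]: "r \<in> borel_measurable M"
  shows "AE \<omega> in M. \<psi> z r \<omega> = slope z \<omega> * r \<omega> + offset z \<omega>"
proof -
  have le: "AE \<omega> in M. r \<omega> \<le> q \<longrightarrow> \<psi> z r \<omega> - offset z \<omega> \<le> q * slope z \<omega>" if q: "q \<in> \<rat>" for q
  proof -
    \<comment> \<open>Truncation makes the comparison with the constant q valid everywhere, as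
      monotonicity requires; where r \<le> q the truncated variable is r, and locality restores r
      there.\<close>
    have m: "(\<lambda>\<omega>. min (r \<omega>) q) \<in> borel_measurable M" "(\<lambda>_. q) \<in> borel_measurable M" by measurable
    have "AE \<omega> in M. \<psi> z (\<lambda>\<omega>. min (r \<omega>) q) \<omega> \<le> \<psi> z (\<lambda>_. q) \<omega>"
      by (rule \<psi>_mono[OF z m]) simp
    then show ?thesis
      using \<psi>_local[OF z z m(1) r] N_minus_self[OF z] \<psi>_rat[OF z q]
      by eventually_elim (auto simp: min_def)
  qed
  have ge: "AE \<omega> in M. q \<le> r \<omega> \<longrightarrow> q * slope z \<omega> \<le> \<psi> z r \<omega> - offset z \<omega>" if q: "q \<in> \<rat>" for q
  proof -
    have m: "(\<lambda>\<omega>. max (r \<omega>) q) \<in> borel_measurable M" "(\<lambda>_. q) \<in> borel_measurable M" by measurable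
    have "AE \<omega> in M. \<psi> z (\<lambda>_. q) \<omega> \<le> \<psi> z (\<lambda>\<omega>. max (r \<omega>) q) \<omega>"
      by (rule \<psi>_mono[OF z m(2) m(1)]) simp
    then show ?thesis
      using \<psi>_local[OF z z m(1) r] N_minus_self[OF z] \<psi>_rat[OF z q]
      by eventually_elim (auto simp: max_def)
  qed
  have "AE \<omega> in M. \<forall>q\<in>\<rat>. (r \<omega> \<le> q \<longrightarrow> \<psi> z r \<omega> - offset z \<omega> \<le> q * slope z \<omega>) \<and> (q \<le> r \<omega> \<longrightarrow> q * slope z \<omega> \<le> \<psi> z r \<omega> - offset z \<omega>)"
    using le ge by (subst AE_ball_countable[OF countable_rat]) auto
  with slope_nonneg[OF z] show ?thesis
  proof eventually_elim
    case (elim \<omega>)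
    define k where "k = \<psi> z r \<omega> - offset z \<omega>"
    have 1: "r \<omega> \<le> q \<Longrightarrow> k \<le> q * slope z \<omega>" and 2: "q \<le> r \<omega> \<Longrightarrow> q * slope z \<omega> \<le> k" if "q \<in> \<rat>" for q
      using elim(2) that by (auto simp: k_def)
    have "k = r \<omega> * slope z \<omega>"
    proof (cases "slope z \<omega> = 0")
      case True
      obtain p q where "p \<in> \<rat>" "q \<in> \<rat>" "p < r \<omega>" "r \<omega> < q"
        by (meson Rats_dense_in_real gt_ex lt_ex)
      then show ?thesis using 1[of q] 2[of p] True by simp
    next
      case False
      then have a: "0 < slope z \<omega>" using elim by simp
      have "\<not> r \<omega> < k / slope z \<omega>"
      proof
        assume "r \<omega> < k / slope z \<omega>"
        then obtain q where "q \<in> \<rat>" "r \<omega> < q" "q < k / slope z \<omega>" using Rats_dense_in_real by blast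
        then show False using 1[of q] a by (simp add: field_simps)
      qed
      moreover have "\<not> k / slope z \<omega> < r \<omega>"
      proof
        assume "k / slope z \<omega> < r \<omega>"
        then obtain q where "q \<in> \<rat>" "k / slope z \<omega> < q" "q < r \<omega>" using Rats_dense_in_real by blast
        then show False using 2[of q] a by (simp add: field_simps)
      qed
      ultimately show ?thesis using a by (simp add: field_simps)
    qed
    then show ?case by (simp add: k_def algebra_simps)
  qed
qed

text \<open>Subtract the affine formula at \<phi> z for the inputs \<psi> z 1 and \<psi> z 0, whose
  outputs are 1 and 0.\<close>

lemma slope_inverse:
  assumes z: "z \<in> carrier E"
  shows "AE \<omega> in M. slope (\<phi> z) \<omega> * slope z \<omega> = 1"
proof -
  have m: "\<psi> z (\<lambda>_. 1) \<in> borel_measurable M" "\<psi> z (\<lambda>_. 0) \<in> borel_measurable M"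
    using z by (auto intro: \<psi>_meas)
  show ?thesis
    using \<psi>_affine[OF \<phi>_closed[OF z] m(1)] \<psi>_affine[OF \<phi>_closed[OF z] m(2)]
      \<phi>\<psi>_inv(2)[OF z, of "\<lambda>_. 1"] \<phi>\<psi>_inv(2)[OF z, of "\<lambda>_. 0"]
    by (auto simp: slope_def[of z] algebra_simps elim!: AE_mp)
qed

lemma slope_pos:
  assumes z: "z \<in> carrier E"
  shows "AE \<omega> in M. 0 < slope z \<omega>"
  using slope_inverse[OF z] slope_nonneg[OF z] by eventually_elim (metis less_eq_real_def mult_zero_right zero_neq_one)

text \<open>Both sides of \<open>segment_eq\<close> are affine in the two values; the constants (0,
  0), (1, 0) and (0, 1) extract the three coefficients. Dividing the two slope relations by the
  slopes and adding shows that 1 / slope is affine along the segment.\<close>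

lemma segment_slope_offset:
  assumes x: "x \<in> carrier E" "y \<in> carrier E" and pos: "AE \<omega> in M. 0 < N (x \<ominus> y) \<omega>"
    and g [measurable]: "g \<in> borel_measurable M" and g01: "AE \<omega> in M. 0 < g \<omega>" "AE \<omega> in M. g \<omega> < 1"
  obtains t where "t \<in> borel_measurable M" "\<phi> (cv g x y) = cv t (\<phi> x) (\<phi> y)"
    "AE \<omega> in M. slope (cv g x y) \<omega> * g \<omega> = t \<omega> * slope x \<omega>"
    "AE \<omega> in M. slope (cv g x y) \<omega> * (1 - g \<omega>) = (1 - t \<omega>) * slope y \<omega>"
    "AE \<omega> in M. offset (cv g x y) \<omega> = t \<omega> * offset x \<omega> + (1 - t \<omega>) * offset y \<omega>"
proof -
  obtain t where t: "t \<in> borel_measurable M" "AE \<omega> in M. 0 < t \<omega>" "AE \<omega> in M. t \<omega> < 1"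
      "\<phi> (cv g x y) = cv t (\<phi> x) (\<phi> y)"
    and eq: "\<forall>r\<in>borel_measurable M. \<forall>s\<in>borel_measurable M.
      AE \<omega> in M. \<psi> (cv g x y) (\<lambda>\<omega>. g \<omega> * r \<omega> + (1 - g \<omega>) * s \<omega>) \<omega> = t \<omega> * \<psi> x r \<omega> + (1 - t \<omega>) * \<psi> y s \<omega>"
    by (rule segment_eq[OF x pos g g01])
  have z: "cv g x y \<in> carrier E" using x by simp
  have eq': "AE \<omega> in M. slope (cv g x y) \<omega> * (g \<omega> * r + (1 - g \<omega>) * s) + offset (cv g x y) \<omega> =
      t \<omega> * (slope x \<omega> * r + offset x \<omega>) + (1 - t \<omega>) * (slope y \<omega> * s + offset y \<omega>)" for r s
    using eq[rule_format, of "\<lambda>_. r" "\<lambda>_. s"] \<psi>_affine[OF z, of "\<lambda>\<omega>. g \<omega> * r + (1 - g \<omega>) * s"]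
      \<psi>_affine[OF x(1), of "\<lambda>_. r"] \<psi>_affine[OF x(2), of "\<lambda>_. s"]
    by (auto elim!: AE_mp)
  have "AE \<omega> in M. slope (cv g x y) \<omega> * g \<omega> = t \<omega> * slope x \<omega> \<and>
      slope (cv g x y) \<omega> * (1 - g \<omega>) = (1 - t \<omega>) * slope y \<omega> \<and>
      offset (cv g x y) \<omega> = t \<omega> * offset x \<omega> + (1 - t \<omega>) * offset y \<omega>"
    using eq'[of 0 0] eq'[of 1 0] eq'[of 0 1] by eventually_elim (simp add: distrib_left)
  with t(1,4) that show ?thesis by auto
qed

text \<open>The reciprocal of \<open>slope\<close> is affine along lines and positive, hence constant.\<close>

lemma slope_le_of_pos:
  assumes x: "x \<in> carrier E" "y \<in> carrier E" and pos: "AE \<omega> in M. 0 < N (x \<ominus> y) \<omega>"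
  shows "AE \<omega> in M. slope x \<omega> \<le> slope y \<omega>"
proof -
  have "AE \<omega> in M. (1 - 1 / real (n + 2)) / slope y \<omega> \<le> 1 / slope x \<omega>" for n
  proof -
    \<comment> \<open>The point p = y + k (x - y) lies beyond x, which then has weight 1/k between p
      and y. Starting at k = 2 keeps this weight strictly between 0 and 1.\<close>
    let ?k = "real (n + 2)"
    define p where "p = cv (\<lambda>_. ?k) x y"
    have p: "p \<in> carrier E" using x by (simp add: p_def)
    have 1: "AE \<omega> in M. 0 < N (p \<ominus> y) \<omega>"
      using N_cv_minus_right[of "\<lambda>_. ?k" x y] x pos by (auto simp: p_def elim!: AE_mp)
    have "cv (\<lambda>_. 0) x y = y" "cv (\<lambda>_. 1) x y = x" using x by (simp_all add: cv_def sm_zero sm_one)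
    then have px: "cv (\<lambda>_. 1 / ?k) p y = x"
      using cv_cv[of "\<lambda>_. 1 / ?k" "\<lambda>_. ?k" "\<lambda>_. 0" x y] x by (simp add: p_def)
    obtain t where "AE \<omega> in M. slope x \<omega> * (1 / ?k) = t \<omega> * slope p \<omega>"
      "AE \<omega> in M. slope x \<omega> * (1 - 1 / ?k) = (1 - t \<omega>) * slope y \<omega>"
      using segment_slope_offset[OF p x(2) 1, of "\<lambda>_. 1 / ?k"] unfolding px by auto
    then show ?thesis
      using slope_pos[OF p] slope_pos[OF x(1)] slope_pos[OF x(2)]
    proof eventually_elim
      case (elim \<omega>)
      \<comment> \<open>Positivity of the slope at the remote point p enters only as t > 0, which
        makes 1 - t at most 1; the lost factor 1 - 1/k disappears as n grows.\<close>
      have "0 < t \<omega>" using elim by (metis mult_pos_pos of_nat_0_less_iff add_gr_0 zero_less_numeral zero_less_divide_1_iff zero_less_mult_pos2)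
      then have "slope x \<omega> * (1 - 1 / ?k) \<le> slope y \<omega>" using elim by (simp add: mult_left_le_one_le)
      then show ?case using elim by (simp add: divide_simps mult.commute)
    qed
  qed
  then have "AE \<omega> in M. \<forall>n. (1 - 1 / real (n + 2)) / slope y \<omega> \<le> 1 / slope x \<omega>" by (intro AE_allI)
  then show ?thesis
    using slope_pos[OF x(1)] slope_pos[OF x(2)]
  proof eventually_elim
    case (elim \<omega>)
    have "(\<lambda>n. (1 - 1 / real (n + 2)) / slope y \<omega>) \<longlonglongrightarrow> (1 - 0) / slope y \<omega>"
      using LIMSEQ_ignore_initial_segment[OF lim_1_over_n, of 2] elim by (intro tendsto_intros) simp_all
    then have "(1 - 0) / slope y \<omega> \<le> 1 / slope x \<omega>"
      by (rule LIMSEQ_le_const2) (use elim(1) in blast)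
    then show ?case using elim by (simp add: divide_simps)
  qed
qed

section \<open>From separated pairs to arbitrary pairs\<close>

text \<open>Keep y where it differs from x and put x + e where it does not. A claim about x and y
  then follows from the claim about x and y' on the first event and from locality on the
  second.\<close>

lemma separate_points:
  assumes x: "x \<in> carrier E" "y \<in> carrier E"
  obtains y' where "y' \<in> carrier E" "AE \<omega> in M. 0 < N (x \<ominus> y') \<omega>"
    "AE \<omega> in M. N (x \<ominus> y) \<omega> = 0 \<or> N (y' \<ominus> y) \<omega> = 0"
proof -
  obtain e where e: "e \<in> carrier E" and pos: "AE \<omega> in M. 0 < N e \<omega>" using ex_nonvanishing by blast
  have [measurable]: "N (x \<ominus> y) \<in> borel_measurable M" using x by (intro N_meas) simp
  define A where "A = {\<omega> \<in> space M. N (x \<ominus> y) \<omega> = 0}"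
  have A: "A \<in> events" unfolding A_def by measurable
  have [measurable]: "indicat_real A \<in> borel_measurable M" using A by simp
  have xe: "x \<oplus> e \<in> carrier E" using x e by simp
  have eq: "(x \<oplus> e) \<ominus> x = e" using x e by (simp add: a_minus_def a_comm[of x e] a_assoc r_neg)
  let ?y = "cmb A (x \<oplus> e) y"
  have c: "?y \<in> carrier E" using xe x by simp
  have n: "x \<ominus> y \<in> carrier E" using x by simp
  show ?thesis
  proof (rule that[OF c])
    show "AE \<omega> in M. 0 < N (x \<ominus> ?y) \<omega>"
      using N_cmb_minus[OF A xe x(2) x(1)] N_minus_commute[OF x(1) c] N_minus_commute[OF x] pos N_nonneg[OF n] AE_space
      unfolding eq by eventually_elim (auto simp: A_def)
    show "AE \<omega> in M. N (x \<ominus> y) \<omega> = 0 \<or> N (?y \<ominus> y) \<omega> = 0"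
      using N_cmb_minus[OF A xe x(2) x(2)] N_minus_self[OF x(2)] by eventually_elim (auto simp: A_def)
  qed
qed

lemma slope_const:
  assumes x: "x \<in> carrier E" "y \<in> carrier E"
  shows "AE \<omega> in M. slope x \<omega> = slope y \<omega>"
proof -
  obtain y' where y': "y' \<in> carrier E" and pos: "AE \<omega> in M. 0 < N (x \<ominus> y') \<omega>"
    and or: "AE \<omega> in M. N (x \<ominus> y) \<omega> = 0 \<or> N (y' \<ominus> y) \<omega> = 0"
    by (rule separate_points[OF x])
  have pos': "AE \<omega> in M. 0 < N (y' \<ominus> x) \<omega>"
    using pos N_minus_commute[OF x(1) y'] by eventually_elim simp
  have loc: "AE \<omega> in M. N (a \<ominus> b) \<omega> = 0 \<longrightarrow> slope a \<omega> = slope b \<omega>" if "a \<in> carrier E" "b \<in> carrier E" for a b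
    using \<psi>_local[OF that, of "\<lambda>_. 0" "\<lambda>_. 0"] \<psi>_local[OF that, of "\<lambda>_. 1" "\<lambda>_. 1"]
    by (auto simp: slope_def elim!: AE_mp)
  show ?thesis
    using slope_le_of_pos[OF x(1) y' pos] slope_le_of_pos[OF y' x(1) pos'] loc[OF x] loc[OF y' x(2)] or
    by eventually_elim auto
qed

lemma slope_eq_1:
  assumes x: "x \<in> carrier E"
  shows "AE \<omega> in M. slope x \<omega> = 1"
  using slope_inverse[OF x] slope_const[OF \<phi>_closed[OF x] x] slope_pos[OF x]
proof eventually_elim
  case (elim \<omega>)
  then have "(slope x \<omega>)\<^sup>2 = 1\<^sup>2" by (simp add: power2_eq_square)
  then show ?case using elim by (simp only: power2_eq_iff) auto
qed

lemma \<psi>_translation: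
  assumes z: "z \<in> carrier E" and r: "r \<in> borel_measurable M"
  shows "AE \<omega> in M. \<psi> z r \<omega> = r \<omega> + offset z \<omega>"
  using \<psi>_affine[OF z r] slope_eq_1[OF z] by eventually_elim simp

lemma offset_\<phi>:
  assumes z: "z \<in> carrier E"
  shows "AE \<omega> in M. offset (\<phi> z) \<omega> = - offset z \<omega>"
  using \<psi>_translation[OF \<phi>_closed[OF z] offset_meas[OF z]] \<phi>\<psi>_inv(2)[OF z, of "\<lambda>_. 0"]
  by (auto simp: offset_def[of z] elim!: AE_mp)

text \<open>For a separated pair the first slope relation with all slopes equal to 1 reads g = t.
  For a general pair the two events of \<open>separate_points\<close> are treated apart: either y'
  agrees with y, or x, y and their combination all agree.\<close>

lemma \<phi>_offset_cv:
  assumes x: "x \<in> carrier E" "y \<in> carrier E"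
    and g [measurable]: "g \<in> borel_measurable M" and g01: "AE \<omega> in M. 0 < g \<omega>" "AE \<omega> in M. g \<omega> < 1"
  shows "\<phi> (cv g x y) = cv g (\<phi> x) (\<phi> y)"
    and "AE \<omega> in M. offset (cv g x y) \<omega> = g \<omega> * offset x \<omega> + (1 - g \<omega>) * offset y \<omega>"
proof -
  obtain y' where y': "y' \<in> carrier E" and pos: "AE \<omega> in M. 0 < N (x \<ominus> y') \<omega>"
    and or: "AE \<omega> in M. N (x \<ominus> y) \<omega> = 0 \<or> N (y' \<ominus> y) \<omega> = 0"
    by (rule separate_points[OF x])
  define z where "z = cv g x y"
  define z' where "z' = cv g x y'"
  have z: "z \<in> carrier E" "z' \<in> carrier E" using x y' by (simp_all add: z_def z'_def)
  obtain t where t [measurable]: "t \<in> borel_measurable M" and \<phi>z: "\<phi> z' = cv t (\<phi> x) (\<phi> y')"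
    and a: "AE \<omega> in M. slope z' \<omega> * g \<omega> = t \<omega> * slope x \<omega>"
    and "AE \<omega> in M. slope z' \<omega> * (1 - g \<omega>) = (1 - t \<omega>) * slope y' \<omega>"
    and b: "AE \<omega> in M. offset z' \<omega> = t \<omega> * offset x \<omega> + (1 - t \<omega>) * offset y' \<omega>"
    by (rule segment_slope_offset[OF x(1) y' pos g g01, folded z'_def])
  have tg: "AE \<omega> in M. t \<omega> = g \<omega>"
    using a slope_eq_1[OF x(1)] slope_eq_1[OF z(2)] by eventually_elim simp
  have \<phi>z': "\<phi> z' = cv g (\<phi> x) (\<phi> y')"
    unfolding \<phi>z by (rule cv_cong[OF t g tg])
  have bz': "AE \<omega> in M. offset z' \<omega> = g \<omega> * offset x \<omega> + (1 - g \<omega>) * offset y' \<omega>"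
    using b tg by eventually_elim simp
  have loc: "AE \<omega> in M. N (a \<ominus> b) \<omega> = 0 \<longrightarrow> offset a \<omega> = offset b \<omega>" if "a \<in> carrier E" "b \<in> carrier E" for a b
    using \<psi>_local[OF that, of "\<lambda>_. 0" "\<lambda>_. 0"] by (simp add: offset_def)
  have shift: "AE \<omega> in M. N (cv g u v \<ominus> cv g u w) \<omega> = \<bar>1 - g \<omega>\<bar> * N (v \<ominus> w) \<omega>"
    if "u \<in> carrier E" "v \<in> carrier E" "w \<in> carrier E" for u v w
    using N_sm[of "\<lambda>\<omega>. 1 - g \<omega>" "v \<ominus> w"] that by (simp add: cv_minus_cv minus_self cv_zero_left)
  show "AE \<omega> in M. offset (cv g x y) \<omega> = g \<omega> * offset x \<omega> + (1 - g \<omega>) * offset y \<omega>"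
    unfolding z_def[symmetric]
    using or bz' shift[OF x(1) y' x(2)] N_cv_minus_left[OF g x] loc[OF z(2,1)] loc[OF z(1) x(1)] loc[OF y' x(2)] loc[OF x]
    unfolding z_def z'_def by eventually_elim (auto simp: algebra_simps)
  note X = \<phi>_closed[OF x(1)] \<phi>_closed[OF x(2)] \<phi>_closed[OF y'] and Z = \<phi>_closed[OF z(1)] \<phi>_closed[OF z(2)]
  have cX: "cv g (\<phi> x) (\<phi> y) \<in> carrier E" using X by simp
  have nn: "\<phi> z \<ominus> cv g (\<phi> x) (\<phi> y) \<in> carrier E" using Z cX by simp
  have "AE \<omega> in M. N (\<phi> z \<ominus> cv g (\<phi> x) (\<phi> y)) \<omega> = 0"
    using or shift[OF x(1) y' x(2), folded z_def z'_def] N_cv_minus_left[OF g x, folded z_def] \<phi>_local[OF z(2,1)]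
      \<phi>_local[OF z(1) x(1)] \<phi>_local[OF y' x(2)]
      \<phi>_local[OF x] shift[OF X(1,3,2), folded \<phi>z'] N_cv_minus_left[OF g X(1,2)]
      N_triangle_minus[OF Z(1) Z(2) cX] N_triangle_minus[OF Z(1) X(1) cX]
      N_minus_commute[OF Z(1) Z(2)] N_minus_commute[OF X(1) cX] N_nonneg[OF nn]
    by eventually_elim auto
  then show "\<phi> (cv g x y) = cv g (\<phi> x) (\<phi> y)"
    using eq_iff_N[OF Z(1) cX] by (simp add: z_def)
qed

end


section \<open>Affine maps between random normed modules\<close>

text \<open>Only weights strictly between 0 and 1 are available. Taking zero as second point gives
  homogeneity for such scalars; the extension to positive scalars, to sums and to all scalars uses
  only the module laws.\<close>

lemma affine_imp_hom:
  fixes M :: "'w measure" and E :: "('w, 'e) rn_module" and G :: "('w, 'f) rn_module"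
  assumes "rn_module M E" "rn_module M G" and F: "\<And>x. x \<in> carrier E \<Longrightarrow> F x \<in> carrier G"
    and aff: "\<And>x y g. x \<in> carrier E \<Longrightarrow> y \<in> carrier E \<Longrightarrow> g \<in> borel_measurable M \<Longrightarrow>
      AE \<omega> in M. 0 < g \<omega> \<Longrightarrow> AE \<omega> in M. g \<omega> < 1 \<Longrightarrow> F (rn_module.cv M E g x y) = rn_module.cv M G g (F x) (F y)"
  defines "H \<equiv> \<lambda>x. F x \<ominus>\<^bsub>G\<^esub> F \<zero>\<^bsub>E\<^esub>"
  shows "x \<in> carrier E \<Longrightarrow> y \<in> carrier E \<Longrightarrow> H (x \<oplus>\<^bsub>E\<^esub> y) = H x \<oplus>\<^bsub>G\<^esub> H y"
    and "x \<in> carrier E \<Longrightarrow> g \<in> borel_measurable M \<Longrightarrow> H (rn_module.sm M E g x) = rn_module.sm M G g (H x)"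
proof -
  interpret E: rn_module M E by fact
  interpret G: rn_module M G by fact
  have Hc: "H x \<in> carrier G" if "x \<in> carrier E" for x using that F by (simp add: H_def)
  have H0: "H \<zero>\<^bsub>E\<^esub> = \<zero>\<^bsub>G\<^esub>" using F by (simp add: H_def G.minus_self)
  have Hcv: "H (E.cv g x y) = G.cv g (H x) (H y)"
    if "x \<in> carrier E" "y \<in> carrier E" "g \<in> borel_measurable M" "AE \<omega> in M. 0 < g \<omega>" "AE \<omega> in M. g \<omega> < 1" for x y g
    using that F by (simp add: H_def aff G.cv_minus)
  have Hs1: "H (E.sm g x) = G.sm g (H x)"
    if "x \<in> carrier E" "g \<in> borel_measurable M" "AE \<omega> in M. 0 < g \<omega>" "AE \<omega> in M. g \<omega> < 1" for x g
    using Hcv[of x "\<zero>\<^bsub>E\<^esub>" g] that by (simp add: E.cv_zero_right G.cv_zero_right H0 Hc)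
  have Hs2: "H (E.sm g x) = G.sm g (H x)"
    if x: "x \<in> carrier E" and g [measurable]: "g \<in> borel_measurable M" and pos: "AE \<omega> in M. 0 < g \<omega>" for x g
  proof -
    \<comment> \<open>Both quotients lie strictly between 0 and 1 and \<open>?a = ?b * g\<close>, so
      H is known on \<open>E.sm ?a x\<close> in two ways; multiplying by 1 + g clears the
      denominator.\<close>
    let ?a = "\<lambda>\<omega>. g \<omega> / (1 + g \<omega>)" and ?b = "\<lambda>\<omega>. 1 / (1 + g \<omega>)" and ?c = "\<lambda>\<omega>. 1 + g \<omega>"
    have "E.sm ?b (E.sm g x) = E.sm ?a x"
      using x by (simp add: E.sm_sm)
    moreover have "H (E.sm ?b (E.sm g x)) = G.sm ?b (H (E.sm g x))"
      by (rule Hs1) (use x pos in \<open>auto elim!: AE_mp\<close>)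
    moreover have "H (E.sm ?a x) = G.sm ?a (H x)"
      by (rule Hs1) (use x pos in \<open>auto elim!: AE_mp\<close>)
    ultimately have "G.sm ?c (G.sm ?b (H (E.sm g x))) = G.sm ?c (G.sm ?a (H x))" by simp
    then have e: "G.sm (\<lambda>\<omega>. ?c \<omega> * ?b \<omega>) (H (E.sm g x)) = G.sm (\<lambda>\<omega>. ?c \<omega> * ?a \<omega>) (H x)"
      using x Hc by (simp add: G.sm_sm)
    have "G.sm (\<lambda>\<omega>. ?c \<omega> * ?b \<omega>) (H (E.sm g x)) = G.sm (\<lambda>_. 1) (H (E.sm g x))"
      "G.sm (\<lambda>\<omega>. ?c \<omega> * ?a \<omega>) (H x) = G.sm g (H x)"
      using pos by (auto intro!: G.sm_cong elim!: AE_mp)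
    then show ?thesis using e x Hc by (simp add: G.sm_one)
  qed
  show add: "H (x \<oplus>\<^bsub>E\<^esub> y) = H x \<oplus>\<^bsub>G\<^esub> H y" if x: "x \<in> carrier E" "y \<in> carrier E" for x y
  proof -
    \<comment> \<open>A sum is twice the midpoint, and both the midpoint and the positive scalar 2
      are already respected.\<close>
    have E2: "E.sm (\<lambda>_. 2) (E.cv (\<lambda>_. 1/2) x y) = x \<oplus>\<^bsub>E\<^esub> y"
      using x by (simp add: E.cv_def E.sm_add_right E.sm_sm E.sm_one)
    have G2: "G.sm (\<lambda>_. 2) (G.cv (\<lambda>_. 1/2) u v) = u \<oplus>\<^bsub>G\<^esub> v" if "u \<in> carrier G" "v \<in> carrier G" for u v
      using that by (simp add: G.cv_def G.sm_add_right G.sm_sm G.sm_one)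
    have "H (E.sm (\<lambda>_. 2) (E.cv (\<lambda>_. 1/2) x y)) = G.sm (\<lambda>_. 2) (G.cv (\<lambda>_. 1/2) (H x) (H y))"
      using x Hcv[of x y "\<lambda>_. 1/2"] by (simp add: Hs2)
    then show ?thesis unfolding E2 using G2 x Hc by simp
  qed
  show "H (E.sm g x) = G.sm g (H x)" if x: "x \<in> carrier E" and g [measurable]: "g \<in> borel_measurable M" for x g
  proof -
    \<comment> \<open>Writes g as a difference of two scalars that are positive everywhere, so that
      additivity reduces it to the positive case.\<close>
    let ?a = "\<lambda>\<omega>. \<bar>g \<omega>\<bar> + 1 - g \<omega>" and ?b = "\<lambda>\<omega>. \<bar>g \<omega>\<bar> + 1"
    have eq: "(\<lambda>\<omega>. g \<omega> + ?a \<omega>) = ?b" by auto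
    have "H (E.sm g x) \<oplus>\<^bsub>G\<^esub> G.sm ?a (H x) = H (E.sm g x \<oplus>\<^bsub>E\<^esub> E.sm ?a x)"
    proof -
      have "H (E.sm ?a x) = G.sm ?a (H x)" by (rule Hs2) (use x in auto)
      then show ?thesis using x by (simp add: add)
    qed
    also have "\<dots> = H (E.sm ?b x)"
      using E.sm_add_left[of g ?a x] x unfolding eq by simp
    also have "\<dots> = G.sm ?b (H x)" by (rule Hs2) (use x in auto)
    also have "\<dots> = G.sm g (H x) \<oplus>\<^bsub>G\<^esub> G.sm ?a (H x)"
      using G.sm_add_left[of g ?a "H x"] x Hc unfolding eq by simp
    finally show ?thesis using x Hc by simp
  qed
qed

section \<open>Finite convex functions are locally bounded in probability\<close>

lemma (in prob_space) prob_gt_small: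
  fixes f :: "'a \<Rightarrow> real"
  assumes [measurable]: "f \<in> borel_measurable M" and "0 < \<delta>"
  obtains k :: nat where "prob {\<omega> \<in> space M. real k < f \<omega>} < \<delta>"
proof -
  have "(\<lambda>n. prob {\<omega> \<in> space M. f \<omega> \<le> real n}) \<longlonglongrightarrow> 1"
  proof (rule prob_tendsto_1_AE)
    show "AE \<omega> in M. \<forall>\<^sub>F n in sequentially. \<omega> \<in> {\<omega> \<in> space M. f \<omega> \<le> real n}"
    proof (rule AE_I2)
      fix \<omega> assume "\<omega> \<in> space M"
      moreover obtain k where "f \<omega> \<le> real k" using real_arch_simple by blast
      ultimately show "\<forall>\<^sub>F n in sequentially. \<omega> \<in> {\<omega> \<in> space M. f \<omega> \<le> real n}"
        by (auto intro!: eventually_sequentiallyI[of k])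
    qed
  qed simp
  then have "eventually (\<lambda>n. 1 - \<delta> < prob {\<omega> \<in> space M. f \<omega> \<le> real n}) sequentially"
    by (rule order_tendstoD) (use \<open>0 < \<delta>\<close> in simp)
  then obtain k where k: "1 - \<delta> < prob {\<omega> \<in> space M. f \<omega> \<le> real k}"
    by (auto simp: eventually_sequentially)
  have "{\<omega> \<in> space M. real k < f \<omega>} = space M - {\<omega> \<in> space M. f \<omega> \<le> real k}" by auto
  then have "prob {\<omega> \<in> space M. real k < f \<omega>} = 1 - prob {\<omega> \<in> space M. f \<omega> \<le> real k}"
    by (simp add: prob_compl)
  with k have "prob {\<omega> \<in> space M. real k < f \<omega>} < \<delta>" by simp
  then show ?thesis by (rule that)
qed

context rn_module
begin

text \<open>With one parameter for size and probability these are the balls of the Ky Fan metric,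
  used without the metric itself: radii add in \<open>kball_triangle\<close>.\<close>

abbreviation kball :: "'e \<Rightarrow> real \<Rightarrow> 'e set" where
  "kball x \<epsilon> \<equiv> rn_ball M E x \<epsilon> \<epsilon>"

lemma kball_iff:
  assumes "x \<in> carrier E"
  shows "y \<in> kball x \<epsilon> \<longleftrightarrow> y \<in> carrier E \<and> prob {\<omega> \<in> space M. \<epsilon> \<le> N (y \<ominus> x) \<omega>} < \<epsilon>"
proof (cases "y \<in> carrier E")
  case True
  have [measurable]: "N (y \<ominus> x) \<in> borel_measurable M" using True assms by (intro N_meas) simp
  have "{\<omega> \<in> space M. \<epsilon> \<le> N (y \<ominus> x) \<omega>} = space M - {\<omega> \<in> space M. N (y \<ominus> x) \<omega> < \<epsilon>}" by auto
  then have "prob {\<omega> \<in> space M. \<epsilon> \<le> N (y \<ominus> x) \<omega>} = 1 - prob {\<omega> \<in> space M. N (y \<ominus> x) \<omega> < \<epsilon>}"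
    by (simp add: prob_compl)
  then show ?thesis by (auto simp: rn_ball_iff[OF assms])
qed (simp add: rn_ball_iff[OF assms])

lemma kball_sym:
  assumes x: "x \<in> carrier E" "y \<in> carrier E"
  shows "y \<in> kball x \<epsilon> \<longleftrightarrow> x \<in> kball y \<epsilon>"
proof -
  have [measurable]: "N (y \<ominus> x) \<in> borel_measurable M" "N (x \<ominus> y) \<in> borel_measurable M"
    using x by (auto intro!: N_meas)
  have "prob {\<omega> \<in> space M. \<epsilon> \<le> N (y \<ominus> x) \<omega>} = prob {\<omega> \<in> space M. \<epsilon> \<le> N (x \<ominus> y) \<omega>}"
    by (rule finite_measure_eq_AE) (use N_minus_commute[OF x] in \<open>auto elim!: AE_mp\<close>)
  then show ?thesis using x by (simp add: kball_iff)
qed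

lemma kball_triangle:
  assumes x: "x \<in> carrier E" and y: "y \<in> kball x a" and z: "z \<in> kball y b"
  shows "z \<in> kball x (a + b)"
proof -
  have yc: "y \<in> carrier E" using y by (simp add: kball_iff[OF x])
  then have zc: "z \<in> carrier E" using z by (simp add: kball_iff)
  have [measurable]: "N (y \<ominus> x) \<in> borel_measurable M" "N (z \<ominus> y) \<in> borel_measurable M"
    "N (z \<ominus> x) \<in> borel_measurable M"
    using x yc zc by (auto intro!: N_meas)
  have "prob {\<omega> \<in> space M. a + b \<le> N (z \<ominus> x) \<omega>} \<le>
      prob ({\<omega> \<in> space M. a \<le> N (y \<ominus> x) \<omega>} \<union> {\<omega> \<in> space M. b \<le> N (z \<ominus> y) \<omega>})"
  proof (rule finite_measure_mono_AE)
    show "AE \<omega> in M. \<omega> \<in> {\<omega> \<in> space M. a + b \<le> N (z \<ominus> x) \<omega>} \<longrightarrow>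
        \<omega> \<in> {\<omega> \<in> space M. a \<le> N (y \<ominus> x) \<omega>} \<union> {\<omega> \<in> space M. b \<le> N (z \<ominus> y) \<omega>}"
      using N_triangle_minus[OF zc yc x] by eventually_elim auto
  qed measurable
  also have "\<dots> \<le> prob {\<omega> \<in> space M. a \<le> N (y \<ominus> x) \<omega>} + prob {\<omega> \<in> space M. b \<le> N (z \<ominus> y) \<omega>}"
    by (rule measure_Un_le) measurable
  also have "\<dots> < a + b" using y z by (simp add: kball_iff x yc)
  finally show ?thesis using zc by (simp add: kball_iff x)
qed

lemma kball_center:
  assumes x: "x \<in> carrier E" and "0 < \<epsilon>"
  shows "x \<in> kball x \<epsilon>"
proof -
  have [measurable]: "N (x \<ominus> x) \<in> borel_measurable M" using x by (intro N_meas) simp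
  have "prob {\<omega> \<in> space M. \<epsilon> \<le> N (x \<ominus> x) \<omega>} = prob {}"
    by (rule finite_measure_eq_AE) (use N_minus_self[OF x] \<open>0 < \<epsilon>\<close> in \<open>auto elim!: AE_mp\<close>)
  then show ?thesis using assms by (simp add: kball_iff)
qed

lemma kball_mono: "x \<in> carrier E \<Longrightarrow> a \<le> b \<Longrightarrow> y \<in> kball x a \<Longrightarrow> y \<in> kball x b"
  using rn_ball_mono[of x a b a b] by auto

text \<open>The limit cannot be closer to x in probability than the sequence is: a strict inequality
  at the limit holds almost surely for all late terms too.\<close>

lemma kball_open:
  assumes x: "x \<in> carrier E"
  shows "openin (rn_topology M E) (kball x \<epsilon>)"
proof -
  have "closedin (rn_topology M E) (carrier E - kball x \<epsilon>)"
    unfolding closedin_rn_topology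
  proof (intro conjI allI impI)
    fix X y assume X: "range X \<subseteq> carrier E - kball x \<epsilon>" and conv: "as_conv X y"
    have c: "X n \<in> carrier E" "y \<in> carrier E" for n using conv by (auto simp: as_conv_def)
    note [measurable] = N_meas[OF minus_closed[OF c(1) x]] N_meas[OF minus_closed[OF c(2) x]]
    \<comment> \<open>The implication holds for all late n almost surely, so the probabilities tend
      to 1, while each exceeds \<open>prob {\<omega> \<in> space M. \<epsilon> \<le> N (y \<ominus>
      x) \<omega>}\<close> by at most 1 - \<epsilon>.\<close>
    let ?A = "\<lambda>n. {\<omega> \<in> space M. N (y \<ominus> x) \<omega> < \<epsilon> \<longrightarrow> N (X n \<ominus> x) \<omega> < \<epsilon>}"
    have "(\<lambda>n. prob (?A n)) \<longlonglongrightarrow> 1"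
    proof (rule prob_tendsto_1_AE)
      show "AE \<omega> in M. \<forall>\<^sub>F n in sequentially. \<omega> \<in> ?A n"
        using as_conv_N[OF conv x] AE_space
      proof eventually_elim
        case (elim \<omega>)
        show ?case
        proof (cases "N (y \<ominus> x) \<omega> < \<epsilon>")
          case True
          from order_tendstoD(2)[OF elim(1) this] show ?thesis
            by eventually_elim (use elim in simp)
        qed (use elim in simp)
      qed
    qed measurable
    then have lim: "(\<lambda>n. prob (?A n) - prob {\<omega> \<in> space M. \<epsilon> \<le> N (y \<ominus> x) \<omega>}) \<longlonglongrightarrow>
        1 - prob {\<omega> \<in> space M. \<epsilon> \<le> N (y \<ominus> x) \<omega>}"
      by (intro tendsto_intros)
    have "prob (?A n) - prob {\<omega> \<in> space M. \<epsilon> \<le> N (y \<ominus> x) \<omega>} \<le> 1 - \<epsilon>" for n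
    proof -
      have "prob (?A n) \<le> prob ({\<omega> \<in> space M. \<epsilon> \<le> N (y \<ominus> x) \<omega>} \<union> {\<omega> \<in> space M. N (X n \<ominus> x) \<omega> < \<epsilon>})"
        by (rule finite_measure_mono) auto
      also have "\<dots> \<le> prob {\<omega> \<in> space M. \<epsilon> \<le> N (y \<ominus> x) \<omega>} + prob {\<omega> \<in> space M. N (X n \<ominus> x) \<omega> < \<epsilon>}"
        by (rule measure_Un_le) measurable
      also have "prob {\<omega> \<in> space M. N (X n \<ominus> x) \<omega> < \<epsilon>} \<le> 1 - \<epsilon>"
        using subsetD[OF X rangeI[of X n]] c(1)[of n] by (simp add: rn_ball_iff[OF x])
      finally show ?thesis by simp
    qed
    then have "1 - prob {\<omega> \<in> space M. \<epsilon> \<le> N (y \<ominus> x) \<omega>} \<le> 1 - \<epsilon>"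
      by (intro LIMSEQ_le_const2[OF lim]) blast
    then show "y \<in> carrier E - kball x \<epsilon>" using c by (simp add: kball_iff[OF x])
  qed auto
  moreover have "kball x \<epsilon> \<subseteq> carrier E" by (auto simp: rn_ball_def)
  ultimately show ?thesis
    by (metis Diff_Diff_Int inf.absorb_iff2 openin_diff openin_topspace topspace_rn_topology)
qed

lemma complete_limit:
  assumes "rn_complete M E" and X: "\<And>n. X n \<in> carrier E"
    and C: "\<And>\<epsilon>. 0 < \<epsilon> \<Longrightarrow> \<exists>K. \<forall>m\<ge>K. \<forall>n\<ge>K. X m \<in> kball (X n) \<epsilon>"
  obtains x where "x \<in> carrier E" "\<forall>\<epsilon>>0. eventually (\<lambda>n. X n \<in> kball x \<epsilon>) sequentially"
proof -
  have "rn_Cauchy M E X"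
    unfolding rn_Cauchy_def
  proof (intro conjI allI impI)
    fix \<epsilon> \<delta> :: real assume "0 < \<epsilon>" "0 < \<delta>"
    then obtain K where "\<forall>m\<ge>K. \<forall>n\<ge>K. X m \<in> kball (X n) (min \<epsilon> \<delta>)" using C[of "min \<epsilon> \<delta>"] by auto
    then show "\<exists>K. \<forall>m\<ge>K. \<forall>n\<ge>K. X m \<in> rn_ball M E (X n) \<epsilon> \<delta>"
      using rn_ball_mono[OF X, of "min \<epsilon> \<delta>" \<epsilon> "min \<epsilon> \<delta>" \<delta>] by (meson min.cobounded1 min.cobounded2 subsetD)
  qed (use X in auto)
  then obtain x where x: "limitin (rn_topology M E) X x sequentially"
    using assms(1) unfolding rn_complete_def by blast
  then have c: "x \<in> carrier E" by (simp add: limitin_def topspace_rn_topology)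
  show ?thesis
  proof (rule that[OF c], intro allI impI)
    fix \<epsilon> :: real assume "0 < \<epsilon>"
    then show "eventually (\<lambda>n. X n \<in> kball x \<epsilon>) sequentially"
      using x kball_open[OF c] kball_center[OF c] by (auto simp: limitin_def)
  qed
qed

text \<open>On the limsup \<open>A\<close> of the sets where \<open>f (X n) \<le> k\<close>, paste the \<open>X m\<close>, \<open>m \<ge> n\<close>, along their
  sets; the pasted points still converge and their values are eventually at most \<open>k\<close> on \<open>A\<close>.\<close>

lemma sublevel_prob_closed:
  assumes f: "f \<in> Cvx M E" and fin: "\<And>x. x \<in> carrier E \<Longrightarrow> AE \<omega> in M. rp (f x) \<omega> = ereal (Q x \<omega>)"
    and Q: "\<And>x. x \<in> carrier E \<Longrightarrow> Q x \<in> borel_measurable M"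
    and X: "as_conv X x" and le: "\<And>n. prob {\<omega> \<in> space M. k < Q (X n) \<omega>} \<le> \<delta>"
  shows "prob {\<omega> \<in> space M. k < Q x \<omega>} \<le> \<delta>"
proof -
  have c: "X n \<in> carrier E" "x \<in> carrier E" for n using X by (auto simp: as_conv_def)
  note [measurable] = Q[OF c(1)] Q[OF c(2)]
  define B where "B n = {\<omega> \<in> space M. Q (X n) \<omega> \<le> k}" for n
  have B [measurable]: "B n \<in> events" for n unfolding B_def by measurable
  have pB: "1 - \<delta> \<le> prob (B n)" for n
  proof -
    have "{\<omega> \<in> space M. k < Q (X n) \<omega>} = space M - B n" by (auto simp: B_def)
    then show ?thesis using le[of n] by (simp add: prob_compl)
  qed
  define U where "U n = (\<Union>m\<in>{n..}. B m)" for n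
  have U [measurable]: "U n \<in> events" for n unfolding U_def by measurable
  define A where "A = (\<Inter>n. U n)"
  have A [measurable]: "A \<in> events" unfolding A_def by measurable
  have "1 - \<delta> \<le> prob A"
  proof (rule LIMSEQ_le_const)
    have "decseq U" unfolding U_def by (rule antimonoI, rule UN_mono) auto
    then show "(\<lambda>n. prob (U n)) \<longlonglongrightarrow> prob A"
      unfolding A_def by (intro finite_Lim_measure_decseq) auto
    have "prob (B n) \<le> prob (U n)" for n by (rule finite_measure_mono) (auto simp: U_def)
    then show "\<exists>N. \<forall>n\<ge>N. 1 - \<delta> \<le> prob (U n)" using pB order_trans by blast
  qed
  define C where "C n j = (\<Union>m\<in>{n..n+j}. B m)" for n j
  have C [measurable]: "C n j \<in> events" for n j unfolding C_def by measurable
  have CU: "C n j \<subseteq> U n" for n j by (auto simp: C_def U_def)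
  \<comment> \<open>Only finitely many points can be pasted at a time; the finite union up to n + j
    misses a part of \<open>U n\<close> whose probability is summable in n.\<close>
  have "\<exists>j. prob (U n - C n j) \<le> (1/2) ^ n" for n
  proof -
    have "incseq (C n)" unfolding C_def by (rule monoI, rule UN_mono) auto
    moreover have "(\<Union>j. C n j) = U n"
      unfolding C_def U_def by (auto, metis atLeastAtMost_iff le_Suc_ex order_refl)
    ultimately have "(\<lambda>j. prob (C n j)) \<longlonglongrightarrow> prob (U n)"
      using finite_Lim_measure_incseq[of "C n"] C by (simp add: image_subset_iff)
    then have "eventually (\<lambda>j. prob (U n) - (1/2) ^ n < prob (C n j)) sequentially"
      by (rule order_tendstoD) simp
    then obtain j where "prob (U n) - (1/2) ^ n < prob (C n j)" by (auto simp: eventually_sequentially)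
    moreover have "prob (U n - C n j) = prob (U n) - prob (C n j)"
      using CU by (intro finite_measure_Diff) auto
    ultimately show ?thesis by (intro exI[of _ j]) simp
  qed
  then obtain j where j: "\<And>n. prob (U n - C n (j n)) \<le> (1/2) ^ n" by metis
  \<comment> \<open>Start from x and paste in \<open>X n\<close>, \<open>X (n + 1)\<close> and so
    on, each on its own event; later indices overwrite earlier ones, and outside all events x
    remains.\<close>
  define Z where "Z n = rec_nat (cmb (B n) (X n) x) (\<lambda>i z. cmb (B (n + Suc i)) (X (n + Suc i)) z)" for n
  have Z0: "Z n 0 = cmb (B n) (X n) x" and ZS: "Z n (Suc i) = cmb (B (n + Suc i)) (X (n + Suc i)) (Z n i)" for n i
    by (simp_all add: Z_def)
  have im [measurable]: "indicat_real (B n) \<in> borel_measurable M" for n by simp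
  have Zc: "Z n i \<in> carrier E" for n i by (induction i) (use c in \<open>simp_all add: Z0 ZS\<close>)
  have local: "AE \<omega> in M. N (u \<ominus> v) \<omega> = 0 \<longrightarrow> Q u \<omega> = Q v \<omega>" if "u \<in> carrier E" "v \<in> carrier E" for u v
    using Cvx_local[OF f that] fin[OF that(1)] fin[OF that(2)] by eventually_elim simp
  \<comment> \<open>The last conjunct makes the pasted points converge: at each
    \<open>\<omega>\<close> their distance to x is that of some late \<open>X m\<close>, or zero.
    The absolute value lets the bound cover the case zero without a separate sign condition.\<close>
  have Zp: "AE \<omega> in M. (\<omega> \<in> C n i \<longrightarrow> Q (Z n i) \<omega> \<le> k) \<and> (\<omega> \<notin> C n i \<longrightarrow> N (Z n i \<ominus> x) \<omega> = 0) \<and>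
      (\<exists>m\<ge>n. N (Z n i \<ominus> x) \<omega> \<le> \<bar>N (X m \<ominus> x) \<omega>\<bar>)" for n i
  proof (induction i)
    case 0
    show ?case
      using N_cmb_minus[OF B c(1) c(2) c(1), of n n n] N_cmb_minus[OF B c(1) c(2) c(2), of n n] N_minus_self[OF c(1), of n]
        N_minus_self[OF c(2)] local[OF Zc[of n 0] c(1)[of n]]
      unfolding Z0[symmetric]
    proof eventually_elim
      case (elim \<omega>)
      then show ?case by (cases "\<omega> \<in> B n") (auto simp: C_def B_def)
    qed
  next
    case (Suc i)
    let ?m = "n + Suc i"
    have CS: "C n (Suc i) = B ?m \<union> C n i" by (auto simp: C_def atLeastAtMostSuc_conv)
    show ?case
      using N_cmb_minus[OF B[of ?m] c(1)[of ?m] Zc[of n i] c(1)[of ?m]]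
        N_cmb_minus[OF B[of ?m] c(1)[of ?m] Zc[of n i] Zc[of n i]]
        N_cmb_minus[OF B[of ?m] c(1)[of ?m] Zc[of n i] c(2)] N_minus_self[OF c(1), of ?m] N_minus_self[OF Zc[of n i]]
        local[OF Zc[of n "Suc i"] c(1)[of ?m]] local[OF Zc[of n "Suc i"] Zc[of n i]] Suc
      unfolding ZS[symmetric]
    proof eventually_elim
      case (elim \<omega>)
      show ?case
      proof (cases "\<omega> \<in> B ?m")
        case True
        then have "N (Z n (Suc i) \<ominus> x) \<omega> \<le> \<bar>N (X ?m \<ominus> x) \<omega>\<bar>" using elim by simp
        then have "\<exists>m\<ge>n. N (Z n (Suc i) \<ominus> x) \<omega> \<le> \<bar>N (X m \<ominus> x) \<omega>\<bar>" by (intro exI[of _ ?m]) simp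
        moreover have "Q (Z n (Suc i)) \<omega> \<le> k" using True elim by (simp add: B_def)
        ultimately show ?thesis using True unfolding CS by blast
      next
        case False
        then show ?thesis using elim unfolding CS by simp
      qed
    qed
  qed
  define Y where "Y n = Z n (j n)" for n
  have Yc: "Y n \<in> carrier E" for n using Zc by (simp add: Y_def)
  note [measurable] = Q[OF Yc]
  have Yp: "AE \<omega> in M. \<forall>n. (\<omega> \<in> C n (j n) \<longrightarrow> Q (Y n) \<omega> \<le> k) \<and> (\<omega> \<notin> C n (j n) \<longrightarrow> N (Y n \<ominus> x) \<omega> = 0) \<and>
      (\<exists>m\<ge>n. N (Y n \<ominus> x) \<omega> \<le> \<bar>N (X m \<ominus> x) \<omega>\<bar>)"
    unfolding Y_def by (intro AE_allI Zp)
  have Y: "as_conv Y x"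
  proof -
    have "AE \<omega> in M. \<forall>n. 0 \<le> N (Y n \<ominus> x) \<omega>" using Yc c by (intro AE_allI N_nonneg) simp
    moreover have "AE \<omega> in M. (\<lambda>n. N (X n \<ominus> x) \<omega>) \<longlonglongrightarrow> 0" using X by (simp add: as_conv_def)
    ultimately have "AE \<omega> in M. (\<lambda>n. N (Y n \<ominus> x) \<omega>) \<longlonglongrightarrow> 0"
      using Yp
    proof eventually_elim
      case (elim \<omega>)
      show ?case
      proof (rule LIMSEQ_I)
        fix e :: real assume "0 < e"
        then obtain K where K: "\<And>n. K \<le> n \<Longrightarrow> \<bar>N (X n \<ominus> x) \<omega>\<bar> < e"
          using LIMSEQ_D[OF elim(2)] by fastforce
        have "norm (N (Y n \<ominus> x) \<omega> - 0) < e" if n: "K \<le> n" for n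
        proof -
          obtain m where "n \<le> m" "N (Y n \<ominus> x) \<omega> \<le> \<bar>N (X m \<ominus> x) \<omega>\<bar>" using elim(3) by blast
          then show ?thesis using K[of m] n elim(1)[rule_format, of n] by simp
        qed
        then show "\<exists>K. \<forall>n\<ge>K. norm (N (Y n \<ominus> x) \<omega> - 0) < e" by blast
      qed
    qed
    then show ?thesis using Yc c by (auto simp: as_conv_def)
  qed
  \<comment> \<open>Outside \<open>C n (j n)\<close> any finite upper bound for
    \<open>Q (Y n)\<close> will do: by Borel-Cantelli almost every point of A lies in
    \<open>C n (j n)\<close> for all late n, so the bounds converge to k.\<close>
  have "AE \<omega> in M. \<omega> \<in> A \<longrightarrow> rp (f x) \<omega> \<le> ereal k"
  proof (rule Cvx_closed_on[OF f Y A, where R = "\<lambda>n \<omega>. if \<omega> \<in> C n (j n) then k else max k (Q (Y n) \<omega>)"])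
    show "(\<lambda>\<omega>. if \<omega> \<in> C n (j n) then k else max k (Q (Y n) \<omega>)) \<in> borel_measurable M" for n
      by measurable
    show "AE \<omega> in M. \<omega> \<in> A \<longrightarrow> rp (f (Y n)) \<omega> \<le> ereal (if \<omega> \<in> C n (j n) then k else max k (Q (Y n) \<omega>))" for n
      using Yp fin[OF Yc[of n]] by eventually_elim simp
    have "AE \<omega> in M. eventually (\<lambda>n. \<omega> \<in> space M - (U n - C n (j n))) sequentially"
    proof (rule borel_cantelli_AE1)
      have "summable (\<lambda>n. (1/2::real) ^ n)" by (simp add: summable_geometric)
      then show "summable (\<lambda>n. prob (U n - C n (j n)))"
        by (rule summable_comparison_test') (use j in auto)
    qed (simp_all add: emeasure_eq_measure)
    then show "AE \<omega> in M. \<omega> \<in> A \<longrightarrow> (\<lambda>n. if \<omega> \<in> C n (j n) then k else max k (Q (Y n) \<omega>)) \<longlonglongrightarrow> k"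
    proof eventually_elim
      case (elim \<omega>)
      show ?case
      proof
        assume "\<omega> \<in> A"
        then show "(\<lambda>n. if \<omega> \<in> C n (j n) then k else max k (Q (Y n) \<omega>)) \<longlonglongrightarrow> k"
          by (intro tendsto_eventually eventually_mono[OF elim]) (auto simp: A_def)
      qed
    qed
  qed simp
  then have "AE \<omega> in M. \<omega> \<in> A \<longrightarrow> Q x \<omega> \<le> k" using fin[OF c(2)] by eventually_elim simp
  then have "prob {\<omega> \<in> space M. k < Q x \<omega>} \<le> prob (space M - A)"
    by (intro finite_measure_mono_AE) (auto elim!: AE_mp)
  also have "\<dots> \<le> \<delta>" using \<open>1 - \<delta> \<le> prob A\<close> by (simp add: prob_compl)
  finally show ?thesis .
qed

text \<open>The Baire category argument, carried out with nested balls instead of a complete metric.\<close>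

lemma locally_bounded_in_prob:
  assumes compl: "rn_complete M E" and f: "f \<in> Cvx M E"
    and fin: "\<And>x. x \<in> carrier E \<Longrightarrow> AE \<omega> in M. rp (f x) \<omega> = ereal (Q x \<omega>)"
    and Q: "\<And>x. x \<in> carrier E \<Longrightarrow> Q x \<in> borel_measurable M" and \<delta>: "0 < \<delta>"
  obtains x0 \<epsilon> k where "x0 \<in> carrier E" "0 < \<epsilon>"
    "\<And>x. x \<in> kball x0 \<epsilon> \<Longrightarrow> prob {\<omega> \<in> space M. real k < Q x \<omega>} \<le> \<delta>"
proof (rule ccontr)
  assume "\<not> thesis"
  with that have no: "\<exists>x\<in>kball x0 \<epsilon>. \<delta> < prob {\<omega> \<in> space M. real k < Q x \<omega>}"
    if "x0 \<in> carrier E" "0 < \<epsilon>" for x0 \<epsilon> and k :: nat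
    using that by (meson not_le)
  \<comment> \<open>By \<open>sublevel_prob_closed\<close> the set where the probability exceeds
    \<delta> is open, so a bad point has a bad ball around it.\<close>
  have nbhd: "\<exists>s>0. \<forall>y\<in>kball x s. \<delta> < prob {\<omega> \<in> space M. k < Q y \<omega>}"
    if x: "x \<in> carrier E" "\<delta> < prob {\<omega> \<in> space M. k < Q x \<omega>}" for x k
  proof -
    let ?V = "{y \<in> carrier E. prob {\<omega> \<in> space M. k < Q y \<omega>} \<le> \<delta>}"
    have "closedin (rn_topology M E) ?V"
      unfolding closedin_rn_topology
    proof (intro conjI allI impI)
      fix X y assume "range X \<subseteq> ?V" "as_conv X y"
      then show "y \<in> ?V" using sublevel_prob_closed[OF f fin Q, of X y k \<delta>] by (auto simp: as_conv_def)
    qed auto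
    then have "openin (rn_topology M E) (carrier E - ?V)" by (simp add: closedin_def topspace_rn_topology)
    moreover have "x \<in> carrier E - ?V" using x by simp
    ultimately obtain \<epsilon> \<eta> where e: "0 < \<epsilon>" "0 < \<eta>" "rn_ball M E x \<epsilon> \<eta> \<subseteq> carrier E - ?V"
      unfolding openin_rn_topology by meson
    have "kball x (min \<epsilon> \<eta>) \<subseteq> rn_ball M E x \<epsilon> \<eta>" by (rule rn_ball_mono[OF x(1)]) auto
    then show ?thesis using e by (intro exI[of _ "min \<epsilon> \<eta>"]) force
  qed
  \<comment> \<open>Pairs of centre and radius of a ball on which the level n is exceeded with
    probability more than \<delta>.\<close>
  define ok where "ok n p \<longleftrightarrow> fst p \<in> carrier E \<and> 0 < snd p \<and> snd p \<le> (1/4) ^ n \<and>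
      (\<forall>y\<in>kball (fst p) (snd p). \<delta> < prob {\<omega> \<in> space M. real n < Q y \<omega>})" for n and p :: "'e \<times> real"
  have step: "\<exists>p. ok n p \<and> fst p \<in> kball x (r / 4) \<and> snd p \<le> r / 4" if x: "x \<in> carrier E" "0 < r" for n x r
  proof -
    obtain y where y: "y \<in> kball x (r / 4)" "\<delta> < prob {\<omega> \<in> space M. real n < Q y \<omega>}"
      using no[of x "r / 4" n] x by auto
    then have yc: "y \<in> carrier E" by (simp add: kball_iff x)
    obtain s where s: "0 < s" "\<forall>z\<in>kball y s. \<delta> < prob {\<omega> \<in> space M. real n < Q z \<omega>}"
      using nbhd[OF yc y(2)] by blast
    \<comment> \<open>The radius has three tasks: to stay inside the bad ball, to be at most a
      quarter of the previous one so that the displacements sum up, and to tend to zero so that the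
      centres are Cauchy.\<close>
    define s' where "s' = min s (min (r / 4) ((1/4) ^ n))"
    have "ok n (y, s')" using yc s x kball_mono[OF yc, of s' s] by (auto simp: ok_def s'_def)
    then show ?thesis using y(1) by (intro exI[of _ "(y, s')"]) (auto simp: s'_def)
  qed
  have "\<exists>p. ok 0 p" using step[of \<zero> 1 0] by auto
  moreover have "\<exists>q. ok (Suc n) q \<and> fst q \<in> kball (fst p) (snd p / 4) \<and> snd q \<le> snd p / 4" if "ok n p" for n p
    using step[of "fst p" "snd p" "Suc n"] that by (auto simp: ok_def)
  ultimately obtain p where p: "\<And>n. ok n (p n)"
    and ps: "\<And>n. fst (p (Suc n)) \<in> kball (fst (p n)) (snd (p n) / 4) \<and> snd (p (Suc n)) \<le> snd (p n) / 4"
    using dependent_nat_choice[of ok "\<lambda>n p q. fst q \<in> kball (fst p) (snd p / 4) \<and> snd q \<le> snd p / 4"] by metis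
  define X where "X n = fst (p n)" for n
  define r where "r n = snd (p n)" for n
  have Xc: "X n \<in> carrier E" and r0: "0 < r n" and r1: "r n \<le> (1/4) ^ n" for n
    using p[of n] by (auto simp: ok_def X_def r_def)
  have XS: "X (Suc n) \<in> kball (X n) (r n / 4)" "r (Suc n) \<le> r n / 4" for n
    using ps[of n] by (auto simp: X_def r_def)
  have tail: "X (n + i) \<in> kball (X n) (r n / 2)" for n i
  proof (induction i arbitrary: n)
    case 0
    show ?case using kball_center[OF Xc, of "r n / 2"] r0[of n] by simp
  next
    case (Suc i)
    \<comment> \<open>One step moves by a quarter of the radius and all later ones by half of the
      next radius, at most an eighth; the total stays below one half.\<close>
    have "X (Suc n + i) \<in> kball (X n) (r n / 4 + r (Suc n) / 2)"
      by (rule kball_triangle[OF Xc XS(1) Suc])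
    then show ?case
      using kball_mono[OF Xc, of "r n / 4 + r (Suc n) / 2" "r n / 2"] XS(2)[of n] r0[of n] by simp
  qed
  have Cau: "\<exists>K. \<forall>m\<ge>K. \<forall>n\<ge>K. X m \<in> kball (X n) \<epsilon>" if "0 < \<epsilon>" for \<epsilon>
  proof -
    obtain K where "(1/4::real) ^ K < \<epsilon>" using real_arch_pow_inv[of \<epsilon> "1/4"] \<open>0 < \<epsilon>\<close> by auto
    then have K: "r K \<le> \<epsilon>" using r1[of K] by simp
    have "X m \<in> kball (X n) \<epsilon>" if "K \<le> m" "K \<le> n" for m n
    proof -
      have "X m \<in> kball (X K) (r K / 2)" "X n \<in> kball (X K) (r K / 2)"
        using tail[of K "m - K"] tail[of K "n - K"] that by simp_all
      then have "X m \<in> kball (X n) (r K / 2 + r K / 2)"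
        using kball_triangle[OF Xc, of "X K" n "r K / 2"] kball_sym[OF Xc Xc] by blast
      then show ?thesis using kball_mono[OF Xc _, of _ \<epsilon>] K by simp
    qed
    then show ?thesis by blast
  qed
  obtain x where x: "x \<in> carrier E" and lim: "\<forall>\<epsilon>>0. eventually (\<lambda>n. X n \<in> kball x \<epsilon>) sequentially"
    by (rule complete_limit[where X = X, OF compl Xc Cau])
  \<comment> \<open>The centres stay within half the radius and the limit is within another half of
    a late centre, so x lies in every ball. But Q x is finite and exceeds a high level only with
    small probability.\<close>
  have "\<delta> < prob {\<omega> \<in> space M. real k < Q x \<omega>}" for k
  proof -
    obtain K where "\<forall>n\<ge>K. X n \<in> kball x (r k / 2)" using lim[rule_format, of "r k / 2"] r0[of k] by (auto simp: eventually_sequentially)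
    then have "X (k + K) \<in> kball x (r k / 2)" by simp
    then have "x \<in> kball (X (k + K)) (r k / 2)" using kball_sym[OF x Xc] by blast
    from kball_triangle[OF Xc tail this] have "x \<in> kball (X k) (r k)" by simp
    then show ?thesis using p[of k] by (simp add: ok_def X_def r_def)
  qed
  moreover obtain k :: nat where "prob {\<omega> \<in> space M. real k < Q x \<omega>} < \<delta>"
    by (rule prob_gt_small[OF Q[OF x] \<delta>])
  ultimately show False by (meson less_asym)
qed


section \<open>A nowhere vanishing element\<close>

text \<open>An exhaustion argument: the supremum s of the probabilities of the supports is attained
  by pasting and completeness. Off a maximal support every element vanishes, for otherwise pasting
  would enlarge it, so full support makes that support the whole space up to a null set.\<close>

lemma full_support_nonvanishing:
  assumes compl: "rn_complete M E" and full: "full_support M E"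
  shows "\<exists>e\<in>carrier E. AE \<omega> in M. 0 < N e \<omega>"
proof -
  define S where "S x = {\<omega> \<in> space M. 0 < N x \<omega>}" for x
  have S: "S x \<in> events" if "x \<in> carrier E" for x
    unfolding S_def using N_meas[OF that] by measurable
  define s where "s = (SUP x\<in>carrier E. prob (S x))"
  have bdd: "bdd_above ((\<lambda>x. prob (S x)) ` carrier E)" by (rule bdd_aboveI[of _ 1]) auto
  have le_s: "prob (S x) \<le> s" if "x \<in> carrier E" for x
    unfolding s_def by (rule cSUP_upper[OF that bdd])
  have "\<exists>y\<in>carrier E. s - (1/2) ^ n < prob (S y)" for n :: nat
    using less_cSUP_iff[OF _ bdd, of "s - (1/2) ^ n"] by (auto simp: s_def)
  then obtain y where y: "\<And>n::nat. y n \<in> carrier E" "\<And>n. s - (1/2) ^ n < prob (S (y n))" by metis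
  \<comment> \<open>Each step fills only the part where the current element vanishes, so values once
    nonzero are never changed.\<close>
  define e where "e = rec_nat (y 0) (\<lambda>n z. cmb (S z) z (y (Suc n)))"
  have e0: "e 0 = y 0" and eS: "e (Suc n) = cmb (S (e n)) (e n) (y (Suc n))" for n
    by (simp_all add: e_def)
  have ec: "e n \<in> carrier E" for n
    by (induction n) (use y S in \<open>simp_all add: e0 eS\<close>)
  note Se = S[OF ec]
  have Ne: "AE \<omega> in M. N (e (Suc n)) \<omega> = (if \<omega> \<in> S (e n) then N (e n) \<omega> else N (y (Suc n)) \<omega>)" for n
    unfolding eS by (rule N_cmb[OF Se ec y(1)])
  have pe: "s - (1/2) ^ n < prob (S (e n))" for n
  proof (cases n)
    case (Suc m)
    have "prob (S (y n)) \<le> prob (S (e n))"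
      unfolding Suc
      by (rule finite_measure_mono_AE[OF _ Se]) (use Ne[of m] in \<open>auto simp: S_def elim!: AE_mp\<close>)
    with y(2)[of n] show ?thesis by simp
  qed (use y(2)[of 0] in \<open>simp add: e0\<close>)
  have stab: "AE \<omega> in M. \<omega> \<in> S (e n) \<longrightarrow> N (e (n + i) \<ominus> e n) \<omega> = 0 \<and> \<omega> \<in> S (e (n + i))" for n i
  proof (induction i)
    case 0
    show ?case using N_minus_self[OF ec[of n]] by eventually_elim simp
  next
    case (Suc i)
    have "AE \<omega> in M. N (e (Suc (n + i)) \<ominus> e n) \<omega> =
        (if \<omega> \<in> S (e (n + i)) then N (e (n + i) \<ominus> e n) \<omega> else N (y (Suc (n + i)) \<ominus> e n) \<omega>)"
      unfolding eS by (rule N_cmb_minus[OF Se ec y(1) ec])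
    then show ?case using Suc Ne[of "n + i"] by eventually_elim (auto simp: S_def)
  qed
  \<comment> \<open>\<open>e n\<close> and \<open>e (n + i)\<close> differ only on the part of the
    support gained in between, whose probability is at most s - prob (S (e n)).\<close>
  have near: "prob {\<omega> \<in> space M. \<epsilon> \<le> N (e (n + i) \<ominus> e n) \<omega>} < (1/2) ^ n" if "0 < \<epsilon>" for \<epsilon> n i
  proof -
    have [measurable]: "N (e (n + i) \<ominus> e n) \<in> borel_measurable M" using ec by (intro N_meas) simp
    have nn: "AE \<omega> in M. 0 \<le> N (e (n + i)) \<omega>" "AE \<omega> in M. 0 \<le> N (e n) \<omega>" using ec by (auto intro: N_nonneg)
    have tri: "AE \<omega> in M. N (e (n + i) \<ominus> e n) \<omega> \<le> N (e (n + i)) \<omega> + N (e n) \<omega>"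
      using N_triangle_minus[OF ec zero_closed ec, of "n + i" n] N_minus_commute[OF zero_closed ec, of n]
        minus_zero_right[OF ec, of "n + i"] minus_zero_right[OF ec, of n] by (auto elim!: AE_mp)
    have "prob {\<omega> \<in> space M. \<epsilon> \<le> N (e (n + i) \<ominus> e n) \<omega>} \<le> prob (S (e (n + i)) - S (e n))"
    proof (rule finite_measure_mono_AE)
      show "AE \<omega> in M. \<omega> \<in> {\<omega> \<in> space M. \<epsilon> \<le> N (e (n + i) \<ominus> e n) \<omega>} \<longrightarrow> \<omega> \<in> S (e (n + i)) - S (e n)"
        using stab[of n i] tri nn by eventually_elim (use that in \<open>auto simp: S_def\<close>)
    qed (use Se in auto)
    also have "\<dots> \<le> prob (S (e (n + i)) \<union> S (e n)) - prob (S (e n))"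
    proof -
      have "prob (S (e (n + i)) - S (e n)) = prob ((S (e (n + i)) \<union> S (e n)) - S (e n))"
        by (rule arg_cong[where f = prob]) auto
      also have "\<dots> = prob (S (e (n + i)) \<union> S (e n)) - prob (S (e n))"
        by (rule finite_measure_Diff) (use Se in auto)
      finally show ?thesis by simp
    qed
    also have "prob (S (e (n + i)) \<union> S (e n)) \<le> prob (S (e (n + i)))"
      by (rule finite_measure_mono_AE[OF _ Se]) (use stab[of n i] in \<open>auto elim!: AE_mp\<close>)
    finally show ?thesis using le_s[OF ec, of "n + i"] pe[of n] by simp
  qed
  have Cau: "\<exists>K. \<forall>m\<ge>K. \<forall>n\<ge>K. e m \<in> kball (e n) \<epsilon>" if "0 < \<epsilon>" for \<epsilon>
  proof -
    obtain K where K: "(1/2::real) ^ K < \<epsilon>" using real_arch_pow_inv[of \<epsilon> "1/2"] \<open>0 < \<epsilon>\<close> by auto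
    have *: "e (n + i) \<in> kball (e n) \<epsilon>" if "K \<le> n" for n i
    proof -
      have "(1/2::real) ^ n \<le> (1/2) ^ K" using that by (intro power_decreasing) auto
      then have "prob {\<omega> \<in> space M. \<epsilon> \<le> N (e (n + i) \<ominus> e n) \<omega>} < \<epsilon>"
        using near[OF \<open>0 < \<epsilon>\<close>, of n i] K by linarith
      then show ?thesis using ec by (simp add: kball_iff)
    qed
    have "e m \<in> kball (e n) \<epsilon>" if "K \<le> m" "K \<le> n" for m n
      using *[of n "m - n"] *[of m "n - m"] that kball_sym[OF ec ec] by (cases "n \<le> m") simp_all
    then show ?thesis by blast
  qed
  obtain x where x: "x \<in> carrier E" and lim: "\<forall>\<epsilon>>0. eventually (\<lambda>n. e n \<in> kball x \<epsilon>) sequentially"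
    by (rule complete_limit[where X = e, OF compl ec Cau])
  have "\<exists>m\<ge>n. e m \<in> kball x ((1/2) ^ Suc n)" for n
    using lim[rule_format, of "(1/2) ^ Suc n"] by (auto simp: eventually_sequentially) (meson linear)
  then obtain \<kappa> where \<kappa>: "\<And>n. n \<le> \<kappa> n" "\<And>n. e (\<kappa> n) \<in> kball x ((1/2) ^ Suc n)" by metis
  have conv: "as_conv (e \<circ> \<kappa>) x" by (rule as_convI_ball[OF x]) (use \<kappa>(2) in simp)
  \<comment> \<open>On the support of \<open>e n\<close> all later terms coincide with
    \<open>e n\<close>, hence so does their limit along \<kappa>, and the norm stays positive
    there.\<close>
  have Sx: "AE \<omega> in M. \<omega> \<in> S (e n) \<longrightarrow> \<omega> \<in> S x" for n
  proof -
    have "AE \<omega> in M. \<forall>i. \<omega> \<in> S (e n) \<longrightarrow> N (e (n + i) \<ominus> e n) \<omega> = 0" 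
    proof (rule AE_allI)
      fix i
      show "AE \<omega> in M. \<omega> \<in> S (e n) \<longrightarrow> N (e (n + i) \<ominus> e n) \<omega> = 0"
        using stab[of n i] by eventually_elim simp
    qed
    moreover have "AE \<omega> in M. (\<lambda>i. N ((e \<circ> \<kappa>) i \<ominus> e n) \<omega>) \<longlonglongrightarrow> N (x \<ominus> e n) \<omega>"
      by (rule as_conv_N[OF conv ec])
    moreover have "AE \<omega> in M. \<bar>N (x \<ominus> \<zero>) \<omega> - N (e n \<ominus> \<zero>) \<omega>\<bar> \<le> N (x \<ominus> e n) \<omega>"
      by (rule N_diff_le[OF x ec zero_closed])
    ultimately show ?thesis
      unfolding minus_zero_right[OF x] minus_zero_right[OF ec]
    proof eventually_elim
      case (elim \<omega>)
      show ?case
      proof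
        assume \<omega>: "\<omega> \<in> S (e n)"
        have "N (e (\<kappa> i) \<ominus> e n) \<omega> = 0" if "n \<le> i" for i
          using elim(1)[rule_format, OF \<omega>, of "\<kappa> i - n"] \<kappa>(1)[of i] that by simp
        then have "eventually (\<lambda>i. N ((e \<circ> \<kappa>) i \<ominus> e n) \<omega> = 0) sequentially"
          by (intro eventually_sequentiallyI[of n]) simp
        then have "(\<lambda>i. N ((e \<circ> \<kappa>) i \<ominus> e n) \<omega>) \<longlonglongrightarrow> 0" by (rule tendsto_eventually)
        then have "N (x \<ominus> e n) \<omega> = 0" using elim(2) LIMSEQ_unique by blast
        then show "\<omega> \<in> S x" using elim(3) \<omega> by (simp add: S_def)
      qed
    qed
  qed
  have px: "prob (S x) = s"
  proof (rule antisym[OF le_s[OF x]])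
    have "s - (1/2) ^ n \<le> prob (S x)" for n
      using pe[of n] finite_measure_mono_AE[OF Sx[of n] S[OF x]] by simp
    moreover have "(\<lambda>n. s - (1/2) ^ n) \<longlonglongrightarrow> s - 0"
      by (intro tendsto_intros LIMSEQ_realpow_zero) simp_all
    ultimately show "s \<le> prob (S x)"
      using LIMSEQ_le_const2[of "\<lambda>n. s - (1/2) ^ n" "s - 0" "prob (S x)"] by auto
  qed
  \<comment> \<open>Pasting z in where x vanishes yields an element whose support is the union of
    both supports; by maximality nothing is gained.\<close>
  have zero: "AE \<omega> in M. \<omega> \<notin> S x \<longrightarrow> N z \<omega> = 0" if z: "z \<in> carrier E" for z
  proof -
    have [measurable]: "indicat_real (S x) \<in> borel_measurable M" using S[OF x] by simp
    let ?u = "cmb (S x) x z"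
    have u: "?u \<in> carrier E" using x z by simp
    have "prob (S x \<union> S z) \<le> prob (S ?u)"
      by (rule finite_measure_mono_AE[OF _ S[OF u]])
        (use N_cmb[OF S[OF x] x z] in \<open>auto simp: S_def elim!: AE_mp\<close>)
    also have "\<dots> \<le> prob (S x)" unfolding px by (rule le_s[OF u])
    finally have "prob ((S x \<union> S z) - S x) \<le> 0"
      using S[OF x] S[OF z] by (subst finite_measure_Diff) auto
    then have "prob ((S x \<union> S z) - S x) = 0" by (simp add: measure_le_0_iff)
    then have "AE \<omega> in M. \<omega> \<notin> (S x \<union> S z) - S x"
      using S[OF x] S[OF z] by (subst (asm) prob_eq_0) auto
    then show ?thesis
      using N_nonneg[OF z] AE_space by eventually_elim (auto simp: S_def)
  qed
  let ?N = "(\<lambda>x. to_L0bar M (rnorm E x)) ` carrier E"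
  \<comment> \<open>The explicit supremum of all norms: zero off the maximal support because every
    element vanishes there, and infinite on it because the multiples n x have unbounded
    norm.\<close>
  define L where "L = rv_class M (\<lambda>\<omega>. if \<omega> \<in> S x then \<infinity> else 0 :: ereal)"
  have [measurable]: "S x \<in> events" by (rule S[OF x])
  have L: "L \<in> rv M" "AE \<omega> in M. rp L \<omega> = (if \<omega> \<in> S x then \<infinity> else 0)"
  proof -
    have m: "(\<lambda>\<omega>. if \<omega> \<in> S x then \<infinity> else 0 :: ereal) \<in> borel_measurable M" by measurable
    show "L \<in> rv M" "AE \<omega> in M. rp L \<omega> = (if \<omega> \<in> S x then \<infinity> else 0)"
      unfolding L_def using rv_class_in_rv[OF m] rp_rv_class[OF m] by blast+
  qed
  have Nr: "to_L0bar M (rnorm E z) \<in> rv M" "AE \<omega> in M. rp (to_L0bar M (rnorm E z)) \<omega> = ereal (N z \<omega>)"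
    if "z \<in> carrier E" for z
    using to_L0bar_rp[OF rnorm_rv[OF that]] by (simp_all add: N_def)
  have upper: "L \<in> Upper (L0bar M) ?N"
  proof -
    have "rv_le M (to_L0bar M (rnorm E z)) L" if z: "z \<in> carrier E" for z
      unfolding rv_le_iff[OF Nr(1)[OF z] L(1)]
      using Nr(2)[OF z] L(2) zero[OF z] by eventually_elim auto
    then show ?thesis using L Nr by (auto simp: Upper_def L0bar_def)
  qed
  have below: "rv_le M L b" if "b \<in> Upper (L0bar M) ?N" for b
  proof -
    have b: "b \<in> rv M" and bz: "\<And>z. z \<in> carrier E \<Longrightarrow> rv_le M (to_L0bar M (rnorm E z)) b"
      using that Nr(1) by (auto simp: Upper_def L0bar_def)
    have le: "AE \<omega> in M. ereal (N z \<omega>) \<le> rp b \<omega>" if z: "z \<in> carrier E" for z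
    proof -
      have "AE \<omega> in M. rp (to_L0bar M (rnorm E z)) \<omega> \<le> rp b \<omega>"
        using bz[OF z] unfolding rv_le_iff[OF Nr(1)[OF z] b] .
      then show ?thesis using Nr(2)[OF z] by eventually_elim simp
    qed
    have "AE \<omega> in M. ereal (real n * N x \<omega>) \<le> rp b \<omega>" for n :: nat
      using le[of "sm (\<lambda>_. real n) x"] N_sm[of "\<lambda>_. real n" x] x by (auto elim!: AE_mp)
    then have "AE \<omega> in M. \<forall>n::nat. ereal (real n * N x \<omega>) \<le> rp b \<omega>" by (intro AE_allI)
    then have "AE \<omega> in M. rp L \<omega> \<le> rp b \<omega>"
      using L(2)
    proof eventually_elim
      case (elim \<omega>)
      show ?case
      proof (cases "\<omega> \<in> S x")
        case True
        then have pos: "0 < N x \<omega>" by (simp add: S_def)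
        have "rp b \<omega> = \<infinity>"
        proof (cases "rp b \<omega>")
          case (real c)
          obtain n :: nat where "c < real n * N x \<omega>" using reals_Archimedean3[OF pos] by blast
          then show ?thesis using elim(1)[rule_format, of n] real by simp
        qed (use elim(1)[rule_format, of 0] in auto)
        then show ?thesis by simp
      qed (use elim elim(1)[rule_format, of 0] in \<open>simp add: zero_ereal_def\<close>)
    qed
    then show ?thesis using rv_le_iff[OF L(1) b] by blast
  qed
  \<comment> \<open>The supremum in the definition of full support is a choice among least upper
    bounds, so one has to be exhibited before anything is known about it.\<close>
  have "least (L0bar M) L (Upper (L0bar M) ?N)"
    using upper below L(1) by (auto simp: least_def L0bar_def Upper_def)
  then have "least (L0bar M) (\<Squnion>\<^bsub>L0bar M\<^esub> ?N) (Upper (L0bar M) ?N)"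
    unfolding sup_def by (rule someI)
  then have sup: "(\<Squnion>\<^bsub>L0bar M\<^esub> ?N) \<in> rv M" "rv_le M (\<Squnion>\<^bsub>L0bar M\<^esub> ?N) L"
    using upper by (auto simp: least_def Upper_def L0bar_def)
  have "AE \<omega> in M. rp (rv_const M (0::ereal)) \<omega> < rp (\<Squnion>\<^bsub>L0bar M\<^esub> ?N) \<omega>"
    using full unfolding full_support_def rv_less_iff[OF rv_const_rv sup(1)] .
  moreover have "AE \<omega> in M. rp (\<Squnion>\<^bsub>L0bar M\<^esub> ?N) \<omega> \<le> rp L \<omega>"
    using sup(2) unfolding rv_le_iff[OF sup(1) L(1)] .
  ultimately have "AE \<omega> in M. 0 < N x \<omega>"
    using L(2) rp_rv_const[of M "0::ereal"] by eventually_elim (auto simp: S_def split: if_splits)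
  with x show ?thesis by blast
qed

end

section \<open>Continuity of module homomorphisms\<close>

text \<open>One good index for each \<epsilon> suffices: the indices chosen for
  \<open>(1/2) ^ Suc i\<close> give images converging almost surely to \<open>h x\<close>, and they
  need not increase since only membership of the limit in a closed set is at stake.\<close>

lemma continuous_map_rnI:
  fixes M :: "'w measure" and E :: "('w, 'e) rn_module" and G :: "('w, 'f) rn_module"
  assumes "rn_module M E" "rn_module M G" and h: "\<And>x. x \<in> carrier E \<Longrightarrow> h x \<in> carrier G"
    and near: "\<And>X x \<epsilon>. rn_module.as_conv M E X x \<Longrightarrow> 0 < \<epsilon> \<Longrightarrow> \<exists>n. h (X n) \<in> rn_ball M G (h x) \<epsilon> \<epsilon>"
  shows "continuous_map (rn_topology M E) (rn_topology M G) h"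
proof -
  interpret E: rn_module M E by fact
  interpret G: rn_module M G by fact
  show ?thesis
    unfolding continuous_map_closedin E.topspace_rn_topology G.topspace_rn_topology
  proof (intro conjI allI impI)
    show "h \<in> carrier E \<rightarrow> carrier G" using h by blast
    fix C assume C: "closedin (rn_topology M G) C"
    show "closedin (rn_topology M E) {x \<in> carrier E. h x \<in> C}"
      unfolding E.closedin_rn_topology
    proof (intro conjI allI impI)
      fix X x assume X: "range X \<subseteq> {x \<in> carrier E. h x \<in> C}" and conv: "E.as_conv X x"
      have x: "x \<in> carrier E" using conv by (simp add: E.as_conv_def)
      have "\<exists>n. h (X n) \<in> rn_ball M G (h x) ((1/2) ^ Suc i) ((1/2) ^ Suc i)" for i
        by (rule near[OF conv]) simp
      then obtain \<kappa> where \<kappa>: "\<And>i. h (X (\<kappa> i)) \<in> rn_ball M G (h x) ((1/2) ^ Suc i) ((1/2) ^ Suc i)"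
        by metis
      have "G.as_conv (\<lambda>i. h (X (\<kappa> i))) (h x)" by (rule G.as_convI_ball[OF h[OF x] \<kappa>])
      moreover have "range (\<lambda>i. h (X (\<kappa> i))) \<subseteq> C" using X by auto
      ultimately have "h x \<in> C" using C G.closedin_rn_topology by blast
      then show "x \<in> {x \<in> carrier E. h x \<in> C}" using x by simp
    qed auto
  qed
qed

text \<open>Q is bounded in probability on a ball about x0, and \<open>bound\<close> passes this on
  to h near zero through the two points x0 + b and x0 - b. Homogeneity turns boundedness into
  smallness.\<close>

lemma hom_continuous:
  fixes M :: "'w measure" and E :: "('w, 'e) rn_module" and G :: "('w, 'f) rn_module"
  assumes E: "rn_module M E" and G: "rn_module M G" and h: "\<And>x. x \<in> carrier E \<Longrightarrow> h x \<in> carrier G"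
    and add: "\<And>x y. x \<in> carrier E \<Longrightarrow> y \<in> carrier E \<Longrightarrow> h (x \<oplus>\<^bsub>E\<^esub> y) = h x \<oplus>\<^bsub>G\<^esub> h y"
    and sm: "\<And>x g. x \<in> carrier E \<Longrightarrow> g \<in> borel_measurable M \<Longrightarrow>
      h (rn_module.sm M E g x) = rn_module.sm M G g (h x)"
    and compl: "rn_complete M E" and f: "f \<in> Cvx M E"
    and fin: "\<And>x. x \<in> carrier E \<Longrightarrow> AE \<omega> in M. rp (f x) \<omega> = ereal (Q x \<omega>)"
    and Q: "\<And>x. x \<in> carrier E \<Longrightarrow> Q x \<in> borel_measurable M"
    and bound: "\<And>x0. x0 \<in> carrier E \<Longrightarrow> \<exists>C\<in>borel_measurable M. \<forall>b\<in>carrier E.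
      AE \<omega> in M. rn_module.N G (h b) \<omega> \<le> max (Q (x0 \<oplus>\<^bsub>E\<^esub> b) \<omega>) (Q (x0 \<ominus>\<^bsub>E\<^esub> b) \<omega>) + C \<omega>"
  shows "continuous_map (rn_topology M E) (rn_topology M G) h"
proof (rule continuous_map_rnI[OF E G h])
  interpret E: rn_module M E by fact
  interpret G: rn_module M G by fact
  fix X x and \<epsilon> :: real assume conv: "E.as_conv X x" and \<epsilon>: "0 < \<epsilon>"
  have c: "X n \<in> carrier E" "x \<in> carrier E" for n using conv by (auto simp: E.as_conv_def)
  \<comment> \<open>Three exceptional events occur, two for Q and one for C, each of probability at
    most \<delta>; together they stay below \<epsilon>.\<close>
  define \<delta> where "\<delta> = \<epsilon> / 4"
  have \<delta>: "0 < \<delta>" using \<epsilon> by (simp add: \<delta>_def)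
  obtain x0 s k where x0: "x0 \<in> carrier E" and s: "0 < s"
    and bd: "\<And>x. x \<in> E.kball x0 s \<Longrightarrow> E.prob {\<omega> \<in> space M. real k < Q x \<omega>} \<le> \<delta>"
    using E.locally_bounded_in_prob[OF compl f fin Q \<delta>] by metis
  obtain C where C [measurable]: "C \<in> borel_measurable M" and le: "\<And>b. b \<in> carrier E \<Longrightarrow>
      AE \<omega> in M. G.N (h b) \<omega> \<le> max (Q (x0 \<oplus>\<^bsub>E\<^esub> b) \<omega>) (Q (x0 \<ominus>\<^bsub>E\<^esub> b) \<omega>) + C \<omega>"
    using bound[OF x0] by blast
  obtain l :: nat where l: "E.prob {\<omega> \<in> space M. real l < C \<omega>} < \<delta>" by (rule E.prob_gt_small[OF C \<delta>])
  define \<kappa> where "\<kappa> = real k + real l + 1"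
  \<comment> \<open>Magnifying by a turns a deviation \<epsilon> of the images into at least 2
    \<kappa>, which exceeds the bound k + l valid outside the exceptional events. The summand 1 in
    \<kappa> keeps it positive.\<close>
  define a where "a = 2 * \<kappa> / \<epsilon>"
  have a: "0 < a" "0 < \<kappa>" using \<epsilon> by (simp_all add: a_def \<kappa>_def)
  define b where "b n = E.sm (\<lambda>_. a) (X n \<ominus>\<^bsub>E\<^esub> x)" for n
  have bc: "b n \<in> carrier E" for n using c by (simp add: b_def)
  have "E.as_conv b \<zero>\<^bsub>E\<^esub>"
  proof -
    have "AE \<omega> in M. E.N (b n) \<omega> = a * E.N (X n \<ominus>\<^bsub>E\<^esub> x) \<omega>" for n
      using E.N_sm[of "\<lambda>_. a" "X n \<ominus>\<^bsub>E\<^esub> x"] c a by (simp add: b_def)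
    then have "AE \<omega> in M. \<forall>n. E.N (b n) \<omega> = a * E.N (X n \<ominus>\<^bsub>E\<^esub> x) \<omega>" by (intro AE_allI)
    moreover have "AE \<omega> in M. (\<lambda>n. E.N (X n \<ominus>\<^bsub>E\<^esub> x) \<omega>) \<longlonglongrightarrow> 0" using conv by (simp add: E.as_conv_def)
    ultimately have "AE \<omega> in M. (\<lambda>n. E.N (b n) \<omega>) \<longlonglongrightarrow> 0"
      by eventually_elim (simp add: tendsto_mult_right_zero)
    then show ?thesis using bc E.minus_zero_right[OF bc] by (auto simp: E.as_conv_def)
  qed
  then have "eventually (\<lambda>n. b n \<in> E.kball \<zero>\<^bsub>E\<^esub> s) sequentially" by (rule E.as_conv_ball) (use s in auto)
  then obtain n where bn: "b n \<in> E.kball \<zero>\<^bsub>E\<^esub> s" by (auto simp: eventually_sequentially)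
  have pm: "x0 \<oplus>\<^bsub>E\<^esub> b n \<in> carrier E" "x0 \<ominus>\<^bsub>E\<^esub> b n \<in> carrier E" using x0 bc by simp_all
  note [measurable] = Q[OF pm(1)] Q[OF pm(2)]
  have m [measurable]: "E.N (b n) \<in> borel_measurable M" "E.N ((x0 \<ominus>\<^bsub>E\<^esub> b n) \<ominus>\<^bsub>E\<^esub> x0) \<in> borel_measurable M"
    "E.N (\<ominus>\<^bsub>E\<^esub> b n) \<in> borel_measurable M"
    using pm x0 bc by (auto intro!: E.N_meas)
  have "(x0 \<oplus>\<^bsub>E\<^esub> b n) \<ominus>\<^bsub>E\<^esub> x0 = b n" "(x0 \<ominus>\<^bsub>E\<^esub> b n) \<ominus>\<^bsub>E\<^esub> x0 = \<ominus>\<^bsub>E\<^esub> b n"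
    using x0 bc by (simp_all add: a_minus_def E.a_comm[of x0] E.a_assoc E.r_neg)
  moreover have "AE \<omega> in M. E.N (\<ominus>\<^bsub>E\<^esub> b n) \<omega> = E.N (b n) \<omega>"
    using E.N_sm[of "\<lambda>_. -1" "b n"] bc by (simp add: E.sm_uminus_one)
  moreover have "E.prob {\<omega> \<in> space M. s \<le> E.N (b n) \<omega>} < s"
    using bn bc E.minus_zero_right[OF bc] by (simp add: E.kball_iff)
  moreover have "E.prob {\<omega> \<in> space M. s \<le> E.N ((x0 \<ominus>\<^bsub>E\<^esub> b n) \<ominus>\<^bsub>E\<^esub> x0) \<omega>} = E.prob {\<omega> \<in> space M. s \<le> E.N (b n) \<omega>}"
    by (rule E.finite_measure_eq_AE) (use calculation(2,3) in \<open>auto elim!: AE_mp\<close>)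
  ultimately have "x0 \<oplus>\<^bsub>E\<^esub> b n \<in> E.kball x0 s" "x0 \<ominus>\<^bsub>E\<^esub> b n \<in> E.kball x0 s"
    using pm by (simp_all add: E.kball_iff x0)
  note b12 = bd[OF this(1)] bd[OF this(2)]
  define Bad where "Bad = ({\<omega> \<in> space M. real k < Q (x0 \<oplus>\<^bsub>E\<^esub> b n) \<omega>} \<union> {\<omega> \<in> space M. real k < Q (x0 \<ominus>\<^bsub>E\<^esub> b n) \<omega>}) \<union> {\<omega> \<in> space M. real l < C \<omega>}"
  have Bm: "Bad \<in> E.events" unfolding Bad_def by measurable
  have Bad: "E.prob Bad < 3 * \<delta>"
  proof -
    have "E.prob Bad \<le> E.prob ({\<omega> \<in> space M. real k < Q (x0 \<oplus>\<^bsub>E\<^esub> b n) \<omega>} \<union> {\<omega> \<in> space M. real k < Q (x0 \<ominus>\<^bsub>E\<^esub> b n) \<omega>})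
        + E.prob {\<omega> \<in> space M. real l < C \<omega>}"
      unfolding Bad_def by (rule measure_Un_le) measurable
    also have "E.prob ({\<omega> \<in> space M. real k < Q (x0 \<oplus>\<^bsub>E\<^esub> b n) \<omega>} \<union> {\<omega> \<in> space M. real k < Q (x0 \<ominus>\<^bsub>E\<^esub> b n) \<omega>})
        \<le> E.prob {\<omega> \<in> space M. real k < Q (x0 \<oplus>\<^bsub>E\<^esub> b n) \<omega>} + E.prob {\<omega> \<in> space M. real k < Q (x0 \<ominus>\<^bsub>E\<^esub> b n) \<omega>}"
      by (rule measure_Un_le) measurable
    finally show ?thesis using b12 l by simp
  qed
  have hX: "h (X n) \<in> carrier G" "h x \<in> carrier G" using c h by auto
  have diff: "h (X n \<ominus>\<^bsub>E\<^esub> x) = h (X n) \<ominus>\<^bsub>G\<^esub> h x"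
    using c h sm[of x "\<lambda>_. -1"] add[of "X n" "\<ominus>\<^bsub>E\<^esub> x"]
    by (simp add: a_minus_def E.sm_uminus_one G.sm_uminus_one)
  have [measurable]: "G.N (h (X n) \<ominus>\<^bsub>G\<^esub> h x) \<in> borel_measurable M" using hX by (intro G.N_meas) simp
  have "h (b n) = G.sm (\<lambda>_. a) (h (X n) \<ominus>\<^bsub>G\<^esub> h x)"
    using c by (simp add: b_def sm diff)
  then have "AE \<omega> in M. G.N (h (b n)) \<omega> = a * G.N (h (X n) \<ominus>\<^bsub>G\<^esub> h x) \<omega>"
    using G.N_sm[of "\<lambda>_. a" "h (X n) \<ominus>\<^bsub>G\<^esub> h x"] hX a by simp
  then have "AE \<omega> in M. \<omega> \<in> {\<omega> \<in> space M. \<epsilon> \<le> G.N (h (X n) \<ominus>\<^bsub>G\<^esub> h x) \<omega>} \<longrightarrow> \<omega> \<in> Bad"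
    using le[OF bc[of n]]
  proof eventually_elim
    case (elim \<omega>)
    show ?case
    proof (rule impI, rule ccontr)
      assume \<omega>: "\<omega> \<in> {\<omega> \<in> space M. \<epsilon> \<le> G.N (h (X n) \<ominus>\<^bsub>G\<^esub> h x) \<omega>}" and "\<omega> \<notin> Bad"
      then have "max (Q (x0 \<oplus>\<^bsub>E\<^esub> b n) \<omega>) (Q (x0 \<ominus>\<^bsub>E\<^esub> b n) \<omega>) + C \<omega> \<le> real k + real l"
        by (auto simp: Bad_def)
      moreover have "a * \<epsilon> \<le> a * G.N (h (X n) \<ominus>\<^bsub>G\<^esub> h x) \<omega>" using \<omega> a by simp
      moreover have "a * \<epsilon> = 2 * \<kappa>" using \<epsilon> by (simp add: a_def)
      ultimately show False using elim by (simp add: \<kappa>_def)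
    qed
  qed
  then have "E.prob {\<omega> \<in> space M. \<epsilon> \<le> G.N (h (X n) \<ominus>\<^bsub>G\<^esub> h x) \<omega>} \<le> E.prob Bad"
    by (rule E.finite_measure_mono_AE[OF _ Bm])
  then have "h (X n) \<in> G.kball (h x) \<epsilon>"
    using Bad \<epsilon> hX by (simp add: G.kball_iff \<delta>_def)
  then show "\<exists>n. h (X n) \<in> G.kball (h x) \<epsilon>" by blast
qed

lemma L0_sm_cv:
  assumes "prob_space M" and [measurable]: "g \<in> borel_measurable M" "a \<in> borel_measurable M" "b \<in> borel_measurable M"
  shows "rn_module.sm M (L0 M) g (rv_class M a) = rv_class M (\<lambda>\<omega>. g \<omega> * a \<omega>)"
    and "rn_module.cv M (L0 M) g (rv_class M a) (rv_class M b) = rv_class M (\<lambda>\<omega>. g \<omega> * a \<omega> + (1 - g \<omega>) * b \<omega>)"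
proof -
  interpret L: rn_module M "L0 M" using assms(1) by (rule rn_module_L0)
  show "L.sm g (rv_class M a) = rv_class M (\<lambda>\<omega>. g \<omega> * a \<omega>)"
    "L.cv g (rv_class M a) (rv_class M b) = rv_class M (\<lambda>\<omega>. g \<omega> * a \<omega> + (1 - g \<omega>) * b \<omega>)"
    by (simp_all add: L.sm_def L.cv_def L0_class_simps)
qed

lemma L0_N:
  assumes "prob_space M" and a: "a \<in> borel_measurable M"
  shows "AE \<omega> in M. rn_module.N (L0 M) (rv_class M a) \<omega> = \<bar>a \<omega>\<bar>"
proof -
  interpret L: rn_module M "L0 M" using assms(1) by (rule rn_module_L0)
  show ?thesis
    unfolding L.N_def L0_abs_class(1)[OF a] by (rule rp_rv_class) (use a in simp)
qed


section \<open>The form of a stable order preserving involution\<close>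

context stable_involution
begin

lemma T_at_\<phi>:
  assumes f: "f \<in> Cvx M E" and x: "x \<in> carrier E"
  shows "AE \<omega> in M. rp (T f (\<phi> x)) \<omega> = rp (f x) \<omega> + ereal (offset x \<omega>)"
proof -
  have le: "AE \<omega> in M. rp (T f (\<phi> x)) \<omega> \<le> rp (f x) \<omega> + ereal (offset x \<omega>)"
    if f: "f \<in> Cvx M E" and x: "x \<in> carrier E" for f x
  proof -
    obtain d where d: "d \<in> carrier E" and fd: "AE \<omega> in M. rp (f d) \<omega> < \<infinity>" by (rule Cvx_dom[OF f])
    have [measurable]: "rp (f x) \<in> borel_measurable M" by (rule Cvx_meas[OF f x])
    define B where "B = {\<omega> \<in> space M. rp (f x) \<omega> < \<infinity>}"
    have B: "B \<in> events" unfolding B_def by measurable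
    have [measurable]: "indicat_real B \<in> borel_measurable M" using B by simp
    \<comment> \<open>Where f x is infinite nothing is claimed, so x may be replaced there by a
      point d of the domain; then f z is a real random variable to which \<open>T_le_pt_iff\<close>
      applies.\<close>
    define z where "z = cmb B x d"
    have z: "z \<in> carrier E" using x d by (simp add: z_def)
    have zN: "AE \<omega> in M. N (z \<ominus> x) \<omega> = (if \<omega> \<in> B then N (x \<ominus> x) \<omega> else N (d \<ominus> x) \<omega>)"
      "AE \<omega> in M. N (z \<ominus> d) \<omega> = (if \<omega> \<in> B then N (x \<ominus> d) \<omega> else N (d \<ominus> d) \<omega>)"
      unfolding z_def by (intro N_cmb_minus B x d)+
    define r where "r = (\<lambda>\<omega>. real_of_ereal (rp (f z) \<omega>))"
    have r [measurable]: "r \<in> borel_measurable M" unfolding r_def using Cvx_meas[OF f z] by measurable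
    have fr: "AE \<omega> in M. rp (f z) \<omega> = ereal (r \<omega>)"
      using fd Cvx_gt_MInfty[OF f z] zN Cvx_local[OF f z x] Cvx_local[OF f z d] N_minus_self[OF x]
        N_minus_self[OF d] AE_space
      by eventually_elim (auto simp: r_def ereal_real B_def split: if_splits)
    then have "AE \<omega> in M. rp (f z) \<omega> \<le> ereal (r \<omega>)" by eventually_elim simp
    then have "AE \<omega> in M. rp (T f (\<phi> z)) \<omega> \<le> ereal (\<psi> z r \<omega>)" using T_le_pt_iff[OF f z r] by blast
    moreover have "AE \<omega> in M. N (z \<ominus> x) \<omega> = 0 \<longrightarrow> offset z \<omega> = offset x \<omega>"
      using \<psi>_local[OF z x, of "\<lambda>_. 0" "\<lambda>_. 0"] by (simp add: offset_def)
    ultimately show ?thesis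
      using \<psi>_translation[OF z r] fr Cvx_local[OF f z x] \<phi>_local[OF z x]
        Cvx_local[OF T_Cvx[OF f] \<phi>_closed[OF z] \<phi>_closed[OF x]]
        zN(1) N_minus_self[OF x] AE_space
    proof eventually_elim
      case (elim \<omega>)
      show ?case
      proof (cases "\<omega> \<in> B")
        case True
        then have "N (z \<ominus> x) \<omega> = 0" using elim by simp
        then show ?thesis using elim by simp
      qed (use elim in \<open>simp add: B_def\<close>)
    qed
  qed
  \<comment> \<open>The inequality for T f at \<phi> x, with T T f = f and the offset changing sign,
    is the reverse inequality.\<close>
  show ?thesis
    using le[OF f x] le[OF T_Cvx[OF f] \<phi>_closed[OF x]] offset_\<phi>[OF x]
    unfolding \<phi>_\<phi>[OF x] T_T[OF f]
  proof eventually_elim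
    case (elim \<omega>)
    then show ?case by (cases "rp (f x) \<omega>"; cases "rp (T f (\<phi> x)) \<omega>") auto
  qed
qed

lemma T_eq:
  assumes f: "f \<in> Cvx M E" and x: "x \<in> carrier E"
  shows "AE \<omega> in M. rp (T f x) \<omega> = rp (f (\<phi> x)) \<omega> + ereal (- offset x \<omega>)"
  using T_at_\<phi>[OF f \<phi>_closed[OF x]] offset_\<phi>[OF x] unfolding \<phi>_\<phi>[OF x] by eventually_elim simp

definition H :: "'b \<Rightarrow> 'b" where
  "H x = \<phi> x \<ominus> \<phi> \<zero>"

text \<open>The linear part of the negative offset; the sign is that of the offset in
  \<open>T_eq\<close>.\<close>

definition v :: "'b \<Rightarrow> 'a \<Rightarrow> real" where
  "v x \<omega> = offset \<zero> \<omega> - offset x \<omega>"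

lemma v_meas [measurable]: "x \<in> carrier E \<Longrightarrow> v x \<in> borel_measurable M"
  unfolding v_def[abs_def] by (intro borel_measurable_diff offset_meas) simp_all

lemma H_closed [simp, intro]: "x \<in> carrier E \<Longrightarrow> H x \<in> carrier E"
  by (simp add: H_def)

lemma \<phi>_eq: "x \<in> carrier E \<Longrightarrow> \<phi> x = H x \<oplus> \<phi> \<zero>"
  by (simp add: H_def a_minus_def a_assoc l_neg)

lemma H_add: "x \<in> carrier E \<Longrightarrow> y \<in> carrier E \<Longrightarrow> H (x \<oplus> y) = H x \<oplus> H y"
  and H_sm: "x \<in> carrier E \<Longrightarrow> g \<in> borel_measurable M \<Longrightarrow> H (sm g x) = sm g (H x)"
  unfolding H_def
  by (rule affine_imp_hom[OF rn_module_axioms rn_module_axioms, of \<phi>]; simp add: \<phi>_offset_cv(1))+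

lemma class_v:
  "x \<in> carrier E \<Longrightarrow> rv_class M (v x) = rv_class M (\<lambda>\<omega>. - offset x \<omega>) \<ominus>\<^bsub>L0 M\<^esub> rv_class M (\<lambda>\<omega>. - offset \<zero> \<omega>)"
  by (simp add: L0_minus_class v_def[abs_def] offset_meas)

text \<open>\<open>affine_imp_hom\<close> with \<open>L0 M\<close> itself as target module, applied
  to the class of the negative offset.\<close>

lemma v_add_class: "x \<in> carrier E \<Longrightarrow> y \<in> carrier E \<Longrightarrow>
      rv_class M (v (x \<oplus> y)) = rv_class M (v x) \<oplus>\<^bsub>L0 M\<^esub> rv_class M (v y)"
  and v_sm_class: "x \<in> carrier E \<Longrightarrow> g \<in> borel_measurable M \<Longrightarrow>
      rv_class M (v (sm g x)) = rn_module.sm M (L0 M) g (rv_class M (v x))"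
proof -
  let ?F = "\<lambda>x. rv_class M (\<lambda>\<omega>. - offset x \<omega>)"
  have L: "rn_module M (L0 M)" by (rule rn_module_L0[OF prob_space_axioms])
  have aff: "?F (cv g x y) = rn_module.cv M (L0 M) g (?F x) (?F y)"
    if x: "x \<in> carrier E" "y \<in> carrier E" and g: "g \<in> borel_measurable M" "AE \<omega> in M. 0 < g \<omega>" "AE \<omega> in M. g \<omega> < 1" for x y g
  proof -
    note [measurable] = offset_meas[OF x(1)] offset_meas[OF x(2)] offset_meas[OF cv_closed[OF g(1) x]] g(1)
    have "?F (cv g x y) = rv_class M (\<lambda>\<omega>. g \<omega> * - offset x \<omega> + (1 - g \<omega>) * - offset y \<omega>)"
      by (rule rv_class_cong) (use \<phi>_offset_cv(2)[OF x g] in \<open>auto elim!: AE_mp\<close>)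
    then show ?thesis by (simp add: L0_sm_cv[OF prob_space_axioms])
  qed
  have F: "?F x \<in> carrier (L0 M)" if "x \<in> carrier E" for x using offset_meas[OF that] by auto
  show "rv_class M (v (x \<oplus> y)) = rv_class M (v x) \<oplus>\<^bsub>L0 M\<^esub> rv_class M (v y)"
    if "x \<in> carrier E" "y \<in> carrier E"
  proof -
    have "?F (x \<oplus> y) \<ominus>\<^bsub>L0 M\<^esub> ?F \<zero> = (?F x \<ominus>\<^bsub>L0 M\<^esub> ?F \<zero>) \<oplus>\<^bsub>L0 M\<^esub> (?F y \<ominus>\<^bsub>L0 M\<^esub> ?F \<zero>)"
      by (rule affine_imp_hom(1)[OF rn_module_axioms L, of ?F]) (fact F aff that)+
    then show ?thesis using that by (simp add: class_v)
  qed
  show "rv_class M (v (sm g x)) = rn_module.sm M (L0 M) g (rv_class M (v x))"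
    if "x \<in> carrier E" "g \<in> borel_measurable M"
  proof -
    have "?F (sm g x) \<ominus>\<^bsub>L0 M\<^esub> ?F \<zero> = rn_module.sm M (L0 M) g (?F x \<ominus>\<^bsub>L0 M\<^esub> ?F \<zero>)"
      by (rule affine_imp_hom(2)[OF rn_module_axioms L, of ?F]) (fact F aff that)+
    then show ?thesis using that by (simp add: class_v)
  qed
qed

lemma v_add:
  assumes x: "x \<in> carrier E" "y \<in> carrier E"
  shows "AE \<omega> in M. v (x \<oplus> y) \<omega> = v x \<omega> + v y \<omega>"
proof -
  note [measurable] = v_meas[OF x(1)] v_meas[OF x(2)] v_meas[OF a_closed[OF x]]
  show ?thesis
    using v_add_class[OF x] by (simp add: L0_class_simps rv_class_eq_iff)
qed

lemma v_minus:
  assumes x: "x \<in> carrier E" "y \<in> carrier E"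
  shows "AE \<omega> in M. v (x \<ominus> y) \<omega> = v x \<omega> - v y \<omega>"
proof -
  have e: "(x \<ominus> y) \<oplus> y = x" using x by (simp add: a_minus_def a_assoc l_neg)
  show ?thesis using v_add[OF minus_closed[OF x] x(2)] unfolding e by eventually_elim simp
qed

lemma offset_v: "offset x \<omega> = offset \<zero> \<omega> - v x \<omega>"
  by (simp add: v_def)

text \<open>The finite convex function is the image of the norm, N (\<phi> x) - offset x. The points
  \<phi> (y + b) and \<phi> (y - b) differ by 2 H b, and their offsets have mean
  \<open>offset \<zero> - v y\<close>, which is the correction C.\<close>

lemma H_continuous:
  assumes compl: "rn_complete M E"
  shows "continuous_map (rn_topology M E) (rn_topology M E) H"
proof (rule hom_continuous[OF rn_module_axioms rn_module_axioms H_closed H_add H_sm compl])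
  show "T (fn (\<lambda>x \<omega>. ereal (N x \<omega>))) \<in> Cvx M E" by (rule T_Cvx[OF norm_fn_Cvx])
  show "AE \<omega> in M. rp (T (fn (\<lambda>x \<omega>. ereal (N x \<omega>))) x) \<omega> = ereal (N (\<phi> x) \<omega> - offset x \<omega>)" if x: "x \<in> carrier E" for x
  proof -
    have "(\<lambda>\<omega>. ereal (N (\<phi> x) \<omega>)) \<in> borel_measurable M" using N_meas[OF \<phi>_closed[OF x]] by simp
    from fn_rp[of "\<phi> x" "\<lambda>x \<omega>. ereal (N x \<omega>)", OF \<phi>_closed[OF x] this] T_eq[OF norm_fn_Cvx x]
    show ?thesis by eventually_elim simp
  qed
  show "(\<lambda>\<omega>. N (\<phi> x) \<omega> - offset x \<omega>) \<in> borel_measurable M" if "x \<in> carrier E" for x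
    by (intro borel_measurable_diff N_meas offset_meas \<phi>_closed that)
  fix y assume y: "y \<in> carrier E"
  show "\<exists>C\<in>borel_measurable M. \<forall>b\<in>carrier E. AE \<omega> in M. N (H b) \<omega> \<le>
      max (N (\<phi> (y \<oplus> b)) \<omega> - offset (y \<oplus> b) \<omega>) (N (\<phi> (y \<ominus> b)) \<omega> - offset (y \<ominus> b) \<omega>) + C \<omega>"
  proof (intro bexI ballI)
    fix b assume b: "b \<in> carrier E"
    have c: "y \<oplus> b \<in> carrier E" "y \<ominus> b \<in> carrier E" using y b by simp_all
    have "(y \<ominus> b) \<oplus> (b \<oplus> b) = y \<oplus> b"
      using y b by (simp add: a_minus_def a_assoc r_neg1)
    then have "H (y \<oplus> b) = H (y \<ominus> b) \<oplus> H (b \<oplus> b)"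
      using H_add[OF c(2), of "b \<oplus> b"] b by simp
    moreover have "b \<oplus> b = sm (\<lambda>_. 2) b"
      using sm_add_left[of "\<lambda>_. 1" "\<lambda>_. 1" b] b by (simp add: sm_one)
    ultimately have e: "H (y \<oplus> b) = H (y \<ominus> b) \<oplus> sm (\<lambda>_. 2) (H b)"
      using b by (simp add: H_sm)
    have "\<phi> (y \<oplus> b) = sm (\<lambda>_. 2) (H b) \<oplus> \<phi> (y \<ominus> b)"
      unfolding \<phi>_eq[OF c(1)] \<phi>_eq[OF c(2)] e using c b by (simp add: a_ac)
    then have "\<phi> (y \<oplus> b) \<ominus> \<phi> (y \<ominus> b) = sm (\<lambda>_. 2) (H b)"
      using c b by (simp add: a_minus_def a_assoc r_neg)
    then have 2: "AE \<omega> in M. N (\<phi> (y \<oplus> b) \<ominus> \<phi> (y \<ominus> b)) \<omega> = 2 * N (H b) \<omega>"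
      using N_sm[of "\<lambda>_. 2" "H b"] b by simp
    have "AE \<omega> in M. N (\<phi> (y \<oplus> b) \<ominus> \<phi> (y \<ominus> b)) \<omega> \<le> N (\<phi> (y \<oplus> b) \<ominus> \<zero>) \<omega> + N (\<zero> \<ominus> \<phi> (y \<ominus> b)) \<omega>"
      by (rule N_triangle_minus) (use c in auto)
    moreover have "AE \<omega> in M. N (\<zero> \<ominus> \<phi> (y \<ominus> b)) \<omega> = N (\<phi> (y \<ominus> b) \<ominus> \<zero>) \<omega>"
      by (rule N_minus_commute) (use c in auto)
    ultimately show "AE \<omega> in M. N (H b) \<omega> \<le>
      max (N (\<phi> (y \<oplus> b)) \<omega> - offset (y \<oplus> b) \<omega>) (N (\<phi> (y \<ominus> b)) \<omega> - offset (y \<ominus> b) \<omega>) + (offset \<zero> \<omega> - v y \<omega>)"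
      using 2 v_add[OF y b] v_minus[OF y b]
      unfolding minus_zero_right[OF \<phi>_closed[OF c(1)]] minus_zero_right[OF \<phi>_closed[OF c(2)]]
      by eventually_elim (simp add: offset_v[of "y \<oplus> b"] offset_v[of "y \<ominus> b"])
  qed (intro borel_measurable_diff offset_meas v_meas y zero_closed)
qed

text \<open>The finite convex function is now - offset. Its values at y + b and y - b are v y -
  offset 0 plus and minus v b, so their maximum determines |v b|.\<close>

lemma v_continuous:
  assumes compl: "rn_complete M E"
  shows "continuous_map (rn_topology M E) (rn_topology M (L0 M)) (\<lambda>x. rv_class M (v x))"
proof (rule hom_continuous[OF rn_module_axioms rn_module_L0[OF prob_space_axioms] _ v_add_class v_sm_class compl])
  show "rv_class M (v x) \<in> carrier (L0 M)" if "x \<in> carrier E" for x using v_meas[OF that] by auto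
  show "T (fn (\<lambda>x \<omega>. 0)) \<in> Cvx M E" by (rule T_Cvx[OF zero_fn_Cvx])
  show "AE \<omega> in M. rp (T (fn (\<lambda>x \<omega>. 0)) x) \<omega> = ereal (- offset x \<omega>)" if x: "x \<in> carrier E" for x
    using fn_rp[of "\<phi> x" "\<lambda>x \<omega>. 0", OF \<phi>_closed[OF x]] T_eq[OF zero_fn_Cvx x] by (auto elim!: AE_mp)
  show "(\<lambda>\<omega>. - offset x \<omega>) \<in> borel_measurable M" if "x \<in> carrier E" for x
    using offset_meas[OF that] by simp
  fix y assume y: "y \<in> carrier E"
  show "\<exists>C\<in>borel_measurable M. \<forall>b\<in>carrier E. AE \<omega> in M. rn_module.N (L0 M) (rv_class M (v b)) \<omega> \<le>
      max (- offset (y \<oplus> b) \<omega>) (- offset (y \<ominus> b) \<omega>) + C \<omega>"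
  proof (intro bexI ballI)
    fix b assume b: "b \<in> carrier E"
    show "AE \<omega> in M. rn_module.N (L0 M) (rv_class M (v b)) \<omega> \<le>
      max (- offset (y \<oplus> b) \<omega>) (- offset (y \<ominus> b) \<omega>) + (offset \<zero> \<omega> - v y \<omega>)"
      using L0_N[OF prob_space_axioms v_meas[OF b]] v_add[OF y b] v_minus[OF y b]
    proof eventually_elim
      case (elim \<omega>)
      then show ?case unfolding offset_v[of "y \<oplus> b"] offset_v[of "y \<ominus> b"] by simp
    qed
  qed (intro borel_measurable_diff offset_meas v_meas y zero_closed)
qed

lemma representation:
  assumes compl: "rn_complete M E"
  shows "\<exists>c \<in> carrier E. \<exists>w \<in> carrier (rn_dual M E). \<exists>H \<in> cont_module_auto M E.
      (\<forall>x\<in>carrier E. H (H x) = x) \<and>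
      c \<in> a_kernel E E (\<lambda>x. H x \<oplus> x) \<and>
      w \<in> a_kernel (rn_dual M E) (rn_dual M E) (\<lambda>u. rn_adjoint E H u \<oplus>\<^bsub>rn_dual M E\<^esub> u) \<and>
      (\<forall>f\<in>Cvx M E. \<forall>x\<in>carrier E.
        T f x = L0bar_add M (f (H x \<oplus> c))
          (to_L0bar M (w x \<ominus>\<^bsub>L0 M\<^esub> (rv_const M (1/2) \<otimes>\<^bsub>L0 M\<^esub> w c))))"
proof -
  let ?c = "\<phi> \<zero>"
  define w where "w = (\<lambda>x\<in>carrier E. rv_class M (v x))"
  have c: "?c \<in> carrier E" by simp
  have wx: "w x = rv_class M (v x)" if "x \<in> carrier E" for x using that by (simp add: w_def)
  have wr: "w x \<in> rv M" "AE \<omega> in M. rp (w x) \<omega> = v x \<omega>" if "x \<in> carrier E" for x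
    using v_meas[OF that] by (auto simp: wx that intro: rp_rv_class)
  have Hc: "H ?c \<oplus> ?c = \<zero>" using \<phi>_eq[OF c] \<phi>_\<phi>[of \<zero>] by simp
  have HH: "H (H x) = x" if x: "x \<in> carrier E" for x
  proof -
    have "x = \<phi> (H x \<oplus> ?c)" using \<phi>_\<phi>[OF x] \<phi>_eq[OF x] by simp
    also have "\<dots> = H (H x) \<oplus> (H ?c \<oplus> ?c)"
      using x \<phi>_eq[of "H x \<oplus> ?c"] by (simp add: H_add a_assoc)
    finally show ?thesis using Hc x by simp
  qed
  \<comment> \<open>This is where the half comes from: the offset changes sign under \<phi>, so w c
    is twice the offset at zero and - offset x = w x - w c / 2.\<close>
  have v_c: "AE \<omega> in M. v ?c \<omega> = 2 * offset \<zero> \<omega>"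
    using offset_\<phi>[of \<zero>] by (auto simp: v_def elim!: AE_mp)
  \<comment> \<open>Compare two expressions for v (\<phi> x): additivity gives v (H x) + 2 * offset
    0, the sign change of the offset gives 2 * offset 0 - v x.\<close>
  have vH: "AE \<omega> in M. v (H x) \<omega> = - v x \<omega>" if x: "x \<in> carrier E" for x
    using v_add[OF H_closed[OF x] c] v_c offset_\<phi>[OF x] unfolding \<phi>_eq[OF x, symmetric]
    by eventually_elim (simp add: v_def)
  have Hhom: "H \<in> cont_module_hom M E E"
    unfolding cont_module_hom_def
    using H_continuous[OF compl] by (auto simp: H_add H_sm smult_eq_sm rp_measurable)
  have "bij_betw H (carrier E) (carrier E)"
    by (rule bij_betwI[where g = H]) (auto simp: HH)
  with Hhom have auto: "H \<in> cont_module_auto M E" by (simp add: cont_module_auto_def)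
  have whom: "w \<in> carrier (rn_dual M E)"
  proof -
    interpret L: rn_module M "L0 M" by (rule rn_module_L0[OF prob_space_axioms])
    have "continuous_map (rn_topology M E) (rn_topology M (L0 M)) w"
      by (rule continuous_map_eq[OF v_continuous[OF compl]]) (simp add: topspace_rn_topology wx)
    then show ?thesis
      using wr(1) by (auto simp: rn_dual_def cont_module_hom_def wx v_add_class smult_eq_sm L.smult_eq_sm
        v_sm_class rp_measurable sm_closed) (simp_all add: w_def)
  qed
  show ?thesis
  proof (intro bexI[OF _ c] bexI[OF _ whom] bexI[OF _ auto] conjI ballI)
    show "H (H x) = x" if "x \<in> carrier E" for x by (rule HH[OF that])
    show "?c \<in> a_kernel E E (\<lambda>x. H x \<oplus> x)" using Hc by (simp add: a_kernel_def')
    have "w (H x) \<oplus>\<^bsub>L0 M\<^esub> w x = \<zero>\<^bsub>L0 M\<^esub>" if x: "x \<in> carrier E" for x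
    proof -
      note [measurable] = v_meas[OF x] v_meas[OF H_closed[OF x]]
      show ?thesis
        using x vH[OF x] by (simp add: wx L0_class_simps L0_zero rv_class_eq_iff) (auto elim!: AE_mp)
    qed
    then have "(\<lambda>x\<in>carrier E. w (H x) \<oplus>\<^bsub>L0 M\<^esub> w x) = (\<lambda>x\<in>carrier E. \<zero>\<^bsub>L0 M\<^esub>)"
      by (intro restrict_ext) simp
    then show "w \<in> a_kernel (rn_dual M E) (rn_dual M E) (\<lambda>u. rn_adjoint E H u \<oplus>\<^bsub>rn_dual M E\<^esub> u)"
      using whom by (simp add: a_kernel_def' rn_dual_def rn_adjoint_def cong: restrict_cong)
    fix f x assume f: "f \<in> Cvx M E" and x: "x \<in> carrier E"
    have half: "rv_const M (1/2::real) \<in> rv M" by (rule rv_const_rv)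
    note m = L0_closed(2)[OF half wr(1)[OF c]]
    note d = L0_closed(3)[OF wr(1)[OF x] m]
    note fr = Cvx_rv[OF f \<phi>_closed[OF x]]
    have "AE \<omega> in M. rp (T f x) \<omega> = rp (L0bar_add M (f (\<phi> x))
        (to_L0bar M (w x \<ominus>\<^bsub>L0 M\<^esub> (rv_const M (1/2) \<otimes>\<^bsub>L0 M\<^esub> w ?c)))) \<omega>"
      using T_eq[OF f x] L0bar_add_rp(2)[OF fr to_L0bar_rp(1)[OF d]] to_L0bar_rp(2)[OF d]
        L0_minus_rp[OF wr(1)[OF x] m] L0_mult_rp[OF half wr(1)[OF c]] rp_rv_const[of M "1/2::real"]
        wr(2)[OF x] wr(2)[OF c] v_c
      by eventually_elim (simp add: offset_v[of x])
    then show "T f x = L0bar_add M (f (H x \<oplus> ?c))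
          (to_L0bar M (w x \<ominus>\<^bsub>L0 M\<^esub> (rv_const M (1/2) \<otimes>\<^bsub>L0 M\<^esub> w ?c)))"
      unfolding \<phi>_eq[OF x, symmetric]
      using rv_eq_iff[OF Cvx_rv[OF T_Cvx[OF f] x] L0bar_add_rp(1)[OF fr to_L0bar_rp(1)[OF d]]] by blast
  qed
qed

end

text \<open>Stability and monotonicity hold because T evaluates f at another point and adds a finite
  random variable independent of f; only the involution property uses the kernel conditions.\<close>

lemma (in rn_module) stable_involutionI:
  fixes T :: "('e \<Rightarrow> ('w \<Rightarrow> ereal) set) \<Rightarrow> 'e \<Rightarrow> ('w \<Rightarrow> ereal) set"
  assumes T: "T \<in> Cvx M E \<rightarrow> Cvx M E"
    and c: "c \<in> carrier E" and w: "w \<in> carrier (rn_dual M E)" and H: "H \<in> cont_module_auto M E"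
    and HH: "\<forall>x\<in>carrier E. H (H x) = x" and cK: "c \<in> a_kernel E E (\<lambda>x. H x \<oplus> x)"
    and wK: "w \<in> a_kernel (rn_dual M E) (rn_dual M E) (\<lambda>u. rn_adjoint E H u \<oplus>\<^bsub>rn_dual M E\<^esub> u)"
    and T_eq: "\<forall>f\<in>Cvx M E. \<forall>x\<in>carrier E. T f x = L0bar_add M (f (H x \<oplus> c))
          (to_L0bar M (w x \<ominus>\<^bsub>L0 M\<^esub> (rv_const M (1/2) \<otimes>\<^bsub>L0 M\<^esub> w c)))"
  shows "stable_op M E T \<and> order_preserving_op M E T \<and> involution_op M E T"
proof -
  have TC: "T f \<in> Cvx M E" if "f \<in> Cvx M E" for f using T that by blast
  have Hx: "H x \<in> carrier E" if "x \<in> carrier E" for x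
    using H that by (auto simp: cont_module_auto_def cont_module_hom_def)
  have Hadd: "H (x \<oplus> y) = H x \<oplus> H y" if "x \<in> carrier E" "y \<in> carrier E" for x y
    using H that by (auto simp: cont_module_auto_def cont_module_hom_def)
  have wx: "w x \<in> rv M" if "x \<in> carrier E" for x
    using w that by (auto simp: rn_dual_def cont_module_hom_def)
  have wadd: "w (x \<oplus> y) = w x \<oplus>\<^bsub>L0 M\<^esub> w y" if "x \<in> carrier E" "y \<in> carrier E" for x y
    using w that by (auto simp: rn_dual_def cont_module_hom_def)
  have Hc: "H c \<oplus> c = \<zero>" using cK by (simp add: a_kernel_def')
  have wH: "w (H x) \<oplus>\<^bsub>L0 M\<^esub> w x = \<zero>\<^bsub>L0 M\<^esub>" if x: "x \<in> carrier E" for x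
  proof -
    have "(\<lambda>x\<in>carrier E. rn_adjoint E H w x \<oplus>\<^bsub>L0 M\<^esub> w x) = (\<lambda>x\<in>carrier E. \<zero>\<^bsub>L0 M\<^esub>)"
      using wK by (simp add: a_kernel_def' rn_dual_def)
    from fun_cong[OF this, of x] show ?thesis using x by (simp add: rn_adjoint_def)
  qed
  have p: "H x \<oplus> c \<in> carrier E" if "x \<in> carrier E" for x using that Hx c by simp
  have Trp: "AE \<omega> in M. rp (T f x) \<omega> = rp (f (H x \<oplus> c)) \<omega> + ereal (rp (w x) \<omega> - rp (w c) \<omega> / 2)"
    if f: "f \<in> Cvx M E" and x: "x \<in> carrier E" for f x
  proof -
    have half: "rv_const M (1/2::real) \<in> rv M" by (rule rv_const_rv)
    note m = L0_closed(2)[OF half wx[OF c]]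
    note d = L0_closed(3)[OF wx[OF x] m]
    note fr = Cvx_rv[OF f p[OF x]]
    have eq: "T f x = L0bar_add M (f (H x \<oplus> c))
          (to_L0bar M (w x \<ominus>\<^bsub>L0 M\<^esub> (rv_const M (1/2) \<otimes>\<^bsub>L0 M\<^esub> w c)))"
      using T_eq f x by blast
    show ?thesis
      unfolding eq
      using L0bar_add_rp(2)[OF fr to_L0bar_rp(1)[OF d]] to_L0bar_rp(2)[OF d]
        L0_minus_rp[OF wx[OF x] m] L0_mult_rp[OF half wx[OF c]] rp_rv_const[of M "1/2::real"]
      by eventually_elim simp
  qed
  have "T (paste M E A f g) = paste M E A (T f) (T g)"
    if A: "A \<in> events" and f: "f \<in> Cvx M E" and g: "g \<in> Cvx M E" for A f g
  proof (rule Cvx_eqI)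
    show "T (paste M E A f g) \<in> Cvx M E" "paste M E A (T f) (T g) \<in> Cvx M E"
      using A f g TC paste_Cvx by auto
    fix x assume x: "x \<in> carrier E"
    show "AE \<omega> in M. rp (T (paste M E A f g) x) \<omega> = rp (paste M E A (T f) (T g) x) \<omega>"
      using Trp[OF paste_Cvx[OF f g A] x] paste_rp(2)[OF f g A p[OF x]] paste_rp(2)[OF TC[OF f] TC[OF g] A x]
        Trp[OF f x] Trp[OF g x]
      by eventually_elim simp
  qed
  moreover have "fun_le M E (T f) (T g)" if f: "f \<in> Cvx M E" and g: "g \<in> Cvx M E" and le: "fun_le M E f g" for f g
    unfolding fun_le_iff[OF TC[OF f] TC[OF g]]
  proof
    fix x assume x: "x \<in> carrier E"
    have "AE \<omega> in M. rp (f (H x \<oplus> c)) \<omega> \<le> rp (g (H x \<oplus> c)) \<omega>"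
      using le p[OF x] unfolding fun_le_iff[OF f g] by blast
    then show "AE \<omega> in M. rp (T f x) \<omega> \<le> rp (T g x) \<omega>"
      using Trp[OF f x] Trp[OF g x] by eventually_elim (simp add: add_right_mono)
  qed
  moreover have "T (T f) = f" if f: "f \<in> Cvx M E" for f
  proof (rule Cvx_eqI[OF TC[OF TC[OF f]] f])
    fix x assume x: "x \<in> carrier E"
    have e: "H (H x \<oplus> c) \<oplus> c = x"
      using Hc HH x Hx c by (simp add: Hadd a_assoc)
    have wHx: "AE \<omega> in M. rp (w (H x)) \<omega> + rp (w x) \<omega> = 0"
      using L0_add_rp[OF wx[OF Hx[OF x]] wx[OF x]] L0_zero_rp[of M] unfolding wH[OF x] by eventually_elim simp
    have wp: "AE \<omega> in M. rp (w (H x \<oplus> c)) \<omega> = rp (w (H x)) \<omega> + rp (w c) \<omega>"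
      using L0_add_rp[OF wx[OF Hx[OF x]] wx[OF c]] wadd[OF Hx[OF x] c] by simp
    show "AE \<omega> in M. rp (T (T f) x) \<omega> = rp (f x) \<omega>"
      using Trp[OF TC[OF f] x] Trp[OF f p[OF x]] wHx wp unfolding e
    proof eventually_elim
      case (elim \<omega>)
      \<comment> \<open>The added terms cancel: w (H x + c) = - w x + w c, and the two halves of w c
        taken off by the two applications of T account for the remaining w c.\<close>
      have "rp (w (H x \<oplus> c)) \<omega> - rp (w c) \<omega> / 2 + (rp (w x) \<omega> - rp (w c) \<omega> / 2) = 0" using elim by simp
      then show ?case using elim by (simp add: add.assoc)
    qed
  qed
  ultimately show ?thesis
    by (simp add: stable_op_def order_preserving_op_def involution_op_def)
qed

theorem corollary1:
  fixes M :: "'w measure"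
    and E :: "('w, 'e) rn_module"
    and T :: "('e \<Rightarrow> ('w \<Rightarrow> ereal) set) \<Rightarrow> 'e \<Rightarrow> ('w \<Rightarrow> ereal) set"
  assumes "rn_module M E"
    and "rn_complete M E"
    and "full_support M E"
    and "T \<in> Cvx M E \<rightarrow> Cvx M E"
  shows "(stable_op M E T \<and> order_preserving_op M E T \<and> involution_op M E T) \<longleftrightarrow>
    (\<exists>c \<in> carrier E. \<exists>w \<in> carrier (rn_dual M E). \<exists>H \<in> cont_module_auto M E.
      (\<forall>x\<in>carrier E. H (H x) = x) \<and>
      c \<in> a_kernel E E (\<lambda>x. H x \<oplus>\<^bsub>E\<^esub> x) \<and>
      w \<in> a_kernel (rn_dual M E) (rn_dual M E) (\<lambda>u. rn_adjoint E H u \<oplus>\<^bsub>rn_dual M E\<^esub> u) \<and>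
      (\<forall>f\<in>Cvx M E. \<forall>x\<in>carrier E.
        T f x = L0bar_add M (f (H x \<oplus>\<^bsub>E\<^esub> c))
          (to_L0bar M (w x \<ominus>\<^bsub>L0 M\<^esub> (rv_const M (1/2) \<otimes>\<^bsub>L0 M\<^esub> w c)))))"
    (is "?op \<longleftrightarrow> ?rep")
proof
  interpret rn_module M E by fact
  assume ?op
  then have "stable_involution M E T"
    using assms(4) full_support_nonvanishing[OF assms(2,3)]
    by unfold_locales (auto simp: stable_op_def order_preserving_op_def involution_op_def)
  then show ?rep using assms(2) by (rule stable_involution.representation)
next
  interpret rn_module M E by fact
  assume ?rep
  then show ?op using stable_involutionI[OF assms(4)] by blast
qed

end
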